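(* Let $P$ be an upper stable C*-property and let $A$ be a C*-algebra. Then: (i) $\ll_{\mathsf{G}P}\,=\,\ll_P^{\triangleright}$ in $\mathrm{Id}_A$, so that $\ll_{\mathsf{G}P}$ is an $\mathbf{R}$-order in $\mathrm{Id}_A$; (ii) $\ll_{\mathsf{NG}P}\,=\,\overleftarrow{\ll_P}$ in $\mathrm{Id}_A$, so that $\ll_{\mathsf{NG}P}$ is a dual $\mathbf{R}$-order in $\mathrm{Id}_A$; (iii) $\mathfrak{r}_P^{\triangleright}(A)=\mathfrak{r}_{\mathsf{G}P}(A)=\mathfrak{p}_{\mathsf{NG}P}(A)$.
   Context: For a C*-algebra $A$, $\mathrm{Id}_A$ is the complete lattice of all closed two-sided ideals of $A$ (called ideals), ordered by inclusion, with supremum $\overline{\sum_{I\in G}I}$ and infimum $\bigcap_{I\in G}I$ for $G\subseteq\mathrm{Id}_A$. A C*-property is a class $P$ of C*-algebras with $\{0\}\in P$ that is closed under *-isomorphism; ideals belonging to $P$ are called $P$-ideals. $P$ is upper stable if $A\in P$ implies $A/I\in P$ for all $I\in\mathrm{Id}_A$. For any C*-property $P$, the relation $\ll_P$ in $\mathrm{Id}_A$ is: $I\ll_P J$ iff $I\subseteq J$ and $J/I\in P$. $\mathsf{G}P$ is the C*-property of all C*-algebras $A$ such that $A=\{0\}$ or each non-zero quotient $A/I$ has a non-zero $P$-ideal. $\mathsf{NG}P$ is the C*-property of all C*-algebras having no non-zero $P$-ideals. Let $(Q,\le)$ be a complete lattice with least element $\mathbf 0$ and greatest element $\mathbf 1$;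 relations $\ll$ in $Q$ are reflexive and satisfy $a\ll b\Rightarrow a\le b$. Put $[a,\ll]=\{x: a\ll x\}$, $[\ll,b]=\{x:x\ll b\}$, $[a,b]=\{x:a\le x\le b\}$. $\ll$ is an $\mathbf{H}$-relation if $a\ll b$ and $a\le c$ imply $c\ll b\vee c$; a dual $\mathbf{H}$-relation if $a\ll b$ and $c\le b$ imply $a\wedge c\ll c$. An $\mathbf{R}$-order is a transitive $\mathbf{H}$-relation such that each $[a,\ll]$ is $\vee$-complete (contains the suprema in $Q$ of its non-empty subsets); a dual $\mathbf{R}$-order is a transitive dual $\mathbf{H}$-relation such that each $[\ll,a]$ is $\wedge$-complete. For $a\le b$: $a\ \overleftarrow{\ll}\ b$ iff $[a,\ll]\cap[a,b]=\{a\}$, and $a\ \overrightarrow{\ll}\ b$ iff $[\ll,b]\cap[a,b]=\{b\}$. Write $a\ll^{\triangleright}b$ if there is a family $(x_\lambda)_{1\le\lambda\le\gamma}$ ($\gamma$ an ordinal) with $x_1=a$, $x_\gamma=b$, $x_\lambda\ll x_{\lambda+1}$ for $\lambda<\gamma$, and $x_\beta=\vee_{\lambda<\beta}x_\lambda$ for limit ordinals $\beta$. An $\mathbf{R}$-order $\ll$ has a unique $\ll$-radical, i.e. element $\mathfrak r$ with $\mathbf 0\ll\mathfrak{r}\ \overleftarrow{\ll}\ \mathbf 1$, namely $\mathfrak r=\vee[\mathbf 0,\ll]$; a dual $\mathbf{R}$-order has a unique dual $\ll$-radical, i.e. element $\mathfrak p$ with $\mathbf 0\ \overrightarrow{\ll}\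 \mathfrak{p}\ll\mathbf 1$, namely $\mathfrak p=\wedge[\ll,\mathbf 1]$. For an $\mathbf H$-relation $\ll$, $\ll^{\triangleright}$ is an $\mathbf R$-order. If $P$ is upper stable then $\ll_P$ is an $\mathbf H$-relation in $\mathrm{Id}_A$ and $\mathfrak{r}_P^{\triangleright}(A)$ denotes the $\ll_P^{\triangleright}$-radical in $\mathrm{Id}_A$; $\mathfrak{r}_{\mathsf{G}P}(A)$ denotes the $\ll_{\mathsf{G}P}$-radical and $\mathfrak{p}_{\mathsf{NG}P}(A)$ the dual $\ll_{\mathsf{NG}P}$-radical in $\mathrm{Id}_A$. *)

theory Defs
  imports
    "HOL-Analysis.Analysis"
    "HOL-Algebra.Complete_Lattice"
    "HOL-Algebra.Module"
    "HOL-Algebra.QuotRing"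
begin

definition relation_in :: "('q, 'm) gorder_scheme \<Rightarrow> ('q \<Rightarrow> 'q \<Rightarrow> bool) \<Rightarrow> bool" where
  "relation_in L R \<longleftrightarrow>
     (\<forall>a\<in>carrier L. R a a) \<and>
     (\<forall>a b. R a b \<longrightarrow> a \<in> carrier L \<and> b \<in> carrier L \<and> a \<sqsubseteq>\<^bsub>L\<^esub> b)"

definition H_relation :: "('q, 'm) gorder_scheme \<Rightarrow> ('q \<Rightarrow> 'q \<Rightarrow> bool) \<Rightarrow> bool" where
  "H_relation L R \<longleftrightarrow> relation_in L R \<and>
     (\<forall>a\<in>carrier L. \<forall>b\<in>carrier L. \<forall>c\<in>carrier L.
        R a b \<and> a \<sqsubseteq>\<^bsub>L\<^esub> c \<longrightarrow> R c (b \<squnion>\<^bsub>L\<^esub> c))"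

definition dual_H_relation :: "('q, 'm) gorder_scheme \<Rightarrow> ('q \<Rightarrow> 'q \<Rightarrow> bool) \<Rightarrow> bool" where
  "dual_H_relation L R \<longleftrightarrow> relation_in L R \<and>
     (\<forall>a\<in>carrier L. \<forall>b\<in>carrier L. \<forall>c\<in>carrier L.
        R a b \<and> c \<sqsubseteq>\<^bsub>L\<^esub> b \<longrightarrow> R (a \<sqinter>\<^bsub>L\<^esub> c) c)"

definition up_set :: "('q, 'm) gorder_scheme \<Rightarrow> ('q \<Rightarrow> 'q \<Rightarrow> bool) \<Rightarrow> 'q \<Rightarrow> 'q set" where
  "up_set L R a = {x \<in> carrier L. R a x}"

definition down_set :: "('q, 'm) gorder_scheme \<Rightarrow> ('q \<Rightarrow> 'q \<Rightarrow> bool) \<Rightarrow> 'q \<Rightarrow> 'q set" where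
  "down_set L R b = {x \<in> carrier L. R x b}"

definition R_order :: "('q, 'm) gorder_scheme \<Rightarrow> ('q \<Rightarrow> 'q \<Rightarrow> bool) \<Rightarrow> bool" where
  "R_order L R \<longleftrightarrow> H_relation L R \<and> transp R \<and>
     (\<forall>a\<in>carrier L. \<forall>G. G \<subseteq> up_set L R a \<and> G \<noteq> {} \<longrightarrow> \<Squnion>\<^bsub>L\<^esub> G \<in> up_set L R a)"

definition dual_R_order :: "('q, 'm) gorder_scheme \<Rightarrow> ('q \<Rightarrow> 'q \<Rightarrow> bool) \<Rightarrow> bool" where
  "dual_R_order L R \<longleftrightarrow> dual_H_relation L R \<and> transp R \<and>
     (\<forall>a\<in>carrier L. \<forall>G. G \<subseteq> down_set L R a \<and> G \<noteq> {} \<longrightarrow> \<Sqinter>\<^bsub>L\<^esub> G \<in> down_set L R a)"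

definition left_arrow :: "('q, 'm) gorder_scheme \<Rightarrow> ('q \<Rightarrow> 'q \<Rightarrow> bool) \<Rightarrow> 'q \<Rightarrow> 'q \<Rightarrow> bool" where
  "left_arrow L R a b \<longleftrightarrow> a \<in> carrier L \<and> b \<in> carrier L \<and> a \<sqsubseteq>\<^bsub>L\<^esub> b \<and>
     up_set L R a \<inter> \<lbrace>a..b\<rbrace>\<^bsub>L\<^esub> = {a}"

definition right_arrow :: "('q, 'm) gorder_scheme \<Rightarrow> ('q \<Rightarrow> 'q \<Rightarrow> bool) \<Rightarrow> 'q \<Rightarrow> 'q \<Rightarrow> bool" where
  "right_arrow L R a b \<longleftrightarrow> a \<in> carrier L \<and> b \<in> carrier L \<and> a \<sqsubseteq>\<^bsub>L\<^esub> b \<and>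
     down_set L R b \<inter> \<lbrace>a..b\<rbrace>\<^bsub>L\<^esub> = {b}"

definition is_radical :: "('q, 'm) gorder_scheme \<Rightarrow> ('q \<Rightarrow> 'q \<Rightarrow> bool) \<Rightarrow> 'q \<Rightarrow> bool" where
  "is_radical L R r \<longleftrightarrow> R \<bottom>\<^bsub>L\<^esub> r \<and> left_arrow L R r \<top>\<^bsub>L\<^esub>"

definition is_dual_radical :: "('q, 'm) gorder_scheme \<Rightarrow> ('q \<Rightarrow> 'q \<Rightarrow> bool) \<Rightarrow> 'q \<Rightarrow> bool" where
  "is_dual_radical L R p \<longleftrightarrow> right_arrow L R \<bottom>\<^bsub>L\<^esub> p \<and> R p \<top>\<^bsub>L\<^esub>"

definition radical :: "('q, 'm) gorder_scheme \<Rightarrow> ('q \<Rightarrow> 'q \<Rightarrow> bool) \<Rightarrow> 'q" where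
  "radical L R = (THE r. is_radical L R r)"

definition dual_radical :: "('q, 'm) gorder_scheme \<Rightarrow> ('q \<Rightarrow> 'q \<Rightarrow> bool) \<Rightarrow> 'q" where
  "dual_radical L R = (THE p. is_dual_radical L R p)"

text \<open>On (dual) \<open>R\<close>-orders in a complete lattice the two definite descriptions denote.\<close>

lemma R_order_radical:
  assumes "complete_lattice L" and R: "R_order L R"
  shows "is_radical L R r \<longleftrightarrow> r = \<Squnion>\<^bsub>L\<^esub> (up_set L R \<bottom>\<^bsub>L\<^esub>)"
proof -
  interpret complete_lattice L by fact
  let ?U = "up_set L R \<bottom>\<^bsub>L\<^esub>"
  have rel: "\<And>a. a \<in> carrier L \<Longrightarrow> R a a"
      "\<And>a b. R a b \<Longrightarrow> a \<in> carrier L \<and> b \<in> carrier L \<and> a \<sqsubseteq>\<^bsub>L\<^esub> b"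
    using R by (simp_all add: R_order_def H_relation_def relation_in_def)
  have "\<forall>a\<in>carrier L. \<forall>b\<in>carrier L. \<forall>c\<in>carrier L. R a b \<and> a \<sqsubseteq>\<^bsub>L\<^esub> c \<longrightarrow> R c (b \<squnion>\<^bsub>L\<^esub> c)"
    using R by (simp add: R_order_def H_relation_def)
  then have H: "\<And>a b c. R a b \<Longrightarrow> c \<in> carrier L \<Longrightarrow> a \<sqsubseteq>\<^bsub>L\<^esub> c \<Longrightarrow> R c (b \<squnion>\<^bsub>L\<^esub> c)"
    using rel(2) by metis
  have tr: "\<And>a b c. R a b \<Longrightarrow> R b c \<Longrightarrow> R a c"
    using R unfolding R_order_def by (blast dest: transpD)
  have U: "?U \<subseteq> carrier L" "?U \<noteq> {}"
    using rel(1)[OF bottom_closed] by (auto simp: up_set_def)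
  have sU: "\<Squnion>\<^bsub>L\<^esub> ?U \<in> ?U"
    using R U(2) bottom_closed by (simp add: R_order_def)
  have rad: "is_radical L R (\<Squnion>\<^bsub>L\<^esub> ?U)"
  proof -
    let ?s = "\<Squnion>\<^bsub>L\<^esub> ?U"
    have s: "R \<bottom>\<^bsub>L\<^esub> ?s" "?s \<in> carrier L" using sU by (auto simp: up_set_def)
    have "x = ?s" if "x \<in> carrier L" "R ?s x" for x
    proof -
      have "x \<in> ?U" using tr[OF s(1) that(2)] that by (auto simp: up_set_def)
      then have "x \<sqsubseteq>\<^bsub>L\<^esub> ?s" by (rule sup_upper[OF U(1)])
      then show ?thesis using rel(2)[OF that(2)] le_antisym[of x ?s] by simp
    qed
    moreover have "?s \<in> up_set L R ?s \<inter> \<lbrace>?s..\<top>\<^bsub>L\<^esub>\<rbrace>\<^bsub>L\<^esub>"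
      using s(2) rel(1)[OF s(2)] top_higher[OF s(2)] by (simp add: up_set_def at_least_at_most_def)
    ultimately have "up_set L R ?s \<inter> \<lbrace>?s..\<top>\<^bsub>L\<^esub>\<rbrace>\<^bsub>L\<^esub> = {?s}"
      unfolding up_set_def by blast
    then show ?thesis
      using s top_higher[OF s(2)] by (simp add: is_radical_def left_arrow_def)
  qed
  moreover have "r = \<Squnion>\<^bsub>L\<^esub> ?U" if "is_radical L R r"
  proof -
    let ?s = "\<Squnion>\<^bsub>L\<^esub> ?U"
    have s: "R \<bottom>\<^bsub>L\<^esub> ?s" "?s \<in> carrier L" using sU by (auto simp: up_set_def)
    have r: "R \<bottom>\<^bsub>L\<^esub> r" "r \<in> carrier L" "up_set L R r \<inter> \<lbrace>r..\<top>\<^bsub>L\<^esub>\<rbrace>\<^bsub>L\<^esub> = {r}"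
      using that by (auto simp: is_radical_def left_arrow_def)
    have rs: "r \<sqsubseteq>\<^bsub>L\<^esub> ?s"
      using r(1,2) by (intro sup_upper[OF U(1)]) (simp add: up_set_def)
    then have "?s \<squnion>\<^bsub>L\<^esub> r = ?s"
      using r(2) s(2) by (intro le_antisym join_le join_left) auto
    then have "R r ?s" using H[OF s(1) r(2)] bottom_lower[OF r(2)] by simp
    then have "?s \<in> up_set L R r \<inter> \<lbrace>r..\<top>\<^bsub>L\<^esub>\<rbrace>\<^bsub>L\<^esub>"
      using s rs top_higher[OF s(2)] by (simp add: up_set_def at_least_at_most_def)
    then show ?thesis unfolding r(3) by simp
  qed
  ultimately show ?thesis by metis
qed

lemma dual_R_order_radical:
  assumes "complete_lattice L" and R: "dual_R_order L R"
  shows "is_dual_radical L R p \<longleftrightarrow> p = \<Sqinter>\<^bsub>L\<^esub> (down_set L R \<top>\<^bsub>L\<^esub>)"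
proof -
  interpret complete_lattice L by fact
  let ?U = "down_set L R \<top>\<^bsub>L\<^esub>"
  have rel: "\<And>a. a \<in> carrier L \<Longrightarrow> R a a"
      "\<And>a b. R a b \<Longrightarrow> a \<in> carrier L \<and> b \<in> carrier L \<and> a \<sqsubseteq>\<^bsub>L\<^esub> b"
    using R by (simp_all add: dual_R_order_def dual_H_relation_def relation_in_def)
  have "\<forall>a\<in>carrier L. \<forall>b\<in>carrier L. \<forall>c\<in>carrier L. R a b \<and> c \<sqsubseteq>\<^bsub>L\<^esub> b \<longrightarrow> R (a \<sqinter>\<^bsub>L\<^esub> c) c"
    using R by (simp add: dual_R_order_def dual_H_relation_def)
  then have H: "\<And>a b c. R a b \<Longrightarrow> c \<in> carrier L \<Longrightarrow> c \<sqsubseteq>\<^bsub>L\<^esub> b \<Longrightarrow> R (a \<sqinter>\<^bsub>L\<^esub> c) c"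
    using rel(2) by metis
  have tr: "\<And>a b c. R a b \<Longrightarrow> R b c \<Longrightarrow> R a c"
    using R unfolding dual_R_order_def by (blast dest: transpD)
  have U: "?U \<subseteq> carrier L" "?U \<noteq> {}"
    using rel(1)[OF top_closed] by (auto simp: down_set_def)
  let ?s = "\<Sqinter>\<^bsub>L\<^esub> ?U"
  have sU: "?s \<in> ?U"
    using R U(2) top_closed by (simp add: dual_R_order_def)
  have s: "R ?s \<top>\<^bsub>L\<^esub>" "?s \<in> carrier L" using sU by (auto simp: down_set_def)
  have rad: "is_dual_radical L R ?s"
  proof -
    have "x = ?s" if "x \<in> carrier L" "R x ?s" for x
    proof -
      have "x \<in> ?U" using tr[OF that(2) s(1)] that by (auto simp: down_set_def)
      then have "?s \<sqsubseteq>\<^bsub>L\<^esub> x" by (rule inf_lower[OF U(1)])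
      then show ?thesis using rel(2)[OF that(2)] le_antisym[of x ?s] by simp
    qed
    moreover have "?s \<in> down_set L R ?s \<inter> \<lbrace>\<bottom>\<^bsub>L\<^esub>..?s\<rbrace>\<^bsub>L\<^esub>"
      using s(2) rel(1)[OF s(2)] bottom_lower[OF s(2)] by (simp add: down_set_def at_least_at_most_def)
    ultimately have "down_set L R ?s \<inter> \<lbrace>\<bottom>\<^bsub>L\<^esub>..?s\<rbrace>\<^bsub>L\<^esub> = {?s}"
      unfolding down_set_def by blast
    then show ?thesis
      using s bottom_lower[OF s(2)] by (simp add: is_dual_radical_def right_arrow_def)
  qed
  moreover have "p = ?s" if "is_dual_radical L R p"
  proof -
    have p: "R p \<top>\<^bsub>L\<^esub>" "p \<in> carrier L" "down_set L R p \<inter> \<lbrace>\<bottom>\<^bsub>L\<^esub>..p\<rbrace>\<^bsub>L\<^esub> = {p}"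
      using that by (auto simp: is_dual_radical_def right_arrow_def)
    have sp: "?s \<sqsubseteq>\<^bsub>L\<^esub> p"
      using p(1,2) by (intro inf_lower[OF U(1)]) (simp add: down_set_def)
    then have "?s \<sqinter>\<^bsub>L\<^esub> p = ?s"
      using p(2) s(2) by (intro le_antisym meet_le meet_left) auto
    then have "R ?s p" using H[OF s(1) p(2)] top_higher[OF p(2)] by simp
    then have "?s \<in> down_set L R p \<inter> \<lbrace>\<bottom>\<^bsub>L\<^esub>..p\<rbrace>\<^bsub>L\<^esub>"
      using s sp bottom_lower[OF s(2)] by (simp add: down_set_def at_least_at_most_def)
    then show ?thesis unfolding p(3) by simp
  qed
  ultimately show ?thesis by metis
qed

text \<open>
  An ordinal interval \<open>1 \<le> \<lambda> \<le> \<gamma>\<close> is a well-order with a greatest element.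
  \<open>covers r i j\<close> says \<open>j = i + 1\<close>; limit indices are those that are neither
  first nor the successor of an index.
\<close>

definition covers :: "'i rel \<Rightarrow> 'i \<Rightarrow> 'i \<Rightarrow> bool" where
  "covers r i j \<longleftrightarrow> (i, j) \<in> r \<and> i \<noteq> j \<and> (\<forall>k. (i, k) \<in> r \<and> (k, j) \<in> r \<longrightarrow> k = i \<or> k = j)"

definition transfinite_family ::
    "('q, 'm) gorder_scheme \<Rightarrow> ('q \<Rightarrow> 'q \<Rightarrow> bool) \<Rightarrow> 'i rel \<Rightarrow> ('i \<Rightarrow> 'q) \<Rightarrow> 'q \<Rightarrow> 'q \<Rightarrow> bool" where
  "transfinite_family L R r x a b \<longleftrightarrow>
     Well_order r \<and> x ` Field r \<subseteq> carrier L \<and>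
     (\<exists>i\<in>Field r. (\<forall>j\<in>Field r. (i, j) \<in> r) \<and> x i = a) \<and>
     (\<exists>i\<in>Field r. (\<forall>j\<in>Field r. (j, i) \<in> r) \<and> x i = b) \<and>
     (\<forall>i j. covers r i j \<longrightarrow> R (x i) (x j)) \<and>
     (\<forall>j\<in>Field r. underS r j \<noteq> {} \<and> \<not> (\<exists>i. covers r i j) \<longrightarrow> x j = \<Squnion>\<^bsub>L\<^esub> (x ` underS r j))"

text \<open>
  HOL cannot quantify over all ordinals at once, so the index well-orders live on the type of
  the lattice elements. By \<open>transfinite_closureI\<close> below, families indexed by well-orders
  on any other type give nothing more.
\<close>

definition transfinite_closure ::
    "('q, 'm) gorder_scheme \<Rightarrow> ('q \<Rightarrow> 'q \<Rightarrow> bool) \<Rightarrow> 'q \<Rightarrow> 'q \<Rightarrow> bool" where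
  "transfinite_closure L R a b \<longleftrightarrow> (\<exists>(r :: 'q rel) x. transfinite_family L R r x a b)"

lemma transfinite_closureI:
  fixes r :: "'i rel"
  assumes "complete_lattice L" and rel: "relation_in L R"
    and fam: "transfinite_family L R r x a b"
  shows "transfinite_closure L R a b"
proof -
  interpret complete_lattice L by fact
  have W: "Well_order r" and xc: "\<And>i. i \<in> Field r \<Longrightarrow> x i \<in> carrier L"
    and step: "\<And>i j. covers r i j \<Longrightarrow> R (x i) (x j)"
    and lim: "\<And>j. j \<in> Field r \<Longrightarrow> underS r j \<noteq> {} \<Longrightarrow> \<not> (\<exists>i. covers r i j)
               \<Longrightarrow> x j = \<Squnion>\<^bsub>L\<^esub> (x ` underS r j)"
    using fam by (auto simp: transfinite_family_def)
  obtain i0 where i0: "i0 \<in> Field r" "\<And>j. j \<in> Field r \<Longrightarrow> (i0, j) \<in> r" "x i0 = a"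
    using fam by (auto simp: transfinite_family_def)
  obtain i1 where i1: "i1 \<in> Field r" "\<And>j. j \<in> Field r \<Longrightarrow> (j, i1) \<in> r" "x i1 = b"
    using fam by (auto simp: transfinite_family_def)
  have rF: "refl_on (Field r) r" "trans r" "antisym r" "total_on (Field r) r" and wf: "wf (r - Id)"
    using W unfolding order_on_defs by auto
  have rf: "\<And>i. i \<in> Field r \<Longrightarrow> (i, i) \<in> r"
    using rF(1) by (rule refl_onD)
  have tr: "\<And>i j k. (i, j) \<in> r \<Longrightarrow> (j, k) \<in> r \<Longrightarrow> (i, k) \<in> r"
    using rF(2) by (rule transD)
  have tot: "(i, j) \<in> r \<or> (j, i) \<in> r" if "i \<in> Field r" "j \<in> Field r" for i j
    using that rf rF(4) by (cases "i = j") (auto simp: total_on_def)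
  have F: "\<And>i j. (i, j) \<in> r \<Longrightarrow> i \<in> Field r \<and> j \<in> Field r" by (auto simp: Field_def)
  have leR: "\<And>u v. R u v \<Longrightarrow> u \<sqsubseteq>\<^bsub>L\<^esub> v" using rel by (auto simp: relation_in_def)
  have uS: "\<And>i j. i \<in> underS r j \<longleftrightarrow> (i, j) \<in> r \<and> i \<noteq> j" by (auto simp: underS_def)
  have mono: "(i, j) \<in> r \<Longrightarrow> x i \<sqsubseteq>\<^bsub>L\<^esub> x j" for i j
  proof (induction j arbitrary: i rule: wf_induct_rule[OF wf])
    case (1 j)
    show ?case
    proof (cases "i = j")
      case True then show ?thesis using xc F 1 by auto
    next
      case ij: False
      show ?thesis
      proof (cases "\<exists>k. covers r k j")
        case True
        then obtain k where k: "covers r k j" by auto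
        have "(i, k) \<in> r"
          using k ij 1(2) tot[of i k] F by (auto simp: covers_def)
        moreover have "(k, j) \<in> r - Id" using k by (auto simp: covers_def)
        ultimately have "x i \<sqsubseteq>\<^bsub>L\<^esub> x k" using 1(1) by blast
        then show ?thesis using leR[OF step[OF k]] xc F 1(2) k
          by (meson covers_def le_trans)
      next
        case False
        have "i \<in> underS r j" using 1(2) ij uS by auto
        then have "x j = \<Squnion>\<^bsub>L\<^esub> (x ` underS r j)" using lim False F 1(2) by auto
        moreover have "x ` underS r j \<subseteq> carrier L" using xc F uS by auto
        ultimately show ?thesis using sup_upper \<open>i \<in> underS r j\<close> by auto
      qed
    qed
  qed
  define D where "D = x ` Field r"
  have Dc: "D \<subseteq> carrier L" using xc by (auto simp: D_def)
  define s where "s = {(u, v). u \<in> D \<and> v \<in> D \<and> u \<sqsubseteq>\<^bsub>L\<^esub> v}"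
  have "u \<in> Field s" if "u \<in> D" for u
  proof -
    have "(u, u) \<in> s" using that Dc by (auto simp: s_def)
    then show ?thesis by (rule FieldI1)
  qed
  moreover have "Field s \<subseteq> D" by (auto simp: s_def Field_def)
  ultimately have Fs: "Field s = D" by blast
  have least_ex: "\<exists>j\<in>Field r. x j = v \<and> (\<forall>i. (i, j) \<in> r \<and> i \<noteq> j \<longrightarrow> x i \<noteq> v)" if "v \<in> D" for v
  proof -
    from that obtain j where "j \<in> Field r" "v = x j" unfolding D_def by blast
    then have "j \<in> {j \<in> Field r. x j = v}" by simp
    from wfE_min[OF wf this] obtain j where
      "j \<in> {j \<in> Field r. x j = v}" "\<And>i. (i, j) \<in> r - Id \<Longrightarrow> i \<notin> {j \<in> Field r. x j = v}" by blast
    then show ?thesis using F by blast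
  qed
  define idx where "idx v = (SOME j. j \<in> Field r \<and> x j = v \<and> (\<forall>i. (i, j) \<in> r \<and> i \<noteq> j \<longrightarrow> x i \<noteq> v))" for v
  have idx: "idx v \<in> Field r" "x (idx v) = v" "\<And>i. (i, idx v) \<in> r \<Longrightarrow> i \<noteq> idx v \<Longrightarrow> x i \<noteq> v"
    if "v \<in> D" for v
    using someI_ex[OF least_ex[OF that, unfolded Bex_def]] unfolding idx_def[symmetric] by simp_all
  have tots: "u \<sqsubseteq>\<^bsub>L\<^esub> v \<or> v \<sqsubseteq>\<^bsub>L\<^esub> u" if "u \<in> D" "v \<in> D" for u v
  proof -
    from that obtain i j where "i \<in> Field r" "u = x i" "j \<in> Field r" "v = x j"
      unfolding D_def by blast
    then show ?thesis using tot[of i j] mono[of i j] mono[of j i] by auto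
  qed
  have below: "(i, idx v) \<in> r \<and> i \<noteq> idx v" if "v \<in> D" "i \<in> Field r" "x i \<sqsubseteq>\<^bsub>L\<^esub> v" "x i \<noteq> v" for i v
  proof -
    have "\<not> (idx v, i) \<in> r"
    proof
      assume "(idx v, i) \<in> r"
      then have "v \<sqsubseteq>\<^bsub>L\<^esub> x i" using mono[of "idx v" i] idx(2)[OF that(1)] by simp
      then show False using le_antisym[of "x i" v] that xc Dc by auto
    qed
    then show ?thesis using tot[of i "idx v"] rf[of i] idx(1)[OF that(1)] that(2) by metis
  qed
  have underx: "underS s v = x ` underS r (idx v)" if "v \<in> D" for v
  proof (intro equalityI subsetI)
    fix u assume "u \<in> underS s v"
    then have u: "u \<in> D" "u \<sqsubseteq>\<^bsub>L\<^esub> v" "u \<noteq> v" by (auto simp: underS_def s_def)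
    then obtain i where "i \<in> Field r" "u = x i" by (auto simp: D_def)
    then show "u \<in> x ` underS r (idx v)" using below[OF that, of i] u uS by auto
  next
    fix u assume "u \<in> x ` underS r (idx v)"
    then obtain i where i: "(i, idx v) \<in> r" "i \<noteq> idx v" "u = x i" using uS by auto
    then show "u \<in> underS s v"
      using mono[OF i(1)] idx[OF that] F that by (auto simp: underS_def s_def D_def)
  qed
  have W': "Well_order s"
  proof -
    have "refl_on D s" using Dc by (auto simp: refl_on_def s_def)
    moreover have "trans s"
    proof (rule transI)
      fix u v w assume "(u, v) \<in> s" "(v, w) \<in> s"
      then show "(u, w) \<in> s" using le_trans[of u v w] Dc by (auto simp: s_def)
    qed
    moreover have "antisym s"
    proof (rule antisymI)
      fix u v assume "(u, v) \<in> s" "(v, u) \<in> s"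
      then show "u = v" using le_antisym[of u v] Dc by (auto simp: s_def)
    qed
    moreover have "total_on D s" using tots by (auto simp: total_on_def s_def)
    moreover have "wf (s - Id)"
    proof (rule wf_subset[OF wf_inv_image[OF wf, of idx]])
      show "s - Id \<subseteq> inv_image (r - Id) idx"
        using below idx by (auto simp: s_def inv_image_def) 
    qed
    ultimately show ?thesis
      unfolding order_on_defs Fs using Fs by (auto simp: s_def)
  qed
  have pred: "covers s (x k) v" if v: "v \<in> D" and k: "covers r k (idx v)" for v k
  proof -
    have k': "(k, idx v) \<in> r" "k \<noteq> idx v" using k by (auto simp: covers_def)
    have xk: "x k \<in> D" "x k \<sqsubseteq>\<^bsub>L\<^esub> v" "x k \<noteq> v"
      using mono[OF k'(1)] idx[OF v] k' F by (auto simp: D_def)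
    have "w = x k \<or> w = v" if w: "w \<in> D" "x k \<sqsubseteq>\<^bsub>L\<^esub> w" "w \<sqsubseteq>\<^bsub>L\<^esub> v" for w
    proof (rule ccontr)
      assume n: "\<not> ?thesis"
      obtain i where i: "i \<in> Field r" "w = x i" using w by (auto simp: D_def)
      have "(i, idx v) \<in> r \<and> i \<noteq> idx v" using below[OF v] i w n by auto
      then have "(i, k) \<in> r" using k tot[of i k] F by (auto simp: covers_def)
      then have "w \<sqsubseteq>\<^bsub>L\<^esub> x k" using mono i by auto
      then show False using n w(1,2) xk(1) Dc le_antisym[of w "x k"] by auto
    qed
    then show ?thesis using xk v by (auto simp: covers_def s_def)
  qed
  have step': "R u v" if c: "covers s u v" for u v
  proof -
    have uv: "u \<in> D" "v \<in> D" "u \<sqsubseteq>\<^bsub>L\<^esub> v" "u \<noteq> v"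
      and bt: "\<And>w. w \<in> D \<Longrightarrow> u \<sqsubseteq>\<^bsub>L\<^esub> w \<Longrightarrow> w \<sqsubseteq>\<^bsub>L\<^esub> v \<Longrightarrow> w = u \<or> w = v"
      using c by (auto simp: covers_def s_def)
    have ux: "u \<in> x ` underS r (idx v)" using underx uv by (auto simp: underS_def s_def)
    have le_u: "w \<sqsubseteq>\<^bsub>L\<^esub> u" if "w \<in> D" "w \<sqsubseteq>\<^bsub>L\<^esub> v" "w \<noteq> v" for w
      using that bt[of w] tots[of u w] uv(1) Dc by auto
    show ?thesis
    proof (cases "\<exists>k. covers r k (idx v)")
      case True
      then obtain k where k: "covers r k (idx v)" by auto
      have "covers s (x k) v" using pred uv k by auto
      then have "x k = u"
        using uv le_u[of "x k"] by (auto simp: covers_def s_def)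
      then show ?thesis using step[OF k] idx uv by auto
    next
      case False
      then have "v = \<Squnion>\<^bsub>L\<^esub> (underS s v)" using lim[of "idx v"] idx uv ux underx by auto
      moreover have "\<Squnion>\<^bsub>L\<^esub> (underS s v) \<sqsubseteq>\<^bsub>L\<^esub> u"
        by (rule sup_least) (use le_u uv Dc in \<open>auto simp: underS_def s_def Upper_def\<close>)
      ultimately have "v \<sqsubseteq>\<^bsub>L\<^esub> u" by simp
      then show ?thesis using uv le_antisym[of u v] Dc by auto
    qed
  qed
  have "transfinite_family L R s id a b"
    unfolding transfinite_family_def Fs
  proof (intro conjI ballI allI impI)
    show "\<exists>i\<in>D. (\<forall>j\<in>D. (i, j) \<in> s) \<and> id i = a"
      using i0 mono by (intro bexI[of _ a]) (auto simp: D_def s_def)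
    show "\<exists>i\<in>D. (\<forall>j\<in>D. (j, i) \<in> s) \<and> id i = b"
      using i1 mono by (intro bexI[of _ b]) (auto simp: D_def s_def)
  next
    fix v assume v: "v \<in> D" and l: "underS s v \<noteq> {} \<and> \<not> (\<exists>u. covers s u v)"
    then have "\<not> (\<exists>k. covers r k (idx v))" "underS r (idx v) \<noteq> {}"
      using pred[OF v] underx[OF v] by blast+
    then show "id v = \<Squnion>\<^bsub>L\<^esub> (id ` underS s v)"
      using lim[of "idx v"] idx[OF v] underx[OF v] by auto
  qed (use W' Fs Dc step' in auto)
  then show ?thesis by (auto simp: transfinite_closure_def)
qed

text \<open>
  C*-algebras are carrier-based and not assumed to be unital. The field \<open>one\<close> inherited from
  rings is never referred to (as for the library's modules, where also \<open>mult\<close> is unused).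
\<close>

record 'a cstar = "(complex, 'a) module" +
  adj :: "'a \<Rightarrow> 'a"
  nrm :: "'a \<Rightarrow> real"

definition complex_ring :: "complex ring" where
  "complex_ring = \<lparr>carrier = UNIV, monoid.mult = (*), one = 1, ring.zero = 0, add = (+)\<rparr>"

text \<open>
  The cut-off outside the carrier is there because \<^locale>\<open>Metric_space\<close> asks for
  symmetry and nonnegativity on the whole type.
\<close>

definition cdist :: "'a cstar \<Rightarrow> 'a \<Rightarrow> 'a \<Rightarrow> real" where
  "cdist A x y = (if x \<in> carrier A \<and> y \<in> carrier A then nrm A (x \<ominus>\<^bsub>A\<^esub> y) else 0)"

locale cstar_algebra = module complex_ring A for A :: "'a cstar" (structure) +
  assumes m_closed: "\<lbrakk>x \<in> carrier A; y \<in> carrier A\<rbrakk> \<Longrightarrow> x \<otimes> y \<in> carrier A"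
    and m_assoc: "\<lbrakk>x \<in> carrier A; y \<in> carrier A; z \<in> carrier A\<rbrakk> \<Longrightarrow> (x \<otimes> y) \<otimes> z = x \<otimes> (y \<otimes> z)"
    and l_distr: "\<lbrakk>x \<in> carrier A; y \<in> carrier A; z \<in> carrier A\<rbrakk> \<Longrightarrow> (x \<oplus> y) \<otimes> z = x \<otimes> z \<oplus> y \<otimes> z"
    and r_distr: "\<lbrakk>x \<in> carrier A; y \<in> carrier A; z \<in> carrier A\<rbrakk> \<Longrightarrow> z \<otimes> (x \<oplus> y) = z \<otimes> x \<oplus> z \<otimes> y"
    and smult_m_left: "\<lbrakk>x \<in> carrier A; y \<in> carrier A\<rbrakk> \<Longrightarrow> (c \<odot> x) \<otimes> y = c \<odot> (x \<otimes> y)"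
    and smult_m_right: "\<lbrakk>x \<in> carrier A; y \<in> carrier A\<rbrakk> \<Longrightarrow> x \<otimes> (c \<odot> y) = c \<odot> (x \<otimes> y)"
    and adj_closed: "x \<in> carrier A \<Longrightarrow> adj A x \<in> carrier A"
    and adj_adj: "x \<in> carrier A \<Longrightarrow> adj A (adj A x) = x"
    and adj_add: "\<lbrakk>x \<in> carrier A; y \<in> carrier A\<rbrakk> \<Longrightarrow> adj A (x \<oplus> y) = adj A x \<oplus> adj A y"
    and adj_smult: "x \<in> carrier A \<Longrightarrow> adj A (c \<odot> x) = cnj c \<odot> adj A x"
    and adj_mult: "\<lbrakk>x \<in> carrier A; y \<in> carrier A\<rbrakk> \<Longrightarrow> adj A (x \<otimes> y) = adj A y \<otimes> adj A x"
    and nrm_nonneg: "x \<in> carrier A \<Longrightarrow> 0 \<le> nrm A x"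
    and nrm_eq_0: "x \<in> carrier A \<Longrightarrow> nrm A x = 0 \<longleftrightarrow> x = \<zero>"
    and nrm_triangle: "\<lbrakk>x \<in> carrier A; y \<in> carrier A\<rbrakk> \<Longrightarrow> nrm A (x \<oplus> y) \<le> nrm A x + nrm A y"
    and nrm_smult: "x \<in> carrier A \<Longrightarrow> nrm A (c \<odot> x) = cmod c * nrm A x"
    and nrm_mult: "\<lbrakk>x \<in> carrier A; y \<in> carrier A\<rbrakk> \<Longrightarrow> nrm A (x \<otimes> y) \<le> nrm A x * nrm A y"
    and cstar_identity: "x \<in> carrier A \<Longrightarrow> nrm A (adj A x \<otimes> x) = (nrm A x)\<^sup>2"
    and complete: "Metric_space.mcomplete (carrier A) (cdist A)"

lemma (in cstar_algebra) Metric_space: "Metric_space (carrier A) (cdist A)"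
proof -
  have neg: "nrm A (\<ominus> x) = nrm A x" if x: "x \<in> carrier A" for x
  proof -
    have "(- 1 :: complex) \<odot> x \<oplus> x = (- 1) \<odot> x \<oplus> 1 \<odot> x"
      using smult_one[OF x] by (simp add: complex_ring_def)
    also have "\<dots> = (- 1 + 1 :: complex) \<odot> x"
      using smult_l_distr[of "-1" 1 x] x by (simp add: complex_ring_def)
    also have "\<dots> = \<zero>"
      using smult_l_null[OF x] by (simp add: complex_ring_def)
    finally have "\<ominus> x = (- 1 :: complex) \<odot> x"
      using x smult_closed[of "-1" x] M.minus_equality by (simp add: complex_ring_def)
    then show ?thesis using nrm_smult[OF x, of "-1"] by simp
  qed
  show ?thesis
  proof
    fix x y z
    show "0 \<le> cdist A x y" by (simp add: cdist_def nrm_nonneg)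
    show "cdist A x y = cdist A y x"
    proof (cases "x \<in> carrier A \<and> y \<in> carrier A")
      case True
      then have "\<ominus> (x \<ominus> y) = y \<ominus> x"
        using M.a_comm[of "\<ominus> x" y] by (simp add: a_minus_def M.minus_add)
      then show ?thesis using neg[of "x \<ominus> y"] True by (simp add: cdist_def)
    qed (auto simp: cdist_def)
    assume x: "x \<in> carrier A" and y: "y \<in> carrier A"
    show "cdist A x y = 0 \<longleftrightarrow> x = y"
      using x y M.add.inv_solve_right[of \<zero> x y] by (auto simp: cdist_def nrm_eq_0 a_minus_def)
    assume z: "z \<in> carrier A"
    have "x \<ominus> z = (x \<ominus> y) \<oplus> (y \<ominus> z)"
      using x y z by (simp add: a_minus_def M.a_assoc M.r_neg1)
    then show "cdist A x z \<le> cdist A x y + cdist A y z"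
      using x y z nrm_triangle[of "x \<ominus> y" "y \<ominus> z"] by (simp add: cdist_def)
  qed
qed

definition closed_ideals :: "'a cstar \<Rightarrow> 'a set set" where
  "closed_ideals A = {I. submodule I complex_ring A \<and>
     (\<forall>a\<in>carrier A. \<forall>x\<in>I. a \<otimes>\<^bsub>A\<^esub> x \<in> I \<and> x \<otimes>\<^bsub>A\<^esub> a \<in> I) \<and>
     closedin (Metric_space.mtopology (carrier A) (cdist A)) I}"

text \<open>
  Suprema and infima are the order-theoretic ones: the least closed ideal containing all
  members of \<open>G\<close> is the closure of their sum.
\<close>

definition Id_lattice :: "'a cstar \<Rightarrow> 'a set gorder" where
  "Id_lattice A = \<lparr>carrier = closed_ideals A, eq = (=), le = (\<subseteq>)\<rparr>"

lemma (in cstar_algebra) closed_ideals_Inter: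
  assumes "G \<subseteq> closed_ideals A" "G \<noteq> {}"
  shows "\<Inter>G \<in> closed_ideals A"
proof -
  have sm: "submodule I complex_ring A" if "I \<in> G" for I
    using that assms by (auto simp: closed_ideals_def)
  have sg: "subgroup I (add_monoid A)" if "I \<in> G" for I
    using sm[OF that] by (simp add: submodule_def)
  have "subgroup (\<Inter>G) (add_monoid A)"
    using M.a_group sg assms(2) by (intro group.subgroups_Inter) auto
  moreover have "submodule_axioms (\<Inter>G) complex_ring A"
    using sm by (auto simp: submodule_def submodule_axioms_def)
  ultimately have "submodule (\<Inter>G) complex_ring A"
    by (simp add: submodule_def)
  moreover have "closedin (Metric_space.mtopology (carrier A) (cdist A)) (\<Inter>G)"
    using assms by (intro closedin_Inter) (auto simp: closed_ideals_def)
  ultimately show ?thesis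
    using assms by (auto simp: closed_ideals_def)
qed

lemma (in cstar_algebra) carrier_closed_ideal: "carrier A \<in> closed_ideals A"
proof -
  interpret MS: Metric_space "carrier A" "cdist A" by (rule Metric_space)
  show ?thesis
    using MS.closedin_mspace m_closed module.carrier_is_submodule[OF module_axioms]
    by (auto simp: closed_ideals_def)
qed

theorem complete_lattice_Id_lattice:
  assumes "cstar_algebra A"
  shows "complete_lattice (Id_lattice A)"
proof -
  interpret cstar_algebra A by fact
  interpret P: partial_order "Id_lattice A"
    by unfold_locales (auto simp: Id_lattice_def)
  show ?thesis
  proof (rule P.complete_lattice_criterion1)
    have "greatest (Id_lattice A) (carrier A) (carrier (Id_lattice A))"
      using carrier_closed_ideal 
      by (auto simp: greatest_def Id_lattice_def closed_ideals_def submodule_def subgroup_def)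
    then show "\<exists>g. greatest (Id_lattice A) g (carrier (Id_lattice A))" by blast
  next
    fix G assume "G \<subseteq> carrier (Id_lattice A)" "G \<noteq> {}"
    then have "greatest (Id_lattice A) (\<Inter>G) (Lower (Id_lattice A) G)"
      using closed_ideals_Inter[of G] by (auto simp: greatest_def Lower_def Id_lattice_def)
    then show "\<exists>i. greatest (Id_lattice A) i (Lower (Id_lattice A) G)" by blast
  qed
qed

definition subalgebra_on :: "'a cstar \<Rightarrow> 'a set \<Rightarrow> 'a cstar" where
  "subalgebra_on A J = A\<lparr>carrier := J\<rparr>"

text \<open>
  The quotient consists of cosets. Scalar multiples are written like the library's
  \<^const>\<open>rcoset_mult\<close> since \<open>0 \<odot> (I +> x)\<close> taken elementwise would be \<open>{\<zero>}\<close>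
  instead of \<open>I\<close>. Elementwise adjoints are cosets of \<open>I\<close> because closed ideals are
  self-adjoint.
\<close>

definition cstar_quotient :: "'a cstar \<Rightarrow> 'a set \<Rightarrow> 'a set cstar" where
  "cstar_quotient A I = \<lparr>
     carrier = a_rcosets\<^bsub>A\<^esub> I,
     monoid.mult = rcoset_mult A I,
     one = I +>\<^bsub>A\<^esub> \<one>\<^bsub>A\<^esub>,
     ring.zero = I,
     add = set_add A,
     smult = (\<lambda>c S. \<Union>x\<in>S. I +>\<^bsub>A\<^esub> (c \<odot>\<^bsub>A\<^esub> x)),
     adj = (\<lambda>S. adj A ` S),
     nrm = (\<lambda>S. Inf (nrm A ` S))\<rparr>"

definition star_isomorphism :: "'a cstar \<Rightarrow> 'b cstar \<Rightarrow> ('a \<Rightarrow> 'b) \<Rightarrow> bool" where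
  "star_isomorphism A B f \<longleftrightarrow> bij_betw f (carrier A) (carrier B) \<and>
     (\<forall>x\<in>carrier A. \<forall>y\<in>carrier A. f (x \<oplus>\<^bsub>A\<^esub> y) = f x \<oplus>\<^bsub>B\<^esub> f y) \<and>
     (\<forall>x\<in>carrier A. \<forall>y\<in>carrier A. f (x \<otimes>\<^bsub>A\<^esub> y) = f x \<otimes>\<^bsub>B\<^esub> f y) \<and>
     (\<forall>c. \<forall>x\<in>carrier A. f (c \<odot>\<^bsub>A\<^esub> x) = c \<odot>\<^bsub>B\<^esub> f x) \<and>
     (\<forall>x\<in>carrier A. f (adj A x) = adj B (f x))"

definition star_isomorphic :: "'a cstar \<Rightarrow> 'b cstar \<Rightarrow> bool" where
  "star_isomorphic A B \<longleftrightarrow> (\<exists>f. star_isomorphism A B f)"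

text \<open>
  The type \<open>'u\<close> is the universe: a class of C*-algebras is given by its members whose underlying
  set is a subset of \<open>'u\<close>. Subalgebras and quotients of algebras in the universe are no
  larger, but iterated quotients live on \<open>'u set\<close>, \<open>'u set set\<close>, ...; such an algebra belongs to
  the class iff it is *-isomorphic to one of these members.
\<close>

definition cstar_property :: "('u cstar \<Rightarrow> bool) \<Rightarrow> bool" where
  "cstar_property P \<longleftrightarrow>
     (\<forall>A. P A \<longrightarrow> cstar_algebra A) \<and>
     (\<forall>A. cstar_algebra A \<and> carrier A = {\<zero>\<^bsub>A\<^esub>} \<longrightarrow> P A) \<and>
     (\<forall>A B. P A \<and> cstar_algebra B \<and> star_isomorphic A B \<longrightarrow> P B)"

definition in_class :: "('u cstar \<Rightarrow> bool) \<Rightarrow> 'b cstar \<Rightarrow> bool" where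
  "in_class P B \<longleftrightarrow> cstar_algebra B \<and> (\<exists>B'. P B' \<and> star_isomorphic B' B)"

lemma in_class_iff:
  fixes P :: "'u cstar \<Rightarrow> bool" and B :: "'u cstar"
  assumes "cstar_property P"
  shows "in_class P B \<longleftrightarrow> P B"
proof -
  have "star_isomorphic B B"
    unfolding star_isomorphic_def star_isomorphism_def by (intro exI[of _ id]) auto
  then show ?thesis
    using assms unfolding in_class_def cstar_property_def by blast
qed

definition upper_stable :: "('u cstar \<Rightarrow> bool) \<Rightarrow> bool" where
  "upper_stable P \<longleftrightarrow> (\<forall>A. P A \<longrightarrow> (\<forall>I\<in>closed_ideals A. in_class P (cstar_quotient A I)))"

definition has_nonzero_ideal_in :: "('u cstar \<Rightarrow> bool) \<Rightarrow> 'b cstar \<Rightarrow> bool" where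
  "has_nonzero_ideal_in P B \<longleftrightarrow>
     (\<exists>K\<in>closed_ideals B. K \<noteq> {\<zero>\<^bsub>B\<^esub>} \<and> in_class P (subalgebra_on B K))"

definition G_property :: "('u cstar \<Rightarrow> bool) \<Rightarrow> ('u cstar \<Rightarrow> bool)" where
  "G_property P A \<longleftrightarrow> cstar_algebra A \<and>
     (carrier A = {\<zero>\<^bsub>A\<^esub>} \<or>
      (\<forall>I\<in>closed_ideals A. I \<noteq> carrier A \<longrightarrow> has_nonzero_ideal_in P (cstar_quotient A I)))"

definition NG_property :: "('u cstar \<Rightarrow> bool) \<Rightarrow> ('u cstar \<Rightarrow> bool)" where
  "NG_property P A \<longleftrightarrow> cstar_algebra A \<and> \<not> has_nonzero_ideal_in P A"

definition ideal_rel :: "('u cstar \<Rightarrow> bool) \<Rightarrow> 'u cstar \<Rightarrow> 'u set \<Rightarrow> 'u set \<Rightarrow> bool" where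
  "ideal_rel P A I J \<longleftrightarrow> I \<in> closed_ideals A \<and> J \<in> closed_ideals A \<and> I \<subseteq> J \<and>
     in_class P (cstar_quotient (subalgebra_on A J) I)"

end

theory Submission
  imports Defs
begin

text \<open>
  Write \<open>I \<lless> J\<close> for \<open>I \<subseteq> J\<close> and \<open>J/I \<in> P\<close>. Since the ideals of \<open>J/I\<close> correspond to the ideals
  between \<open>I\<close> and \<open>J\<close>, and an ideal of \<open>J/K\<close> lies in \<open>P\<close> iff it is \<open>L/K\<close> with \<open>K \<lless> L\<close>, the
  properties \<open>GP\<close> and \<open>NGP\<close> of \<open>J/I\<close> are statements about \<open>\<lless>\<close> in the interval from \<open>I\<close> to \<open>J\<close>: \<open>J/I\<close> has \<open>NGP\<close> iff no step
  \<open>I \<lless> L\<close> leads properly upwards inside \<open>J\<close>, which is the left arrow of \<open>\<lless>\<close>, and it has \<open>GP\<close> iff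
  every \<open>K \<noteq> J\<close> in the interval admits a proper step \<open>K \<lless> L \<subseteq> J\<close> (\<open>stepwise_below\<close>).

  What remains is lattice theory for an \<open>H\<close>-relation. If \<open>stepwise_below\<close> holds then choosing a
  step at each element and iterating transfinitely reaches the top, because by Cantor's theorem
  the iteration cannot grow for ever; conversely \<open>stepwise_below\<close> is an \<open>R\<close>-order containing the
  relation, so it follows every transfinite chain. The left arrow of an \<open>H\<close>-relation is a dual
  \<open>R\<close>-order, and the radical of \<open>stepwise_below\<close> is its dual radical: no proper step
  leads from it upwards, and every element properly below it is the start of a step.

  That \<open>\<lless>\<close> is an \<open>H\<close>-relation is the second isomorphism theorem: for \<open>I \<subseteq> K\<close> the algebra
  \<open>(J + K)/K\<close> is \<open>J/(J \<inter> K)\<close>, a quotient of \<open>J/I\<close>. This and the correspondence of ideals rest on the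
  basic theory of closed ideals: they are C*-algebras, their closed ideals are closed ideals of
  the whole algebra, quotients are C*-algebras, sums of two are closed, and *-isomorphisms
  respect the norm. The last point matters because membership in a class is
  witnessed by an isomorphic copy, whose closed ideals have to be carried over.

  All of this is derived without spectral theory from one device. For self-adjoint \<open>g\<close> of norm
  below 1, the contraction principle yields a self-adjoint \<open>c\<close>, commuting with \<open>g\<close>, such that
  \<open>(1 - c)\<^sup>2 + g\<^sup>2 = 1\<close> (\<open>exists_sqrt_complement\<close>). So \<open>1 - c\<close> and \<open>g\<close> behave like a cosine and a sine:
  \<open>(1 - c) + \<i>g\<close> is unitary, whence both act as contractions, and the double angle formula gives
  \<open>\<parallel>g(1 - c)\<parallel> \<le> 1/2\<close> (\<open>cosine_contractive\<close>, \<open>half_sine_bound\<close>). The equation for \<open>c\<close> is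
  preserved by *-homomorphisms, which therefore do not increase norms. The factor \<open>1/2\<close> makes the products
  \<open>h(1 - c\<^sub>1)(1 - c\<^sub>2)\<dots>\<close> tend to zero for self-adjoint \<open>h\<close>, which produces approximate units in closed
  ideals (\<open>approx_unit_ideal\<close>).
\<close>

section \<open>Relations in complete lattices\<close>

text \<open>
  The counterpart of \<open>GP\<close> in an arbitrary lattice. It describes the transfinite closure of an
  \<open>H\<close>-relation without mentioning ordinals.
\<close>
definition stepwise_below :: "('q, 'm) gorder_scheme \<Rightarrow> ('q \<Rightarrow> 'q \<Rightarrow> bool) \<Rightarrow> 'q \<Rightarrow> 'q \<Rightarrow> bool" where
  "stepwise_below L R a b \<longleftrightarrow> a \<in> carrier L \<and> b \<in> carrier L \<and> a \<sqsubseteq>\<^bsub>L\<^esub> b \<and>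
     (\<forall>k\<in>carrier L. a \<sqsubseteq>\<^bsub>L\<^esub> k \<and> k \<sqsubseteq>\<^bsub>L\<^esub> b \<and> k \<noteq> b \<longrightarrow>
       (\<exists>l\<in>carrier L. l \<sqsubseteq>\<^bsub>L\<^esub> b \<and> l \<noteq> k \<and> R k l))"

context complete_lattice
begin

lemma H_relationD:
  assumes "H_relation L R" "R a b"
  shows "a \<in> carrier L" "b \<in> carrier L" "a \<sqsubseteq> b"
    and "\<And>c. c \<in> carrier L \<Longrightarrow> a \<sqsubseteq> c \<Longrightarrow> R c (b \<squnion> c)"
  using assms unfolding H_relation_def relation_in_def by blast+

lemma H_relation_refl: "H_relation L R \<Longrightarrow> a \<in> carrier L \<Longrightarrow> R a a"
  by (simp add: H_relation_def relation_in_def)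

text \<open>
  The proper step from \<open>k \<sqinter> b\<close> inside \<open>b\<close> is pushed up along the join with \<open>k\<close>. This yields all closure
  properties of \<open>stepwise_below\<close>: for a step at \<open>k\<close>, any pair in the relation suffices whose lower
  element is below \<open>k\<close> and whose upper one is not.
\<close>

lemma step_beyond:
  assumes H: "H_relation L R" and s: "stepwise_below L R a b"
    and k: "k \<in> carrier L" "a \<sqsubseteq> k" "\<not> b \<sqsubseteq> k" and c: "c \<in> carrier L" "k \<sqsubseteq> c" "b \<sqsubseteq> c"
  shows "\<exists>l\<in>carrier L. l \<sqsubseteq> c \<and> l \<noteq> k \<and> R k l"
proof -
  have ab: "a \<in> carrier L" "b \<in> carrier L" "a \<sqsubseteq> b"
    using s by (auto simp: stepwise_below_def)
  have kb: "k \<sqinter> b \<in> carrier L" "a \<sqsubseteq> k \<sqinter> b" "k \<sqinter> b \<sqsubseteq> b" "k \<sqinter> b \<sqsubseteq> k"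
    using ab k meet_le meet_left meet_right by auto
  have "k \<sqinter> b \<noteq> b" using kb(4) k(3) by auto
  then obtain l where l: "l \<in> carrier L" "l \<sqsubseteq> b" "l \<noteq> k \<sqinter> b" "R (k \<sqinter> b) l"
    using s kb unfolding stepwise_below_def by blast
  have "\<not> l \<sqsubseteq> k"
  proof
    assume "l \<sqsubseteq> k"
    then have "l \<sqsubseteq> k \<sqinter> b" using l k ab meet_le by auto
    then show False using l H_relationD(3)[OF H l(4)] kb le_antisym by auto
  qed
  moreover have "l \<sqsubseteq> l \<squnion> k" using l k join_left by auto
  ultimately have "l \<squnion> k \<noteq> k" by metis
  moreover have "l \<squnion> k \<sqsubseteq> c"
    using l k c ab le_trans[OF l(2) c(3)] join_le by auto
  ultimately show ?thesis
    using H_relationD(4)[OF H l(4) k(1) kb(4)] l(1) k(1) by auto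
qed

lemma relation_imp_stepwise_below:
  assumes H: "H_relation L R" and "R a b"
  shows "stepwise_below L R a b"
proof -
  note ab = H_relationD[OF H \<open>R a b\<close>]
  have "R k b" if "k \<in> carrier L" "a \<sqsubseteq> k" "k \<sqsubseteq> b" for k
  proof -
    have "b \<squnion> k = b" using that ab by (intro le_antisym join_le join_left) auto
    then show ?thesis using ab(4)[of k] that by simp
  qed
  then show ?thesis using ab by (auto simp: stepwise_below_def)
qed

lemma R_order_stepwise_below:
  assumes H: "H_relation L R"
  shows "R_order L (stepwise_below L R)"
proof -
  let ?S = "stepwise_below L R"
  have SI: "?S a b"
    if ab: "a \<in> carrier L" "b \<in> carrier L" "a \<sqsubseteq> b"
      and ex: "\<And>k. k \<in> carrier L \<Longrightarrow> a \<sqsubseteq> k \<Longrightarrow> k \<sqsubseteq> b \<Longrightarrow> k \<noteq> b \<Longrightarrow>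
        \<exists>c. ?S a c \<and> c \<sqsubseteq> b \<and> \<not> c \<sqsubseteq> k \<or> ?S c b \<and> c \<sqsubseteq> k" for a b
  proof -
    have "\<exists>l\<in>carrier L. l \<sqsubseteq> b \<and> l \<noteq> k \<and> R k l"
      if k: "k \<in> carrier L" "a \<sqsubseteq> k" "k \<sqsubseteq> b" "k \<noteq> b" for k
    proof -
      have nbk: "\<not> b \<sqsubseteq> k" using k le_antisym[of k b] \<open>b \<in> carrier L\<close> by auto
      consider c where "?S a c" "c \<sqsubseteq> b" "\<not> c \<sqsubseteq> k" | c where "?S c b" "c \<sqsubseteq> k"
        using ex[OF k] by blast
      then show ?thesis
      proof cases
        case 1
        then show ?thesis using step_beyond[OF H 1(1) k(1,2) 1(3) \<open>b \<in> carrier L\<close> k(3)] by simp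
      next
        case 2
        then show ?thesis using step_beyond[OF H 2(1) k(1) 2(2) nbk \<open>b \<in> carrier L\<close> k(3)] \<open>b \<in> carrier L\<close>
          by simp
      qed
    qed
    then show ?thesis using ab by (auto simp: stepwise_below_def)
  qed
  have refl: "?S a a" if "a \<in> carrier L" for a
    using that le_antisym by (auto simp: stepwise_below_def)
  have D: "a \<in> carrier L" "b \<in> carrier L" "a \<sqsubseteq> b" if "?S a b" for a b
    using that by (auto simp: stepwise_below_def)
  have "?S c (b \<squnion> c)" if "?S a b" "c \<in> carrier L" "a \<sqsubseteq> c" for a b c
  proof -
    note d = D[OF that(1)]
    have bc: "b \<squnion> c \<in> carrier L" "c \<sqsubseteq> b \<squnion> c" "b \<sqsubseteq> b \<squnion> c" 
      using d that join_left join_right by auto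
    have "\<exists>l\<in>carrier L. l \<sqsubseteq> b \<squnion> c \<and> l \<noteq> k \<and> R k l"
      if k: "k \<in> carrier L" "c \<sqsubseteq> k" "k \<sqsubseteq> b \<squnion> c" "k \<noteq> b \<squnion> c" for k
    proof (rule step_beyond[OF H \<open>?S a b\<close> k(1) _ _ bc(1) k(3) bc(3)])
      show "a \<sqsubseteq> k" using le_trans[OF \<open>a \<sqsubseteq> c\<close> k(2) d(1) _ k(1)] \<open>c \<in> carrier L\<close> by simp
      show "\<not> b \<sqsubseteq> k"
      proof
        assume "b \<sqsubseteq> k"
        then have "b \<squnion> c \<sqsubseteq> k" using k d \<open>c \<in> carrier L\<close> by (intro join_le)
        then show False using k bc le_antisym by auto
      qed
    qed
    then show ?thesis using bc \<open>c \<in> carrier L\<close> by (auto simp: stepwise_below_def)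
  qed
  then have "H_relation L ?S"
    using refl D by (auto simp: H_relation_def relation_in_def)
  moreover have "transp ?S"
  proof (rule transpI)
    fix a b c assume S: "?S a b" "?S b c"
    note d = D[OF S(1)] D[OF S(2)]
    show "?S a c"
    proof (rule SI)
      show "a \<sqsubseteq> c" using le_trans[OF d(3) d(6)] d by simp
      fix k show "\<exists>ca. ?S a ca \<and> ca \<sqsubseteq> c \<and> \<not> ca \<sqsubseteq> k \<or> ?S ca c \<and> ca \<sqsubseteq> k"
        using S d(6) by (intro exI[of _ b]) blast
    qed (use d in auto)
  qed
  moreover have "?S a (\<Squnion> G)" if "a \<in> carrier L" "G \<subseteq> up_set L ?S a" "G \<noteq> {}" for a G
  proof -
    have G: "G \<subseteq> carrier L" "\<And>g. g \<in> G \<Longrightarrow> ?S a g" using that(2) by (auto simp: up_set_def)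
    obtain g where g: "g \<in> G" using \<open>G \<noteq> {}\<close> by blast
    have up: "\<And>g. g \<in> G \<Longrightarrow> g \<sqsubseteq> \<Squnion> G" using G(1) by (rule sup_upper)
    have ex: "\<exists>c\<in>G. \<not> c \<sqsubseteq> k" if k: "k \<in> carrier L" "k \<sqsubseteq> \<Squnion> G" "k \<noteq> \<Squnion> G" for k
    proof (rule ccontr)
      assume "\<not> ?thesis"
      then have "\<Squnion> G \<sqsubseteq> k" using k(1) G(1) by (intro sup_least) (auto simp: Upper_def)
      then show False using k le_antisym[of k "\<Squnion> G"] G(1) by auto
    qed
    show ?thesis
    proof (rule SI)
      show "a \<sqsubseteq> \<Squnion> G" using le_trans[OF D(3)[OF G(2)[OF g]] up[OF g]] that(1) g G(1) by auto
      fix k assume "k \<in> carrier L" "k \<sqsubseteq> \<Squnion> G" "k \<noteq> \<Squnion> G"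
      then obtain c where c: "c \<in> G" "\<not> c \<sqsubseteq> k"
        using ex by blast
      then show "\<exists>c. ?S a c \<and> c \<sqsubseteq> \<Squnion> G \<and> \<not> c \<sqsubseteq> k \<or> ?S c (\<Squnion> G) \<and> c \<sqsubseteq> k"
        using G(2)[OF c(1)] up[OF c(1)] by (intro exI[of _ c]) simp
    qed (use that(1) G(1) in auto)
  qed
  ultimately show ?thesis
    using D(2) unfolding R_order_def up_set_def by blast
qed

text \<open>
  Along a chain from \<open>a\<close>, the relation to \<open>a\<close> passes successors by transitivity and limits because
  the upper sets of an \<open>R\<close>-order are closed under suprema.
\<close>

lemma transfinite_closure_imp_stepwise_below:
  assumes H: "H_relation L R" and "transfinite_closure L R a b"
  shows "stepwise_below L R a b"
proof -
  let ?S = "stepwise_below L R"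
  obtain r :: "'a rel" and x where fam: "transfinite_family L R r x a b"
    using assms(2) by (auto simp: transfinite_closure_def)
  have W: "Well_order r" and xc: "\<And>i. i \<in> Field r \<Longrightarrow> x i \<in> carrier L"
    and step: "\<And>i j. covers r i j \<Longrightarrow> R (x i) (x j)"
    and lim: "\<And>j. j \<in> Field r \<Longrightarrow> underS r j \<noteq> {} \<Longrightarrow> \<not> (\<exists>i. covers r i j)
               \<Longrightarrow> x j = \<Squnion> (x ` underS r j)"
    using fam by (auto simp: transfinite_family_def)
  obtain i0 where i0: "i0 \<in> Field r" "\<And>j. j \<in> Field r \<Longrightarrow> (i0, j) \<in> r" "x i0 = a"
    using fam by (auto simp: transfinite_family_def)
  obtain i1 where i1: "i1 \<in> Field r" "x i1 = b"
    using fam by (auto simp: transfinite_family_def)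
  have wf: "wf (r - Id)" using W unfolding order_on_defs by auto
  have Ro: "R_order L ?S" by (rule R_order_stepwise_below[OF H])
  have trans: "\<And>u v w. ?S u v \<Longrightarrow> ?S v w \<Longrightarrow> ?S u w"
    using Ro unfolding R_order_def by (blast dest: transpD)
  have sup: "\<And>G. G \<subseteq> up_set L ?S a \<Longrightarrow> G \<noteq> {} \<Longrightarrow> \<Squnion> G \<in> up_set L ?S a"
    using Ro xc[OF i0(1)] i0(3) by (auto simp: R_order_def)
  have "j \<in> Field r \<Longrightarrow> ?S a (x j)" for j
  proof (induction j rule: wf_induct_rule[OF wf])
    case (1 j)
    consider "underS r j = {}" | i where "covers r i j" | "underS r j \<noteq> {}" "\<not> (\<exists>i. covers r i j)"
      by auto
    then show ?case
    proof cases
      case 1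
      then have "i0 = j" using i0 \<open>j \<in> Field r\<close> by (auto simp: underS_def)
      then show ?thesis using i0 xc Ro by (auto simp: R_order_def H_relation_def relation_in_def)
    next
      case 2
      then have "(i, j) \<in> r - Id" "i \<in> Field r" by (auto simp: covers_def Field_def)
      then show ?thesis using 1(1) trans relation_imp_stepwise_below[OF H step[OF 2]] by blast
    next
      case 3
      have "x ` underS r j \<subseteq> up_set L ?S a"
        using 1(1) xc by (auto simp: underS_def up_set_def Field_def)
      then show ?thesis
        using sup[of "x ` underS r j"] lim[OF \<open>j \<in> Field r\<close> 3] 3(1) by (auto simp: up_set_def)
    qed
  qed
  then show ?thesis using i1 by auto
qed

text \<open>
  The family is indexed by a well-ordering of the sets of lattice elements, of which there are too
  many for it to be strictly increasing; it is cut off where it reaches \<open>b\<close>.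
\<close>

lemma stepwise_below_imp_transfinite_closure:
  assumes H: "H_relation L R" and ab: "stepwise_below L R a b"
  shows "transfinite_closure L R a b"
proof -
  have abc: "a \<in> carrier L" "b \<in> carrier L" "a \<sqsubseteq> b"
    using ab by (auto simp: stepwise_below_def)
  define I where "I = \<lbrace>a..b\<rbrace>"
  have I: "k \<in> I \<longleftrightarrow> k \<in> carrier L \<and> a \<sqsubseteq> k \<and> k \<sqsubseteq> b" for k
    by (auto simp: I_def at_least_at_most_def)
  have "\<exists>l. l \<in> I \<and> R k l \<and> (k \<noteq> b \<longrightarrow> l \<noteq> k)" if k: "k \<in> I" for k
  proof (cases "k = b")
    case True
    then show ?thesis using k H_relation_refl[OF H] I by auto
  next
    case False
    then obtain l where l: "l \<in> carrier L" "l \<sqsubseteq> b" "l \<noteq> k" "R k l"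
      using ab k I by (auto simp: stepwise_below_def)
    then show ?thesis
      using H_relationD(3)[OF H l(4)] le_trans[of a k l] k abc I by auto
  qed
  then obtain s where s: "\<And>k. k \<in> I \<Longrightarrow> s k \<in> I" "\<And>k. k \<in> I \<Longrightarrow> R k (s k)"
      "\<And>k. k \<in> I \<Longrightarrow> k \<noteq> b \<Longrightarrow> s k \<noteq> k"
    by metis
  have s_le: "k \<sqsubseteq> s k" if "k \<in> I" for k using H_relationD(3)[OF H s(2)[OF that]] .
  have supI: "\<Squnion> (insert a G) \<in> I" if "G \<subseteq> I" for G
  proof -
    have c: "insert a G \<subseteq> carrier L" using that abc I by auto
    then have "a \<sqsubseteq> \<Squnion> (insert a G)" by (intro sup_upper) auto
    moreover have "\<Squnion> (insert a G) \<sqsubseteq> b"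
      using that abc I c by (intro sup_least) (auto simp: Upper_def)
    ultimately show ?thesis using I c by auto
  qed
  obtain w :: "'a set rel" where w: "Well_order w" "Field w = UNIV"
    using well_ordering by metis
  have wo: "refl w" "trans w" "antisym w" "total w" and wf: "wf (w - Id)"
    using w unfolding order_on_defs by auto
  have tot: "(i, j) \<in> w \<or> (j, i) \<in> w" for i j
    using wo(1,4) by (cases "i = j") (auto simp: total_on_def refl_on_def)
  \<comment> \<open>Taking the supremum of \<open>s (x j)\<close> over \<open>j < i\<close> treats the first, successor and limit index alike.\<close>
  define x where "x = wfrec (w - Id) (\<lambda>f i. \<Squnion> (insert a (s ` f ` underS w i)))"
  have x: "x i = \<Squnion> (insert a (s ` x ` underS w i))" for i
  proof -
    have "cut x (w - Id) i ` underS w i = x ` underS w i"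
      by (rule image_cong) (auto simp: cut_def underS_def)
    then show ?thesis
      using wfrec[OF wf, of "\<lambda>f i. \<Squnion> (insert a (s ` f ` underS w i))" i] by (simp add: x_def)
  qed
  have xI: "x i \<in> I" for i
  proof (induction i rule: wf_induct_rule[OF wf])
    case (1 i)
    then have "s ` x ` underS w i \<subseteq> I" using s(1) by (auto simp: underS_def)
    then show ?case unfolding x[of i] by (rule supI)
  qed
  have sub: "insert a (s ` x ` underS w i) \<subseteq> carrier L" for i
    using xI s(1) I abc by blast
  have s_x: "s (x i) \<sqsubseteq> x j" if "(i, j) \<in> w" "i \<noteq> j" for i j
    unfolding x[of j] using that by (intro sup_upper[OF sub]) (auto simp: underS_def)
  have x_s: "x j \<sqsubseteq> u" if "u \<in> carrier L" "a \<sqsubseteq> u" "\<And>i. i \<in> underS w j \<Longrightarrow> s (x i) \<sqsubseteq> u" for j u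
    unfolding x[of j] using that sub[of j] by (intro sup_least) (auto simp: Upper_def)
  have mono: "x i \<sqsubseteq> x j" if "(i, j) \<in> w" for i j
  proof (cases "i = j")
    case False
    then show ?thesis using s_x[OF that False] s_le[OF xI[of i]] le_trans xI s(1) I by meson
  qed (use xI I in auto)
  \<comment> \<open>By Cantor's theorem the sequence cannot be injective, so it stops growing.\<close>
  have "\<exists>i. x i = b"
  proof (rule ccontr)
    assume n: "\<not> ?thesis"
    have "x i \<noteq> x j" if "(i, j) \<in> w" "i \<noteq> j" for i j
    proof
      assume "x i = x j"
      then have "s (x i) = x i"
        using s_x[OF that] s_le[OF xI[of i]] le_antisym xI s(1) I by metis
      then show False using s(3)[OF xI] n by blast
    qed
    then have "inj x" using tot by (metis injI)
    then obtain f :: "'a \<Rightarrow> 'a set" where "surj f" using inj_imp_surj_inv by blast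
    then show False using Cantors_theorem[of UNIV] by auto
  qed
  then obtain e where e: "x e = b" by auto
  define r where "r = w \<inter> (under w e \<times> under w e)"
  have Fr: "Field r = under w e"
    using wo(1) by (auto simp: r_def Field_def refl_on_def)
  have rw: "(i, j) \<in> r \<longleftrightarrow> (i, j) \<in> w \<and> (j, e) \<in> w" for i j
    using transD[OF wo(2)] by (auto simp: r_def under_def)
  have Wr: "Well_order r"
    using Well_order_Restr[OF w(1), of "under w e"] by (simp add: r_def)
  have uS: "underS r j = underS w j" if "(j, e) \<in> w" for j
    using that rw by (auto simp: underS_def)
  have rI: "\<And>i. (i, i) \<in> w" using wo(1) by (auto simp: refl_on_def)
  obtain z where z: "\<And>i. (z, i) \<in> w"
  proof -
    obtain z where "\<And>i. (i, z) \<in> w - Id \<Longrightarrow> i \<notin> UNIV" using wfE_min[OF wf, of undefined UNIV] by auto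
    then have "(z, i) \<in> w" for i using tot[of i z] rI by auto
    then show ?thesis using that by blast
  qed
  have xz: "x z = a"
  proof -
    have "underS w z = {}" using z antisymD[OF wo(3)] by (auto simp: underS_def)
    then have "x z \<sqsubseteq> a" using abc by (intro x_s) auto
    then show ?thesis using xI[of z] I le_antisym abc by auto
  qed
  have "transfinite_family L R r x a b"
    unfolding transfinite_family_def
  proof (intro conjI ballI allI impI)
    show "\<exists>i\<in>Field r. (\<forall>j\<in>Field r. (i, j) \<in> r) \<and> x i = a"
      using z xz by (intro bexI[of _ z]) (auto simp: Fr rw under_def)
    show "\<exists>i\<in>Field r. (\<forall>j\<in>Field r. (j, i) \<in> r) \<and> x i = b"
      using e rI by (intro bexI[of _ e]) (auto simp: Fr rw under_def)
  next
    fix i j assume c: "covers r i j"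
    have ij: "(i, j) \<in> w" "i \<noteq> j" "(j, e) \<in> w" using c by (auto simp: covers_def rw)
    have "(k, i) \<in> w" if "k \<in> underS w j" for k
      using c tot[of i k] that ij rI unfolding covers_def rw underS_def
      by (metis (mono_tags, lifting) mem_Collect_eq wo(2) transD)
    then have "x j \<sqsubseteq> s (x i)"
    proof (intro x_s)
      fix k assume k: "k \<in> underS w j" and le: "\<And>k. k \<in> underS w j \<Longrightarrow> (k, i) \<in> w"
      show "s (x k) \<sqsubseteq> s (x i)"
      proof (cases "k = i")
        case False
        have "s (x k) \<sqsubseteq> x i" using s_x le[OF k] False by blast
        then show ?thesis using s_le[OF xI[of i]] le_trans xI s(1) I by meson
      qed (use xI s I in auto)
    qed (use xI s I in auto)
    then have "x j = s (x i)" using s_x[OF ij(1,2)] le_antisym xI s(1) I by meson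
    then show "R (x i) (x j)" using s(2) xI by simp
  next
    fix j assume j: "j \<in> Field r" and l: "underS r j \<noteq> {} \<and> \<not> (\<exists>i. covers r i j)"
    have je: "(j, e) \<in> w" using j by (simp add: Fr under_def)
    have c: "x ` underS r j \<subseteq> carrier L" using xI I by auto
    obtain i0 where i0: "i0 \<in> underS r j" using l by auto
    show "x j = \<Squnion> (x ` underS r j)"
    proof (rule le_antisym)
      show "\<Squnion> (x ` underS r j) \<sqsubseteq> x j"
        using xI I mono c by (intro sup_least) (auto simp: Upper_def underS_def rw)
      show "x j \<sqsubseteq> \<Squnion> (x ` underS r j)"
      proof (rule x_s)
        show "a \<sqsubseteq> \<Squnion> (x ` underS r j)"
          using sup_upper[OF c, of "x i0"] i0 le_trans[of a "x i0" "\<Squnion> (x ` underS r j)"] xI[of i0] I abc c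
          by auto
        fix i assume i: "i \<in> underS w j"
        then have "(i, j) \<in> w" "i \<noteq> j" by (auto simp: underS_def)
        then obtain k where k: "(i, k) \<in> w" "(k, j) \<in> w" "k \<noteq> i" "k \<noteq> j"
          using l je unfolding covers_def rw by (metis wo(2) transD)
        have "x k \<sqsubseteq> \<Squnion> (x ` underS r j)"
          using k je by (intro sup_upper[OF c]) (auto simp: underS_def rw)
        then show "s (x i) \<sqsubseteq> \<Squnion> (x ` underS r j)"
          using s_x[OF k(1)] k(3) le_trans[of "s (x i)" "x k"] xI s(1) I c by (metis sup_closed)
      qed (use c in auto)
    qed (use xI I c in auto)
  qed (use Wr xI I in auto)
  then show ?thesis
    using H complete_lattice_axioms by (intro transfinite_closureI) (auto simp: H_relation_def)
qed

lemma transfinite_closure_eq_stepwise_below: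
  "H_relation L R \<Longrightarrow> transfinite_closure L R = stepwise_below L R"
  using stepwise_below_imp_transfinite_closure transfinite_closure_imp_stepwise_below by blast

lemma left_arrow_iff:
  assumes H: "H_relation L R"
  shows "left_arrow L R a b \<longleftrightarrow> a \<in> carrier L \<and> b \<in> carrier L \<and> a \<sqsubseteq> b \<and>
    (\<forall>x. R a x \<and> x \<sqsubseteq> b \<longrightarrow> x = a)"
  using H_relationD[OF H] H_relation_refl[OF H]
  by (auto simp: left_arrow_def up_set_def at_least_at_most_def)

text \<open>
  Steps are preserved by joins, so a step leaving a smaller element would yield a step leaving the
  larger one.
\<close>

lemma dual_R_order_left_arrow:
  assumes H: "H_relation L R"
  shows "dual_R_order L (left_arrow L R)"
proof -
  let ?S = "left_arrow L R"
  note S = left_arrow_iff[OF H]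
  \<comment> \<open>An \<open>R\<close>-step below \<open>b\<close> can be pushed up past \<open>a\<close> along joins, where it becomes trivial.\<close>
  have push: "y \<sqsubseteq> a" if "?S a b" "R x y" "y \<sqsubseteq> b" "x \<sqsubseteq> a" for a b x y
  proof -
    have ab: "a \<in> carrier L" "b \<in> carrier L" "a \<sqsubseteq> b" using that S by auto
    have y: "y \<in> carrier L" using H_relationD[OF H that(2)] by auto
    have "R a (y \<squnion> a)" using H_relationD(4)[OF H that(2)] ab that by auto
    moreover have "y \<squnion> a \<sqsubseteq> b" using ab y that join_le by auto
    ultimately have "y \<squnion> a = a" using that S by blast
    then show ?thesis using join_left[of y a] y ab by simp
  qed
  have eq: "y = x" if "R x y" "y \<sqsubseteq> x" for x y
    using that H_relationD[OF H that(1)] le_antisym by auto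
  have "dual_H_relation L ?S"
    unfolding dual_H_relation_def relation_in_def
  proof (intro conjI ballI allI impI)
    fix a b c assume c: "a \<in> carrier L" "b \<in> carrier L" "c \<in> carrier L" and "?S a b \<and> c \<sqsubseteq> b"
    then have ab: "?S a b" "c \<sqsubseteq> b" by auto
    have "x = a \<sqinter> c" if x: "R (a \<sqinter> c) x" "x \<sqsubseteq> c" for x
    proof (rule eq[OF x(1)])
      have xc: "x \<in> carrier L" using H_relationD[OF H x(1)] by auto
      have "x \<sqsubseteq> a"
        using push[OF ab(1) x(1)] le_trans[OF x(2) ab(2)] c xc meet_left by auto
      then show "x \<sqsubseteq> a \<sqinter> c" using x c xc meet_le by auto
    qed
    then show "?S (a \<sqinter> c) c" using c meet_right S by auto
  next
    fix a assume "a \<in> carrier L" then show "?S a a" using S eq by auto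
  qed (use S in auto)
  moreover have "transp ?S"
  proof (rule transpI)
    fix a b c assume ab: "?S a b" and bc: "?S b c"
    have c: "a \<in> carrier L" "b \<in> carrier L" "c \<in> carrier L" "a \<sqsubseteq> b" "b \<sqsubseteq> c" using ab bc S by auto
    have "x = a" if "R a x" "x \<sqsubseteq> c" for x
      using ab push[OF bc that c(4)] that S by auto
    then show "?S a c" using c le_trans[OF c(4,5)] S by auto
  qed
  moreover have "?S (\<Sqinter> G) b" if b: "b \<in> carrier L" and G: "G \<subseteq> down_set L ?S b" "G \<noteq> {}" for b G
  proof -
    have Gc: "G \<subseteq> carrier L" and GS: "\<And>g. g \<in> G \<Longrightarrow> ?S g b" using G by (auto simp: down_set_def)
    obtain g where g: "g \<in> G" using G(2) by blast
    have low: "\<And>g. g \<in> G \<Longrightarrow> \<Sqinter> G \<sqsubseteq> g" using Gc by (rule inf_lower)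
    have "\<Sqinter> G \<sqsubseteq> b" using low[OF g] GS[OF g] le_trans[of "\<Sqinter> G" g b] Gc S by auto
    moreover have "y = \<Sqinter> G" if y: "R (\<Sqinter> G) y" "y \<sqsubseteq> b" for y
    proof (rule eq[OF y(1)])
      have "y \<sqsubseteq> g" if "g \<in> G" for g by (rule push[OF GS[OF that] y low[OF that]])
      then show "y \<sqsubseteq> \<Sqinter> G"
        using H_relationD[OF H y(1)] Gc by (intro inf_greatest) (auto simp: Lower_def)
    qed
    ultimately show ?thesis using b Gc S by auto
  qed
  ultimately show ?thesis
    using S unfolding dual_R_order_def down_set_def by blast
qed

text \<open>
  With \<open>r\<close> the radical: a step from \<open>r\<close> is trivial, so \<open>r\<close> is left-arrow related to the top. Each \<open>x \<noteq> r\<close>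
  below \<open>r\<close> starts a proper step inside \<open>r\<close>, so it is not left-arrow related to \<open>r\<close>.
\<close>

lemma radical_stepwise_below_eq_dual_radical_left_arrow:
  assumes H: "H_relation L R"
  shows "radical L (stepwise_below L R) = dual_radical L (left_arrow L R)"
proof -
  let ?S = "stepwise_below L R" and ?N = "left_arrow L R"
  note rad = R_order_radical[OF complete_lattice_axioms R_order_stepwise_below[OF H]]
    and drad = dual_R_order_radical[OF complete_lattice_axioms dual_R_order_left_arrow[OF H]]
  define r where "r = \<Squnion> (up_set L ?S \<bottom>)"
  have r: "is_radical L ?S r" by (simp add: rad r_def)
  have Sr: "?S \<bottom> r" "r \<in> carrier L"
    using r by (auto simp: is_radical_def stepwise_below_def)
  have HS: "H_relation L ?S" using R_order_stepwise_below[OF H] by (simp add: R_order_def)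
  have "left_arrow L ?S r \<top>" using r by (simp add: is_radical_def)
  then have N: "?N r \<top>"
    using relation_imp_stepwise_below[OF H] unfolding left_arrow_iff[OF H] left_arrow_iff[OF HS] by blast
  have "x = r" if "?N x r" for x
  proof (rule ccontr)
    assume "x \<noteq> r"
    moreover have x: "x \<in> carrier L" "x \<sqsubseteq> r" using that left_arrow_iff[OF H] by auto
    ultimately obtain l where "l \<sqsubseteq> r" "l \<noteq> x" "R x l"
      using Sr bottom_lower unfolding stepwise_below_def by blast
    then show False using that left_arrow_iff[OF H] by blast
  qed
  moreover have "?N r r"
    using dual_R_order_left_arrow[OF H] Sr
    by (simp add: dual_R_order_def dual_H_relation_def relation_in_def)
  ultimately have "right_arrow L ?N \<bottom> r"
    using Sr bottom_lower by (auto simp: right_arrow_def down_set_def at_least_at_most_def)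
  then have "is_dual_radical L ?N r" using N by (simp add: is_dual_radical_def)
  then have "dual_radical L ?N = r" unfolding dual_radical_def drad by simp
  moreover have "radical L ?S = r" unfolding radical_def rad r_def by simp
  ultimately show ?thesis by simp
qed

end

section \<open>Arithmetic in a C*-algebra\<close>

context cstar_algebra
begin

lemma scale_closed [simp, intro]: "x \<in> carrier A \<Longrightarrow> c \<odot> x \<in> carrier A"
  using smult_closed[of c x] by (simp add: complex_ring_def)

lemma scale_add_left: "x \<in> carrier A \<Longrightarrow> (a + b) \<odot> x = a \<odot> x \<oplus> b \<odot> x"
  using smult_l_distr[of a b x] by (simp add: complex_ring_def)

lemma scale_add_right: "\<lbrakk>x \<in> carrier A; y \<in> carrier A\<rbrakk> \<Longrightarrow> c \<odot> (x \<oplus> y) = c \<odot> x \<oplus> c \<odot> y"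
  using smult_r_distr[of c x y] by (simp add: complex_ring_def)

lemma scale_scale: "x \<in> carrier A \<Longrightarrow> a \<odot> (b \<odot> x) = (a * b) \<odot> x"
  using smult_assoc1[of a b x] by (simp add: complex_ring_def)

lemma scale_one [simp]: "x \<in> carrier A \<Longrightarrow> 1 \<odot> x = x"
  using smult_one[of x] by (simp add: complex_ring_def)

lemma scale_zero_left [simp]: "x \<in> carrier A \<Longrightarrow> 0 \<odot> x = \<zero>"
  using smult_l_null[of x] by (simp add: complex_ring_def)

lemma scale_zero_right [simp]: "c \<odot> \<zero> = \<zero>"
  using smult_r_null[of c] by (simp add: complex_ring_def)

lemma minus_eq_scale: "x \<in> carrier A \<Longrightarrow> \<ominus> x = (-1) \<odot> x"
  using smult_l_minus[of 1 x] M.minus_equality[of "(-1) \<odot> x" x] scale_add_left[of x "-1" 1]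
  by simp

lemma scale_minus_right: "x \<in> carrier A \<Longrightarrow> c \<odot> (\<ominus> x) = \<ominus> (c \<odot> x)"
  by (simp add: minus_eq_scale scale_scale mult.commute)

lemma scale_minus_left: "x \<in> carrier A \<Longrightarrow> (- c) \<odot> x = \<ominus> (c \<odot> x)"
  by (simp add: minus_eq_scale scale_scale)

lemma mult_minus_left: "\<lbrakk>x \<in> carrier A; y \<in> carrier A\<rbrakk> \<Longrightarrow> (\<ominus> x) \<otimes> y = \<ominus> (x \<otimes> y)"
  by (simp add: minus_eq_scale smult_m_left m_closed)

lemma mult_minus_right: "\<lbrakk>x \<in> carrier A; y \<in> carrier A\<rbrakk> \<Longrightarrow> x \<otimes> (\<ominus> y) = \<ominus> (x \<otimes> y)"
  by (simp add: minus_eq_scale smult_m_right m_closed)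

lemma adj_minus: "x \<in> carrier A \<Longrightarrow> adj A (\<ominus> x) = \<ominus> (adj A x)"
  by (simp add: minus_eq_scale adj_smult adj_closed)

lemmas algebra_closed = m_closed adj_closed M.minus_closed M.zero_closed M.a_closed M.a_inv_closed

lemmas star_expand = a_minus_def l_distr r_distr m_assoc mult_minus_left mult_minus_right
  adj_add adj_mult adj_adj adj_minus adj_smult smult_m_left smult_m_right
  scale_add_right scale_minus_right scale_scale M.minus_add M.minus_minus

lemma mult_zero_left [simp]: "x \<in> carrier A \<Longrightarrow> \<zero> \<otimes> x = \<zero>"
  using smult_m_left[of \<zero> x 0] by (simp add: m_closed)

lemma mult_zero_right [simp]: "x \<in> carrier A \<Longrightarrow> x \<otimes> \<zero> = \<zero>"
  using smult_m_right[of x \<zero> 0] by (simp add: m_closed)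

lemma adj_zero [simp]: "adj A \<zero> = \<zero>"
  using adj_smult[of \<zero> 0] by (simp add: adj_closed)

lemma nrm_zero [simp]: "nrm A \<zero> = 0"
  by (simp add: nrm_eq_0)

lemma nrm_uminus [simp]: "x \<in> carrier A \<Longrightarrow> nrm A (\<ominus> x) = nrm A x"
  by (simp add: minus_eq_scale nrm_smult)

lemma nrm_minus_commute: "\<lbrakk>x \<in> carrier A; y \<in> carrier A\<rbrakk> \<Longrightarrow> nrm A (x \<ominus> y) = nrm A (y \<ominus> x)"
  using nrm_uminus[of "x \<ominus> y"] M.a_comm[of "\<ominus> x" y] by (simp add: a_minus_def M.minus_add)

lemma nrm_triangle_minus:
  "\<lbrakk>x \<in> carrier A; y \<in> carrier A\<rbrakk> \<Longrightarrow> nrm A (x \<ominus> y) \<le> nrm A x + nrm A y"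
  using nrm_triangle[of x "\<ominus> y"] by (simp add: a_minus_def)

lemma nrm_adj_le: "x \<in> carrier A \<Longrightarrow> nrm A x \<le> nrm A (adj A x)"
proof (cases "nrm A x = 0")
  case False
  assume x: "x \<in> carrier A"
  have "nrm A x * nrm A x \<le> nrm A (adj A x) * nrm A x"
    using nrm_mult[of "adj A x" x] x cstar_identity[OF x] by (simp add: adj_closed power2_eq_square)
  then show ?thesis using False nrm_nonneg[OF x] by simp
qed (simp add: nrm_nonneg adj_closed)

lemma nrm_adj [simp]: "x \<in> carrier A \<Longrightarrow> nrm A (adj A x) = nrm A x"
  using nrm_adj_le[of x] nrm_adj_le[of "adj A x"] by (simp add: adj_closed adj_adj)

lemma nrm_le_of_square_le:
  "\<lbrakk>x \<in> carrier A; 0 \<le> r; nrm A (adj A x \<otimes> x) \<le> r\<^sup>2\<rbrakk> \<Longrightarrow> nrm A x \<le> r"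
  by (simp add: cstar_identity power2_le_iff_abs_le nrm_nonneg)

end

section \<open>Sines and cosines of self-adjoint elements\<close>

text \<open>
  The hypothesis on \<open>c\<close> says that \<open>b = 1 - c\<close> satisfies \<open>b\<^sup>2 + g\<^sup>2 = 1\<close>. In a C*-algebra, which need not
  have a unit, these identities are used for \<open>t = z\<^sup>*\<close>; hence the form in which \<open>b\<close> only occurs
  multiplied into \<open>t\<close> and \<open>z\<close>.
\<close>

lemma (in ring) product_pythagoras:
  assumes R: "t \<in> carrier R" "c \<in> carrier R" "g \<in> carrier R" "z \<in> carrier R"
    and c: "c \<oplus> c = g \<otimes> g \<oplus> c \<otimes> c"
  shows "(t \<ominus> t \<otimes> c) \<otimes> (z \<ominus> c \<otimes> z) \<oplus> (t \<otimes> g) \<otimes> (g \<otimes> z) = t \<otimes> z"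
proof -
  have "(t \<ominus> t \<otimes> c) \<otimes> (z \<ominus> c \<otimes> z) \<oplus> (t \<otimes> g) \<otimes> (g \<otimes> z) =
      t \<otimes> (\<one> \<ominus> (c \<oplus> c) \<oplus> (g \<otimes> g \<oplus> c \<otimes> c)) \<otimes> z"
    using R by algebra
  also have "\<dots> = t \<otimes> (\<one> \<ominus> (c \<oplus> c) \<oplus> (c \<oplus> c)) \<otimes> z" by (simp only: c)
  also have "\<dots> = t \<otimes> z" using R by algebra
  finally show ?thesis .
qed

lemma (in ring) one_minus_commute:
  assumes "c \<in> carrier R" "g \<in> carrier R" "c \<otimes> g = g \<otimes> c"
  shows "(\<one> \<ominus> c) \<otimes> g = g \<otimes> (\<one> \<ominus> c)"
  using assms by (simp add: a_minus_def l_distr r_distr l_minus r_minus)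

lemma (in ring) cosine_mult:
  assumes "t \<in> carrier R" "c \<in> carrier R" "g \<in> carrier R" "z \<in> carrier R"
  shows "(t \<ominus> t \<otimes> c) \<otimes> g = t \<otimes> ((\<one> \<ominus> c) \<otimes> g)" "g \<otimes> (z \<ominus> c \<otimes> z) = g \<otimes> (\<one> \<ominus> c) \<otimes> z"
  using assms by algebra+

lemma (in ring) double_angle_mult:
  assumes "t \<in> carrier R" "k \<in> carrier R" "z \<in> carrier R" "v \<in> carrier R"
  shows "t \<ominus> (t \<otimes> k \<oplus> t \<otimes> k) = t \<otimes> (\<one> \<ominus> (k \<oplus> k))"
    and "z \<ominus> (k \<otimes> z \<oplus> k \<otimes> z) = (\<one> \<ominus> (k \<oplus> k)) \<otimes> z"
    and "t \<otimes> v \<oplus> t \<otimes> v = t \<otimes> (v \<oplus> v)" "v \<otimes> z \<oplus> v \<otimes> z = (v \<oplus> v) \<otimes> z"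
proof -
  show "t \<ominus> (t \<otimes> k \<oplus> t \<otimes> k) = t \<otimes> (\<one> \<ominus> (k \<oplus> k))" using assms by (algebra, simp)
  show "z \<ominus> (k \<otimes> z \<oplus> k \<otimes> z) = (\<one> \<ominus> (k \<oplus> k)) \<otimes> z" using assms by algebra
qed (use assms in \<open>simp_all add: l_distr r_distr\<close>)

lemma (in ring) square_add:
  assumes R: "d \<in> carrier R" "k \<in> carrier R" and "d \<otimes> k = k \<otimes> d"
  shows "((k \<otimes> d \<oplus> k \<otimes> d) \<oplus> (k \<otimes> d \<oplus> k \<otimes> d)) \<oplus> (d \<ominus> k) \<otimes> (d \<ominus> k) = (d \<oplus> k) \<otimes> (d \<oplus> k)"
proof -
  have "((k \<otimes> d \<oplus> d \<otimes> k) \<oplus> (k \<otimes> d \<oplus> d \<otimes> k)) \<oplus> (d \<ominus> k) \<otimes> (d \<ominus> k) = (d \<oplus> k) \<otimes> (d \<oplus> k)"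
    using R by algebra
  then show ?thesis by (simp only: assms(3))
qed

text \<open>
  This is \<open>sin\<^sup>2 2\<theta> + cos\<^sup>2 2\<theta> = 1\<close> with \<open>sin 2\<theta> = 2bg\<close> and \<open>cos 2\<theta> = 1 - 2g\<^sup>2\<close>.
\<close>

lemma (in ring) double_angle_pythagoras:
  assumes R: "t \<in> carrier R" "c \<in> carrier R" "g \<in> carrier R" "z \<in> carrier R"
    and c: "c \<oplus> c = g \<otimes> g \<oplus> c \<otimes> c" and cg: "c \<otimes> g = g \<otimes> c"
  shows "((t \<ominus> t \<otimes> c) \<otimes> g \<oplus> (t \<ominus> t \<otimes> c) \<otimes> g) \<otimes> (g \<otimes> (z \<ominus> c \<otimes> z) \<oplus> g \<otimes> (z \<ominus> c \<otimes> z)) \<oplus>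
         (t \<ominus> (t \<otimes> (g \<otimes> g) \<oplus> t \<otimes> (g \<otimes> g))) \<otimes> (z \<ominus> ((g \<otimes> g) \<otimes> z \<oplus> (g \<otimes> g) \<otimes> z)) = t \<otimes> z"
proof -
  define b where "b = \<one> \<ominus> c"
  define k where "k = g \<otimes> g"
  have b: "b \<in> carrier R" "k \<in> carrier R" using R by (simp_all add: b_def k_def)
  have bg: "b \<otimes> g = g \<otimes> b" unfolding b_def using R cg by (intro one_minus_commute)
  define d where "d = b \<otimes> b"
  have d: "d \<in> carrier R" using b by (simp add: d_def)
  have d1: "d = \<one> \<ominus> k"
  proof -
    have "d = \<one> \<ominus> (c \<oplus> c) \<oplus> (k \<oplus> c \<otimes> c) \<ominus> k"
      unfolding b_def d_def using R b(2) by (algebra, simp)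
    also have "\<dots> = \<one> \<ominus> k" unfolding k_def c[symmetric] using R by algebra
    finally show ?thesis .
  qed
  have dk: "d \<oplus> k = \<one>" "d \<otimes> k = k \<otimes> d" "\<one> \<ominus> (k \<oplus> k) = d \<ominus> k"
    unfolding d1 using b by (algebra, (simp; fail)?)+
  have "(g \<otimes> b) \<otimes> (g \<otimes> b) = g \<otimes> (b \<otimes> g) \<otimes> b" using R b by (simp add: m_assoc)
  also have "\<dots> = k \<otimes> d" unfolding bg k_def d_def using R b by (simp add: m_assoc)
  finally have bggb: "(g \<otimes> b) \<otimes> (g \<otimes> b) = k \<otimes> d" .
  define v where "v = g \<otimes> b"
  have v: "v \<in> carrier R" "v \<otimes> v = k \<otimes> d" using R b bggb by (simp_all add: v_def)
  define V where "V = v \<oplus> v"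
  define D where "D = d \<ominus> k"
  have VD: "V \<in> carrier R" "D \<in> carrier R" using v d b by (simp_all add: V_def D_def)
  have one: "V \<otimes> V \<oplus> D \<otimes> D = \<one>"
    using square_add[OF d b(2) dk(2)] v(1) by (simp add: V_def D_def l_distr r_distr v(2) dk(1))
  have "t \<otimes> V \<otimes> (V \<otimes> z) \<oplus> t \<otimes> D \<otimes> (D \<otimes> z) = t \<otimes> (V \<otimes> V \<oplus> D \<otimes> D) \<otimes> z"
    using R VD by (simp add: m_assoc l_distr r_distr)
  then have "t \<otimes> V \<otimes> (V \<otimes> z) \<oplus> t \<otimes> D \<otimes> (D \<otimes> z) = t \<otimes> z"
    unfolding one using R by simp
  then have "(t \<otimes> v \<oplus> t \<otimes> v) \<otimes> (v \<otimes> z \<oplus> v \<otimes> z) \<oplus>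
     (t \<ominus> (t \<otimes> k \<oplus> t \<otimes> k)) \<otimes> (z \<ominus> (k \<otimes> z \<oplus> k \<otimes> z)) = t \<otimes> z"
    by (simp only: double_angle_mult[OF R(1) b(2) R(4) v(1)] dk V_def D_def)
  then show ?thesis
    using cosine_mult[OF R] by (simp only: b_def[symmetric] bg v_def[symmetric] k_def[symmetric])
qed

lemma (in ring) double_angle_symmetric:
  assumes R: "t \<in> carrier R" "c \<in> carrier R" "g \<in> carrier R" "z \<in> carrier R"
    and cg: "c \<otimes> g = g \<otimes> c"
  shows "((t \<ominus> t \<otimes> c) \<otimes> g \<oplus> (t \<ominus> t \<otimes> c) \<otimes> g) \<otimes> (z \<ominus> ((g \<otimes> g) \<otimes> z \<oplus> (g \<otimes> g) \<otimes> z)) =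
         (t \<ominus> (t \<otimes> (g \<otimes> g) \<oplus> t \<otimes> (g \<otimes> g))) \<otimes> (g \<otimes> (z \<ominus> c \<otimes> z) \<oplus> g \<otimes> (z \<ominus> c \<otimes> z))"
proof -
  define b where "b = \<one> \<ominus> c"
  define k where "k = g \<otimes> g"
  have b: "b \<in> carrier R" "k \<in> carrier R" using R by (simp_all add: b_def k_def)
  have bg: "b \<otimes> g = g \<otimes> b" unfolding b_def using R cg by (intro one_minus_commute)
  define v where "v = g \<otimes> b"
  have v: "v \<in> carrier R" using R b by (simp add: v_def)
  have "v \<otimes> k = g \<otimes> (b \<otimes> g) \<otimes> g" using R b by (simp add: v_def k_def m_assoc)
  also have "\<dots> = g \<otimes> g \<otimes> (b \<otimes> g)" unfolding bg using R b by (simp add: m_assoc bg)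
  finally have vk: "v \<otimes> k = k \<otimes> v" by (simp add: v_def k_def bg)
  define V where "V = v \<oplus> v"
  define D where "D = \<one> \<ominus> (k \<oplus> k)"
  have VD: "V \<in> carrier R" "D \<in> carrier R" using v b by (simp_all add: V_def D_def)
  have "V \<otimes> D = D \<otimes> V"
    using v b vk
    by (simp add: V_def D_def a_minus_def l_distr r_distr l_minus r_minus minus_add, simp add: a_ac)
  then have "t \<otimes> V \<otimes> (D \<otimes> z) = t \<otimes> D \<otimes> (V \<otimes> z)"
    using R VD by (metis m_assoc m_closed)
  then have "(t \<otimes> v \<oplus> t \<otimes> v) \<otimes> (z \<ominus> (k \<otimes> z \<oplus> k \<otimes> z)) =
      (t \<ominus> (t \<otimes> k \<oplus> t \<otimes> k)) \<otimes> (v \<otimes> z \<oplus> v \<otimes> z)"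
    unfolding double_angle_mult[OF R(1) b(2) R(4) v] V_def D_def .
  then show ?thesis
    using cosine_mult[OF R] by (simp only: b_def[symmetric] bg v_def[symmetric] k_def[symmetric])
qed

lemma (in ring) minus_identities:
  assumes "x \<in> carrier R" "y \<in> carrier R" "z \<in> carrier R"
  shows "x \<ominus> z = (x \<ominus> y) \<oplus> (y \<ominus> z)"
    and "x \<otimes> x \<ominus> y \<otimes> y = x \<otimes> (x \<ominus> y) \<oplus> (x \<ominus> y) \<otimes> y"
    and "(z \<oplus> x) \<ominus> (z \<oplus> y) = x \<ominus> y"
  using assms by algebra+

text \<open>
  The unitization is a ring, in which expressions like \<open>(1 - c)z\<close> can be computed; algebraic identities
  are then pulled back along the embedding. It is not given a norm.
\<close>
definition adjoin_unit :: "'a cstar \<Rightarrow> (complex \<times> 'a) ring" where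
  "adjoin_unit A = \<lparr>carrier = UNIV \<times> carrier A,
     monoid.mult = (\<lambda>(a, x) (b, y). (a * b, (a \<odot>\<^bsub>A\<^esub> y \<oplus>\<^bsub>A\<^esub> b \<odot>\<^bsub>A\<^esub> x) \<oplus>\<^bsub>A\<^esub> x \<otimes>\<^bsub>A\<^esub> y)),
     one = (1, \<zero>\<^bsub>A\<^esub>), ring.zero = (0, \<zero>\<^bsub>A\<^esub>),
     add = (\<lambda>(a, x) (b, y). (a + b, x \<oplus>\<^bsub>A\<^esub> y))\<rparr>"

definition embed :: "'a \<Rightarrow> complex \<times> 'a" where "embed x = (0, x)"

context cstar_algebra
begin

lemma ring_adjoin_unit: "ring (adjoin_unit A)"
proof (rule ringI)
  show "abelian_group (adjoin_unit A)"
  proof (rule abelian_groupI)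
    fix u assume "u \<in> carrier (adjoin_unit A)"
    then show "\<exists>v\<in>carrier (adjoin_unit A). v \<oplus>\<^bsub>adjoin_unit A\<^esub> u = \<zero>\<^bsub>adjoin_unit A\<^esub>"
      by (intro bexI[of _ "(- fst u, \<ominus> snd u)"]) (auto simp: adjoin_unit_def M.l_neg)
  qed (auto simp: adjoin_unit_def M.a_ac)
  show "Group.monoid (adjoin_unit A)"
    by (rule monoidI)
      (auto simp: adjoin_unit_def m_closed star_expand M.a_ac mult.commute mult.left_commute)
next
  fix u v w assume uvw: "u \<in> carrier (adjoin_unit A)" "v \<in> carrier (adjoin_unit A)" "w \<in> carrier (adjoin_unit A)"
  obtain a x b y c z where e: "u = (a, x)" "v = (b, y)" "w = (c, z)"
    by (metis prod.exhaust)
  have c: "x \<in> carrier A" "y \<in> carrier A" "z \<in> carrier A"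
    using uvw by (auto simp: e adjoin_unit_def)
  show "(u \<oplus>\<^bsub>adjoin_unit A\<^esub> v) \<otimes>\<^bsub>adjoin_unit A\<^esub> w =
      u \<otimes>\<^bsub>adjoin_unit A\<^esub> w \<oplus>\<^bsub>adjoin_unit A\<^esub> v \<otimes>\<^bsub>adjoin_unit A\<^esub> w"
    using c by (simp add: e adjoin_unit_def m_closed l_distr scale_add_left scale_add_right distrib_right)
      (simp add: M.a_ac m_closed)
  show "w \<otimes>\<^bsub>adjoin_unit A\<^esub> (u \<oplus>\<^bsub>adjoin_unit A\<^esub> v) =
      w \<otimes>\<^bsub>adjoin_unit A\<^esub> u \<oplus>\<^bsub>adjoin_unit A\<^esub> w \<otimes>\<^bsub>adjoin_unit A\<^esub> v"
    using c by (simp add: e adjoin_unit_def m_closed r_distr scale_add_left scale_add_right distrib_left)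
      (simp add: M.a_ac m_closed)
qed

sublocale U: ring "adjoin_unit A" by (rule ring_adjoin_unit)

lemma embed_closed: "x \<in> carrier A \<Longrightarrow> embed x \<in> carrier (adjoin_unit A)"
  by (simp add: embed_def adjoin_unit_def)

lemma embed_add: "embed (x \<oplus> y) = embed x \<oplus>\<^bsub>adjoin_unit A\<^esub> embed y"
  by (simp add: embed_def adjoin_unit_def)

lemma embed_mult: "\<lbrakk>x \<in> carrier A; y \<in> carrier A\<rbrakk> \<Longrightarrow> embed (x \<otimes> y) = embed x \<otimes>\<^bsub>adjoin_unit A\<^esub> embed y"
  by (simp add: embed_def adjoin_unit_def m_closed)

lemma embed_zero: "embed \<zero> = \<zero>\<^bsub>adjoin_unit A\<^esub>"
  by (simp add: embed_def adjoin_unit_def)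

lemma embed_uminus: "x \<in> carrier A \<Longrightarrow> embed (\<ominus> x) = \<ominus>\<^bsub>adjoin_unit A\<^esub> (embed x)"
  by (rule U.minus_equality[symmetric])
    (auto simp: embed_closed embed_add[symmetric] M.l_neg embed_zero[symmetric])

lemma embed_minus: "\<lbrakk>x \<in> carrier A; y \<in> carrier A\<rbrakk> \<Longrightarrow> embed (x \<ominus> y) = embed x \<ominus>\<^bsub>adjoin_unit A\<^esub> embed y"
  by (simp add: a_minus_def embed_add embed_uminus)

lemmas embed_simps = embed_add embed_mult embed_zero embed_uminus embed_minus algebra_closed

lemma embed_eq_iff: "embed x = embed y \<longleftrightarrow> x = y"
  by (simp add: embed_def)

lemma embed_eqI: "\<lbrakk>x \<in> carrier A; embed x = embed y\<rbrakk> \<Longrightarrow> x = y"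
  by (simp add: embed_eq_iff)

lemma minus_identities:
  assumes "x \<in> carrier A" "y \<in> carrier A" "z \<in> carrier A"
  shows minus_telescope: "x \<ominus> z = (x \<ominus> y) \<oplus> (y \<ominus> z)"
    and square_minus: "x \<otimes> x \<ominus> y \<otimes> y = x \<otimes> (x \<ominus> y) \<oplus> (x \<ominus> y) \<otimes> y"
    and add_minus_add: "(z \<oplus> x) \<ominus> (z \<oplus> y) = x \<ominus> y"
  using U.minus_identities[OF assms[THEN embed_closed]] assms
  by - (rule embed_eqI, simp only: embed_simps, simp only: embed_simps)+

lemma closedin_iff:
  "closedin (Metric_space.mtopology (carrier A) (cdist A)) S \<longleftrightarrow>
    S \<subseteq> carrier A \<and> (\<forall>x\<in>carrier A. (\<forall>e>0. \<exists>y\<in>S. nrm A (x \<ominus> y) < e) \<longrightarrow> x \<in> S)"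
proof -
  interpret MS: Metric_space "carrier A" "cdist A" by (rule Metric_space)
  have D: "disjnt S (MS.mball x r) \<longleftrightarrow> (\<forall>y\<in>S. \<not> nrm A (x \<ominus> y) < r)"
    if "S \<subseteq> carrier A" "x \<in> carrier A" for x r
  proof -
    have "y \<in> MS.mball x r \<longleftrightarrow> nrm A (x \<ominus> y) < r" if "y \<in> S" for y
      using that \<open>S \<subseteq> carrier A\<close> \<open>x \<in> carrier A\<close> by (simp add: cdist_def subset_iff)
    then show ?thesis unfolding disjnt_iff by blast
  qed
  show ?thesis
  proof (cases "S \<subseteq> carrier A")
    case True
    define near where "near x \<longleftrightarrow> (\<forall>e>0. \<exists>y\<in>S. nrm A (x \<ominus> y) < e)" for x
    have "(\<exists>r>0. disjnt S (MS.mball x r)) \<longleftrightarrow> \<not> near x" if "x \<in> carrier A" for x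
      unfolding near_def D[OF True that] by blast
    then have "closedin MS.mtopology S \<longleftrightarrow> (\<forall>x\<in>carrier A. near x \<longrightarrow> x \<in> S)"
      unfolding MS.closedin_metric using True by blast
    then show ?thesis using True by (simp add: near_def)
  qed (simp add: MS.closedin_metric)
qed

text \<open>
  Closed sets in terms of distances measured by the norm, for which estimates can be used directly.
\<close>
definition norm_closed :: "'a set \<Rightarrow> bool" where
  "norm_closed S \<longleftrightarrow>
    S \<subseteq> carrier A \<and> (\<forall>x\<in>carrier A. (\<forall>e>0. \<exists>y\<in>S. nrm A (x \<ominus> y) < e) \<longrightarrow> x \<in> S)"

lemma norm_closedD:
  "\<lbrakk>norm_closed S; x \<in> carrier A; \<And>e. e > 0 \<Longrightarrow> \<exists>y\<in>S. nrm A (x \<ominus> y) < e\<rbrakk> \<Longrightarrow> x \<in> S"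
  by (auto simp: norm_closed_def)

text \<open>
  The equation \<open>2c = h + c\<^sup>2\<close> says \<open>(1 - c)\<^sup>2 = 1 - h\<close>. A solution is a fixed point of
  \<open>c \<mapsto> (h + c\<^sup>2)/2\<close>. It is found in any closed set \<open>S\<close> stable under this map, so \<open>S\<close> can force the solution
  to lie in an ideal, to be self-adjoint and to commute with given elements.
\<close>

lemma exists_sqrt_complement:
  assumes h: "h \<in> carrier A" "nrm A h < 1"
    and S: "norm_closed S" "\<zero> \<in> S" and stable: "\<And>c. c \<in> S \<Longrightarrow> (1/2) \<odot> (h \<oplus> c \<otimes> c) \<in> S"
  obtains c where "c \<in> S" "c \<oplus> c = h \<oplus> c \<otimes> c"
proof -
  interpret MS: Metric_space "carrier A" "cdist A" by (rule Metric_space)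
  \<comment> \<open>The smaller root of \<open>2r = \<parallel>h\<parallel> + r\<^sup>2\<close>: the map preserves the ball of radius \<open>r\<close> and contracts it by the factor \<open>r < 1\<close>.\<close>
  define r where "r = 1 - sqrt (1 - nrm A h)"
  have r: "0 \<le> r" "r < 1" "(nrm A h + r * r) / 2 = r"
    using h nrm_nonneg[OF h(1)] by (auto simp: r_def field_simps)
  define f where "f c = (1/2) \<odot> (h \<oplus> c \<otimes> c)" for c
  define T where "T = {c \<in> S. nrm A c \<le> r}"
  have Sc: "S \<subseteq> carrier A" using S by (simp add: norm_closed_def)
  have T: "T \<subseteq> carrier A" using Sc by (auto simp: T_def)
  have "norm_closed T"
    unfolding norm_closed_def
  proof (intro conjI ballI impI T)
    fix x assume x: "x \<in> carrier A" and lim: "\<forall>e>0. \<exists>y\<in>T. nrm A (x \<ominus> y) < e"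
    have "x \<in> S" by (rule norm_closedD[OF S(1) x]) (use lim T_def in blast)
    moreover have "nrm A x \<le> r + e" if e: "e > 0" for e
    proof -
      obtain y where y: "y \<in> T" "nrm A (x \<ominus> y) < e" using lim e by blast
      have "x = (x \<ominus> y) \<oplus> y" using x y T by (auto simp: a_minus_def M.a_assoc M.l_neg)
      then have "nrm A x \<le> nrm A (x \<ominus> y) + nrm A y"
        using nrm_triangle[of "x \<ominus> y" y] x y T by (metis M.minus_closed subsetD)
      then show ?thesis using y by (auto simp: T_def)
    qed
    then have "nrm A x \<le> r" by (rule field_le_epsilon)
    ultimately show "x \<in> T" by (simp add: T_def)
  qed
  then have "closedin MS.mtopology T"
    by (simp add: closedin_iff norm_closed_def)
  interpret Sub: Submetric "carrier A" "cdist A" T by unfold_locales (rule T)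
  have comp: "Sub.sub.mcomplete"
    using Sub.closedin_mcomplete_imp_mcomplete[OF \<open>closedin MS.mtopology T\<close> complete] .
  have fT: "f c \<in> T" if "c \<in> T" for c
  proof -
    have c: "c \<in> carrier A" "c \<in> S" "nrm A c \<le> r" using that T by (auto simp: T_def)
    have "nrm A (h \<oplus> c \<otimes> c) \<le> nrm A h + r * r"
      using nrm_triangle[of h "c \<otimes> c"] nrm_mult[of c c] c h mult_mono[of "nrm A c" r "nrm A c" r] r
      by (simp add: m_closed nrm_nonneg)
    then show ?thesis
      using stable[OF c(2)] r c(1) h by (simp add: T_def f_def nrm_smult m_closed)
  qed
  have con: "cdist A (f x) (f y) \<le> r * cdist A x y" if "x \<in> T" "y \<in> T" for x y
  proof -
    have xy: "x \<in> carrier A" "nrm A x \<le> r" "y \<in> carrier A" "nrm A y \<le> r"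
      using that T by (auto simp: T_def)
    have "f x \<ominus> f y = (1/2) \<odot> (x \<otimes> (x \<ominus> y) \<oplus> (x \<ominus> y) \<otimes> y)"
    proof -
      have "f x \<ominus> f y = (1/2) \<odot> ((h \<oplus> x \<otimes> x) \<ominus> (h \<oplus> y \<otimes> y))"
        unfolding f_def a_minus_def using xy h
        by (simp add: scale_add_right scale_minus_right m_closed)
      then show ?thesis using xy h by (simp add: add_minus_add square_minus m_closed)
    qed
    then have "nrm A (f x \<ominus> f y) \<le> (nrm A (x \<otimes> (x \<ominus> y)) + nrm A ((x \<ominus> y) \<otimes> y)) / 2"
      using nrm_triangle[of "x \<otimes> (x \<ominus> y)" "(x \<ominus> y) \<otimes> y"] xy
      by (simp add: nrm_smult m_closed)
    also have "\<dots> \<le> (r * nrm A (x \<ominus> y) + nrm A (x \<ominus> y) * r) / 2"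
    proof -
      have "nrm A (x \<otimes> (x \<ominus> y)) \<le> r * nrm A (x \<ominus> y)"
        by (rule order_trans[OF nrm_mult mult_right_mono]) (use xy in \<open>simp_all add: nrm_nonneg\<close>)
      moreover have "nrm A ((x \<ominus> y) \<otimes> y) \<le> nrm A (x \<ominus> y) * r"
        by (rule order_trans[OF nrm_mult mult_left_mono]) (use xy in \<open>simp_all add: nrm_nonneg\<close>)
      ultimately show ?thesis by (simp add: mult.commute)
    qed
    finally show ?thesis using fT[OF that(1)] fT[OF that(2)] T xy by (auto simp: cdist_def)
  qed
  have "\<zero> \<in> T" using S r by (simp add: T_def)
  then obtain c where c: "c \<in> T" "f c = c"
    using Sub.sub.Banach_fixedpoint_thm[OF comp _ _ r(2), of f] fT con by blast
  have cc: "c \<in> carrier A" using c T by auto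
  have "c \<oplus> c = f c \<oplus> f c" by (simp only: c(2))
  also have "\<dots> = (1/2 + 1/2) \<odot> (h \<oplus> c \<otimes> c)"
    unfolding f_def using cc h by (subst scale_add_left) (auto simp: m_closed)
  finally show ?thesis using that[of c] c cc h by (simp add: T_def m_closed)
qed

text \<open>
  Because \<open>p\<^sup>*q\<close> is self-adjoint, \<open>(p + cq)\<^sup>*(p + cq) = p\<^sup>*p + q\<^sup>*q = z\<^sup>*z\<close> for \<open>c = \<plusminus>\<i>\<close>; so both
  \<open>p + \<i>q\<close> and \<open>p - \<i>q\<close> have the norm of \<open>z\<close>, and \<open>p\<close> and \<open>q\<close> are combinations of them. This replaces
  the monotonicity of the norm on positive elements.
\<close>

lemma nrm_le_pythagoras:
  assumes p: "p \<in> carrier A" and q: "q \<in> carrier A" and pq: "adj A p \<otimes> q = adj A q \<otimes> p"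
    and sum: "adj A p \<otimes> p \<oplus> adj A q \<otimes> q = adj A z \<otimes> z" and z: "z \<in> carrier A"
  shows "nrm A p \<le> nrm A z" "nrm A q \<le> nrm A z"
proof -
  have eq: "nrm A (p \<oplus> c \<odot> q) = nrm A z" if c: "c = \<i> \<or> c = - \<i>" for c
  proof -
    define a where "a = c \<odot> (adj A q \<otimes> p)"
    have [simp]: "a \<in> carrier A" using p q by (simp add: a_def algebra_closed)
    have "adj A (p \<oplus> c \<odot> q) \<otimes> (p \<oplus> c \<odot> q) = adj A p \<otimes> p \<oplus> (\<ominus> a \<oplus> (a \<oplus> adj A q \<otimes> q))"
      using c p q pq by (auto simp: star_expand algebra_closed scale_minus_left a_def M.a_ac)
    also have "\<dots> = adj A z \<otimes> z" using p q sum by (simp add: algebra_closed M.r_neg1)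
    finally have "(nrm A (p \<oplus> c \<odot> q))\<^sup>2 = (nrm A z)\<^sup>2"
      using cstar_identity[of "p \<oplus> c \<odot> q"] cstar_identity[OF z] p q by simp
    then show ?thesis using nrm_nonneg p q z by (simp add: power2_eq_iff_nonneg)
  qed
  define a where "a = p \<oplus> \<i> \<odot> q"
  define b where "b = p \<oplus> (- \<i>) \<odot> q"
  have ab: "a \<in> carrier A" "b \<in> carrier A" "nrm A a = nrm A z" "nrm A b = nrm A z"
    using p q eq by (auto simp: a_def b_def)
  have "a \<oplus> b = (p \<oplus> p) \<oplus> (\<i> \<odot> q \<oplus> \<ominus> (\<i> \<odot> q))"
    unfolding a_def b_def using p q by (simp add: scale_minus_left M.a_ac)
  also have "\<dots> = (1 + 1) \<odot> p" using p q by (simp only: scale_add_left scale_one M.r_neg scale_closed) simp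
  finally have "2 * nrm A p \<le> 2 * nrm A z" using nrm_triangle[OF ab(1,2)] ab(3,4) p
    by (simp add: nrm_smult)
  then show "nrm A p \<le> nrm A z" by simp
  have "a \<ominus> b = (\<i> \<odot> q \<oplus> \<i> \<odot> q) \<oplus> (p \<oplus> \<ominus> p)"
    unfolding a_def b_def using p q
    by (simp add: scale_minus_left M.a_ac a_minus_def M.minus_add)
  also have "\<dots> = (\<i> + \<i>) \<odot> q" using p q by (simp only: scale_add_left M.r_neg scale_closed) simp
  finally have "2 * nrm A q \<le> 2 * nrm A z" using nrm_triangle_minus[OF ab(1,2)] ab(3,4) q
    by (simp add: nrm_smult norm_mult flip: mult_2)
  then show "nrm A q \<le> nrm A z" by simp
qed

end

context cstar_algebra
begin

text \<open>
  Apply the preceding inequality to \<open>p = (1 - c)z\<close>, \<open>q = gz\<close>, and for the last claim to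
  \<open>p = 2g(1 - c)z\<close>, \<open>q = (1 - 2g\<^sup>2)z\<close>.
\<close>

lemma cosine_contractive:
  assumes g: "g \<in> carrier A" "adj A g = g" and c: "c \<in> carrier A" "adj A c = c"
    and gc: "c \<oplus> c = g \<otimes> g \<oplus> c \<otimes> c" "c \<otimes> g = g \<otimes> c" and z: "z \<in> carrier A"
  shows "nrm A (z \<ominus> c \<otimes> z) \<le> nrm A z" "nrm A (g \<otimes> z) \<le> nrm A z"
    and "2 * nrm A (g \<otimes> (z \<ominus> c \<otimes> z)) \<le> nrm A z"
proof -
  define t where "t = adj A z"
  have t: "t \<in> carrier A" using z by (simp add: t_def adj_closed)
  have emb: "embed c \<oplus>\<^bsub>adjoin_unit A\<^esub> embed c =
      embed g \<otimes>\<^bsub>adjoin_unit A\<^esub> embed g \<oplus>\<^bsub>adjoin_unit A\<^esub> embed c \<otimes>\<^bsub>adjoin_unit A\<^esub> embed c"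
      "embed c \<otimes>\<^bsub>adjoin_unit A\<^esub> embed g = embed g \<otimes>\<^bsub>adjoin_unit A\<^esub> embed c"
    using gc g c by (metis embed_add embed_mult m_closed)+
  note clo = t g(1) c(1) z
  note E = embed_closed[OF t] embed_closed[OF c(1)] embed_closed[OF g(1)] embed_closed[OF z]
  have y: "adj A (z \<ominus> c \<otimes> z) = t \<ominus> t \<otimes> c" and gz: "adj A (g \<otimes> z) = t \<otimes> g"
    using z c g by (simp_all add: t_def star_expand algebra_closed)
  have sq: "adj A (z \<ominus> c \<otimes> z) \<otimes> (z \<ominus> c \<otimes> z) \<oplus> adj A (g \<otimes> z) \<otimes> (g \<otimes> z) = t \<otimes> z"
  proof -
    have "embed ((t \<ominus> t \<otimes> c) \<otimes> (z \<ominus> c \<otimes> z) \<oplus> (t \<otimes> g) \<otimes> (g \<otimes> z)) = embed (t \<otimes> z)"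
      using U.product_pythagoras[OF E emb(1)] clo by (simp only: embed_simps)
    then show ?thesis unfolding y gz embed_eq_iff .
  qed
  have "adj A (z \<ominus> c \<otimes> z) \<otimes> (g \<otimes> z) = adj A (g \<otimes> z) \<otimes> (z \<ominus> c \<otimes> z)"
  proof -
    have "c \<otimes> (g \<otimes> z) = g \<otimes> (c \<otimes> z)" using gc(2) clo by (metis m_assoc)
    then show ?thesis unfolding y gz using clo by (simp add: star_expand algebra_closed)
  qed
  from nrm_le_pythagoras[OF _ _ this, of z] sq
  show "nrm A (z \<ominus> c \<otimes> z) \<le> nrm A z" "nrm A (g \<otimes> z) \<le> nrm A z"
    using clo by (simp_all add: t_def algebra_closed)
  define p where "p = g \<otimes> (z \<ominus> c \<otimes> z) \<oplus> g \<otimes> (z \<ominus> c \<otimes> z)"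
  define q where "q = z \<ominus> ((g \<otimes> g) \<otimes> z \<oplus> (g \<otimes> g) \<otimes> z)"
  have pq: "p \<in> carrier A" "q \<in> carrier A" using clo by (simp_all add: p_def q_def algebra_closed)
  have p': "adj A p = (t \<ominus> t \<otimes> c) \<otimes> g \<oplus> (t \<ominus> t \<otimes> c) \<otimes> g"
    unfolding p_def using y clo g by (simp add: adj_add adj_mult algebra_closed)
  have q': "adj A q = t \<ominus> (t \<otimes> (g \<otimes> g) \<oplus> t \<otimes> (g \<otimes> g))"
    unfolding q_def using clo g
    by (simp add: a_minus_def adj_add adj_minus adj_mult algebra_closed t_def)
  have "embed (adj A p \<otimes> p \<oplus> adj A q \<otimes> q) = embed (t \<otimes> z)"
    unfolding p' q' unfolding p_def q_def
    using U.double_angle_pythagoras[OF E emb] clo by (simp only: embed_simps)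
  moreover have "embed (adj A p \<otimes> q) = embed (adj A q \<otimes> p)"
    unfolding p' q' unfolding p_def q_def
    using U.double_angle_symmetric[OF E emb(2)] clo by (simp only: embed_simps)
  ultimately have "nrm A p \<le> nrm A z"
    using nrm_le_pythagoras(1)[OF pq, of z] z by (simp add: embed_eq_iff t_def)
  moreover have "p = (1 + 1) \<odot> (g \<otimes> (z \<ominus> c \<otimes> z))"
    using clo by (simp only: scale_add_left scale_one p_def algebra_closed)
  ultimately show "2 * nrm A (g \<otimes> (z \<ominus> c \<otimes> z)) \<le> nrm A z"
    using clo by (simp add: nrm_smult algebra_closed)
qed

text \<open>
  For \<open>w = g(1 - c)\<close> the last estimate with \<open>z = w\<close> reads \<open>2\<parallel>w\<parallel>\<^sup>2 \<le> \<parallel>w\<parallel>\<close>.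
\<close>

lemma half_sine_bound:
  assumes g: "g \<in> carrier A" "adj A g = g" and c: "c \<in> carrier A" "adj A c = c"
    and gc: "c \<oplus> c = g \<otimes> g \<oplus> c \<otimes> c" "c \<otimes> g = g \<otimes> c"
  shows "nrm A (g \<ominus> c \<otimes> g) \<le> 1/2"
proof -
  define w where "w = g \<ominus> c \<otimes> g"
  have w: "w \<in> carrier A" "adj A w = w"
    using g c gc(2) by (simp_all add: w_def a_minus_def adj_add adj_minus adj_mult algebra_closed)
  have "g \<otimes> (w \<ominus> c \<otimes> w) = (g \<ominus> g \<otimes> c) \<otimes> w"
    using g(1) c(1) w(1) by (simp add: star_expand algebra_closed)
  then have "g \<otimes> (w \<ominus> c \<otimes> w) = adj A w \<otimes> w"
    unfolding w(2) by (simp add: w_def gc(2))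
  then have "2 * (nrm A w)\<^sup>2 \<le> nrm A w"
    using cosine_contractive(3)[OF g c gc w(1)] cstar_identity[OF w(1)] by simp
  then have "(2 * nrm A w) * nrm A w \<le> 1 * nrm A w" by (simp add: power2_eq_square)
  then have "nrm A w \<le> 1/2"
    using nrm_nonneg[OF w(1)] mult_right_le_imp_le[of "2 * nrm A w" "nrm A w" 1] by fastforce
  then show ?thesis by (simp add: w_def)
qed

lemma nrm_minus_triangle:
  "\<lbrakk>x \<in> carrier A; y \<in> carrier A; z \<in> carrier A\<rbrakk> \<Longrightarrow> nrm A (x \<ominus> z) \<le> nrm A (x \<ominus> y) + nrm A (y \<ominus> z)"
  unfolding minus_telescope[of x y z] by (rule nrm_triangle) simp_all

lemma minus_eq_zero_iff: "\<lbrakk>x \<in> carrier A; y \<in> carrier A\<rbrakk> \<Longrightarrow> x \<ominus> y = \<zero> \<longleftrightarrow> x = y"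
  using M.add.inv_solve_right[of \<zero> x y] by (auto simp: a_minus_def M.r_neg)

lemma eq_of_approx:
  assumes x: "x \<in> carrier A" and FG: "\<And>y. y \<in> carrier A \<Longrightarrow> F y \<in> carrier A \<and> G y \<in> carrier A"
    and lip: "\<And>y. y \<in> carrier A \<Longrightarrow> nrm A (F x \<ominus> F y) \<le> C * nrm A (x \<ominus> y) \<and>
                 nrm A (G y \<ominus> G x) \<le> C * nrm A (x \<ominus> y)"
    and lim: "\<And>e. e > 0 \<Longrightarrow> \<exists>y\<in>carrier A. nrm A (x \<ominus> y) < e \<and> F y = G y"
  shows "F x = G x"
proof -
  have "nrm A (F x \<ominus> G x) \<le> 0 + e" if e: "e > 0" for e
  proof -
    define D where "D = max C 0 + 1"
    have D: "D > 0" "C \<le> D" by (auto simp: D_def)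
    obtain y where y: "y \<in> carrier A" "nrm A (x \<ominus> y) < e / (2 * D)" "F y = G y"
      using lim[of "e / (2 * D)"] e D by auto
    have n: "0 \<le> nrm A (x \<ominus> y)" using x y by (simp add: nrm_nonneg)
    have "nrm A (F x \<ominus> G x) \<le> nrm A (F x \<ominus> F y) + nrm A (G y \<ominus> G x)"
      using nrm_minus_triangle[of "F x" "F y" "G x"] FG x y by simp
    also have "\<dots> \<le> 2 * (C * nrm A (x \<ominus> y))" using lip[OF y(1)] by simp
    also have "\<dots> \<le> 2 * (D * nrm A (x \<ominus> y))" using D n by (simp add: mult_right_mono)
    also have "\<dots> \<le> e" using y(2) D by (simp add: field_simps)
    finally show ?thesis by simp
  qed
  then have "nrm A (F x \<ominus> G x) \<le> 0" by (rule field_le_epsilon)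
  then have "F x \<ominus> G x = \<zero>" using nrm_nonneg[of "F x \<ominus> G x"] FG[OF x] by (simp flip: nrm_eq_0)
  then show ?thesis using minus_eq_zero_iff FG[OF x] by simp
qed

lemma mult_minus_distrib:
  assumes "x \<in> carrier A" "y \<in> carrier A" "z \<in> carrier A"
  shows "z \<otimes> (x \<ominus> y) = z \<otimes> x \<ominus> z \<otimes> y" "(x \<ominus> y) \<otimes> z = x \<otimes> z \<ominus> y \<otimes> z"
  using assms by (simp_all add: star_expand algebra_closed)

lemma norm_closed_self_adjoint_commuting:
  assumes I: "norm_closed I" and W: "W \<subseteq> carrier A"
  shows "norm_closed {c \<in> I. adj A c = c \<and> (\<forall>w\<in>W. w \<otimes> c = c \<otimes> w)}" (is "norm_closed ?S")
  unfolding norm_closed_def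
proof (intro conjI ballI impI)
  show "?S \<subseteq> carrier A" using I by (auto simp: norm_closed_def)
  fix x assume x: "x \<in> carrier A" and lim: "\<forall>e>0. \<exists>y\<in>?S. nrm A (x \<ominus> y) < e"
  have ex: "\<exists>y\<in>carrier A. nrm A (x \<ominus> y) < e \<and> y \<in> ?S" if "e > 0" for e
    using lim that I unfolding norm_closed_def by blast
  have "x \<in> I" using lim by (intro norm_closedD[OF I x]) blast
  moreover have "adj A x = x"
  proof (rule eq_of_approx[OF x])
    fix e :: real assume "e > 0"
    then show "\<exists>y\<in>carrier A. nrm A (x \<ominus> y) < e \<and> adj A y = y" using ex by blast
  next
    fix y assume y: "y \<in> carrier A"
    have "adj A x \<ominus> adj A y = adj A (x \<ominus> y)"
      using x y by (simp add: a_minus_def adj_add adj_minus algebra_closed)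
    then show "nrm A (adj A x \<ominus> adj A y) \<le> 1 * nrm A (x \<ominus> y) \<and> nrm A (y \<ominus> x) \<le> 1 * nrm A (x \<ominus> y)"
      using x y by (simp add: nrm_minus_commute)
  qed (simp add: adj_closed)
  moreover have "w \<otimes> x = x \<otimes> w" if w: "w \<in> W" for w
  proof (rule eq_of_approx[OF x])
    fix e :: real assume "e > 0"
    then show "\<exists>y\<in>carrier A. nrm A (x \<ominus> y) < e \<and> w \<otimes> y = y \<otimes> w" using ex w by blast
  next
    fix y assume y: "y \<in> carrier A"
    have wc: "w \<in> carrier A" using w W by auto
    show "nrm A (w \<otimes> x \<ominus> w \<otimes> y) \<le> nrm A w * nrm A (x \<ominus> y) \<and>
          nrm A (y \<otimes> w \<ominus> x \<otimes> w) \<le> nrm A w * nrm A (x \<ominus> y)"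
      using nrm_mult[of w "x \<ominus> y"] nrm_mult[of "y \<ominus> x" w] x y wc nrm_minus_commute[OF x y]
      by (simp add: mult_minus_distrib mult.commute)
  qed (use w W in \<open>auto simp: m_closed\<close>)
  ultimately show "x \<in> ?S" by simp
qed

section \<open>Closed ideals and their approximate units\<close>

lemma closed_ideals_iff:
  "I \<in> closed_ideals A \<longleftrightarrow> norm_closed I \<and> \<zero> \<in> I \<and> (\<forall>x\<in>I. \<forall>y\<in>I. x \<oplus> y \<in> I) \<and>
    (\<forall>c. \<forall>x\<in>I. c \<odot> x \<in> I) \<and> (\<forall>a\<in>carrier A. \<forall>x\<in>I. a \<otimes> x \<in> I \<and> x \<otimes> a \<in> I)" (is "_ \<longleftrightarrow> ?R")
proof
  assume I: "I \<in> closed_ideals A"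
  then have "submodule I complex_ring A" by (simp add: closed_ideals_def)
  then have "subgroup I (add_monoid A)" "\<And>c x. x \<in> I \<Longrightarrow> c \<odot> x \<in> I"
    by (simp_all add: submodule_def submodule_axioms_def complex_ring_def)
  then show ?R using I by (auto simp: closed_ideals_def closedin_iff norm_closed_def subgroup_def)
next
  assume R: ?R
  then have Ic: "I \<subseteq> carrier A" by (simp add: norm_closed_def)
  have "subgroup I (add_monoid A)"
  proof (rule group.subgroupI[OF M.a_group])
    fix x assume "x \<in> I"
    then have "\<ominus> x \<in> I" using R Ic minus_eq_scale[of x] by auto
    then show "inv\<^bsub>add_monoid A\<^esub> x \<in> I" by (simp add: a_inv_def)
  qed (use R Ic in auto)
  then have "submodule I complex_ring A"
    using R by (simp add: submodule_def submodule_axioms_def)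
  then show "I \<in> closed_ideals A"
    using R by (auto simp: closed_ideals_def closedin_iff norm_closed_def)
qed

lemma closed_idealD:
  assumes "I \<in> closed_ideals A"
  shows "norm_closed I" "I \<subseteq> carrier A" "\<zero> \<in> I"
    and "\<And>x y. \<lbrakk>x \<in> I; y \<in> I\<rbrakk> \<Longrightarrow> x \<oplus> y \<in> I" "\<And>c x. x \<in> I \<Longrightarrow> c \<odot> x \<in> I"
    and "\<And>a x. \<lbrakk>a \<in> carrier A; x \<in> I\<rbrakk> \<Longrightarrow> a \<otimes> x \<in> I" "\<And>a x. \<lbrakk>a \<in> carrier A; x \<in> I\<rbrakk> \<Longrightarrow> x \<otimes> a \<in> I"
    and "\<And>x. x \<in> I \<Longrightarrow> \<ominus> x \<in> I" "\<And>x y. \<lbrakk>x \<in> I; y \<in> I\<rbrakk> \<Longrightarrow> x \<ominus> y \<in> I"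
proof -
  show I: "norm_closed I" "I \<subseteq> carrier A" "\<zero> \<in> I"
    "\<And>x y. \<lbrakk>x \<in> I; y \<in> I\<rbrakk> \<Longrightarrow> x \<oplus> y \<in> I" "\<And>c x. x \<in> I \<Longrightarrow> c \<odot> x \<in> I"
    "\<And>a x. \<lbrakk>a \<in> carrier A; x \<in> I\<rbrakk> \<Longrightarrow> a \<otimes> x \<in> I" "\<And>a x. \<lbrakk>a \<in> carrier A; x \<in> I\<rbrakk> \<Longrightarrow> x \<otimes> a \<in> I"
    using assms by (auto simp: closed_ideals_iff norm_closed_def)
  show m: "\<ominus> x \<in> I" if "x \<in> I" for x
    using I(2) I(5)[OF that] minus_eq_scale[of x] that by auto
  show "x \<ominus> y \<in> I" if "x \<in> I" "y \<in> I" for x y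
    using I(4) m that by (simp add: a_minus_def)
qed

lemma minus_zero [simp]: "x \<in> carrier A \<Longrightarrow> x \<ominus> \<zero> = x"
  using M.add.inv_one by (simp add: a_minus_def a_inv_def)

lemma zero_closed_ideal: "{\<zero>} \<in> closed_ideals A"
proof -
  have "x = \<zero>" if x: "x \<in> carrier A" and lim: "\<forall>e>0. nrm A x < e" for x
  proof -
    have "nrm A x \<le> 0" by (rule dense_ge) (use lim in auto)
    then show ?thesis using nrm_eq_0[OF x] nrm_nonneg[OF x] by simp
  qed
  then have "norm_closed {\<zero>}" by (auto simp: norm_closed_def)
  then show ?thesis by (auto simp: closed_ideals_iff)
qed

text \<open>
  Rescaling \<open>h\<close> to \<open>g\<close> of norm \<open>2/3\<close>, multiplication by \<open>1 - c\<close> brings the norm of \<open>g\<close> down to \<open>1/2\<close>, which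
  is the factor \<open>3/4\<close>. Any norm between \<open>1/2\<close> and \<open>1\<close> would do. That \<open>c\<close> commutes with everything that
  commutes with \<open>h\<close> allows the step to be iterated.
\<close>

lemma ideal_decrease:
  assumes I: "I \<in> closed_ideals A" and h: "h \<in> I" "adj A h = h"
  obtains c where "c \<in> I" "adj A c = c"
    and "\<And>w. \<lbrakk>w \<in> carrier A; w \<otimes> h = h \<otimes> w\<rbrakk> \<Longrightarrow> w \<otimes> c = c \<otimes> w"
    and "\<And>z. z \<in> carrier A \<Longrightarrow> nrm A (z \<ominus> c \<otimes> z) \<le> nrm A z"
    and "nrm A (h \<ominus> c \<otimes> h) \<le> 3/4 * nrm A h"
proof (cases "nrm A h = 0")
  case True
  note ID = closed_idealD[OF I]
  have "h = \<zero>" using True h ID(2) nrm_eq_0 by auto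
  then show thesis
    using ID(3) by (intro that[of \<zero>]) auto
next
  case False
  note ID = closed_idealD[OF I]
  have hc: "h \<in> carrier A" using h ID(2) by auto
  have pos: "nrm A h > 0" using False nrm_nonneg[OF hc] by simp
  define s where "s = complex_of_real (2 / (3 * nrm A h))"
  define g where "g = s \<odot> h"
  have g: "g \<in> carrier A" "adj A g = g" "g \<in> I"
    using hc h ID(5) by (simp_all add: g_def s_def adj_smult)
  have ng: "nrm A g = 2/3" using pos hc by (simp add: g_def s_def nrm_smult norm_divide norm_mult)
  define W where "W = {w \<in> carrier A. w \<otimes> h = h \<otimes> w}"
  have Wg: "w \<otimes> g = g \<otimes> w" if "w \<in> W" for w
    using that hc by (simp add: W_def g_def smult_m_left smult_m_right)
  define S where "S = {c \<in> I. adj A c = c \<and> (\<forall>w\<in>W. w \<otimes> c = c \<otimes> w)}"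
  have Sc: "S \<subseteq> carrier A" using ID(2) by (auto simp: S_def)
  obtain c where c: "c \<in> S" "c \<oplus> c = g \<otimes> g \<oplus> c \<otimes> c"
  proof (rule exists_sqrt_complement[of "g \<otimes> g" S])
    show "g \<otimes> g \<in> carrier A" using g by (simp add: m_closed)
    have "nrm A (g \<otimes> g) \<le> (2/3) * (2/3)" using nrm_mult[of g g] g ng by simp
    then show "nrm A (g \<otimes> g) < 1" by simp
    show "norm_closed S" unfolding S_def
      using ID(1) by (rule norm_closed_self_adjoint_commuting) (auto simp: W_def)
    show "\<zero> \<in> S" using ID(3) by (auto simp: S_def W_def)
    fix c assume "c \<in> S"
    then have c: "c \<in> I" "c \<in> carrier A" "adj A c = c" "\<And>w. w \<in> W \<Longrightarrow> w \<otimes> c = c \<otimes> w"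
      using Sc by (auto simp: S_def)
    have "w \<otimes> (g \<otimes> g) = (g \<otimes> g) \<otimes> w" "w \<otimes> (c \<otimes> c) = (c \<otimes> c) \<otimes> w" if w: "w \<in> W" for w
    proof -
      have wc: "w \<in> carrier A" using w by (simp add: W_def)
      show "w \<otimes> (g \<otimes> g) = (g \<otimes> g) \<otimes> w" using Wg[OF w] wc g(1) by (metis m_assoc)
      show "w \<otimes> (c \<otimes> c) = (c \<otimes> c) \<otimes> w" using c(4)[OF w] wc c(2) by (metis m_assoc)
    qed
    then have "w \<otimes> ((1/2) \<odot> (g \<otimes> g \<oplus> c \<otimes> c)) = ((1/2) \<odot> (g \<otimes> g \<oplus> c \<otimes> c)) \<otimes> w" if "w \<in> W" for w
      using that g(1) c(2) by (simp add: W_def smult_m_left smult_m_right l_distr r_distr m_closed)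
    moreover have "adj A ((1/2) \<odot> (g \<otimes> g \<oplus> c \<otimes> c)) = (1/2) \<odot> (g \<otimes> g \<oplus> c \<otimes> c)"
      using g c by (simp add: adj_smult adj_add adj_mult m_closed)
    moreover have "(1/2) \<odot> (g \<otimes> g \<oplus> c \<otimes> c) \<in> I" using g c ID by auto
    ultimately show "(1/2) \<odot> (g \<otimes> g \<oplus> c \<otimes> c) \<in> S" by (simp add: S_def)
  qed
  have cI: "c \<in> I" "c \<in> carrier A" "adj A c = c" "\<And>w. w \<in> W \<Longrightarrow> w \<otimes> c = c \<otimes> w"
    using c Sc by (auto simp: S_def)
  have "g \<in> W" using g hc by (simp add: W_def) (simp add: g_def smult_m_left smult_m_right)
  then have cg: "c \<otimes> g = g \<otimes> c" using cI(4) by simp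
  have "nrm A (g \<ominus> c \<otimes> g) \<le> 1/2" by (rule half_sine_bound[OF g(1,2) cI(2,3) c(2) cg])
  moreover have "g \<ominus> c \<otimes> g = s \<odot> (h \<ominus> c \<otimes> h)"
    using hc cI(2) by (simp add: g_def star_expand algebra_closed)
  ultimately have "(2 / (3 * nrm A h)) * nrm A (h \<ominus> c \<otimes> h) \<le> 1/2"
    using hc cI(2) pos by (simp add: nrm_smult algebra_closed s_def norm_divide norm_mult)
  then have "nrm A (h \<ominus> c \<otimes> h) \<le> 3/4 * nrm A h" using pos by (simp add: field_simps)
  moreover have "nrm A (z \<ominus> c \<otimes> z) \<le> nrm A z" if "z \<in> carrier A" for z
    by (rule cosine_contractive(1)[OF g(1,2) cI(2,3) c(2) cg that])
  ultimately show thesis using cI by (intro that[of c]) (auto simp: W_def)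
qed

text \<open>
  The elements \<open>e\<close> that can serve in approximate units: \<open>1 - e\<close> is a contraction. The bound is on
  \<open>1 - e\<close> and not on \<open>e\<close>, since it is \<open>1 - e\<close> that arises as a product of contractions.
\<close>
definition approx_unit :: "'a set \<Rightarrow> 'a set" where
  "approx_unit I = {e \<in> I. adj A e = e \<and> (\<forall>z\<in>carrier A. nrm A (z \<ominus> e \<otimes> z) \<le> nrm A z)}"

lemma approx_unitD:
  assumes "e \<in> approx_unit I" "z \<in> carrier A" "I \<subseteq> carrier A"
  shows "e \<in> I" "e \<in> carrier A" "adj A e = e" "nrm A (z \<ominus> e \<otimes> z) \<le> nrm A z" "nrm A (z \<ominus> z \<otimes> e) \<le> nrm A z"
proof -
  show e: "e \<in> I" "e \<in> carrier A" "adj A e = e" "nrm A (z \<ominus> e \<otimes> z) \<le> nrm A z"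
    using assms by (auto simp: approx_unit_def)
  have "z \<ominus> z \<otimes> e = adj A (adj A z \<ominus> e \<otimes> adj A z)"
    using assms(2) e by (simp add: star_expand algebra_closed)
  moreover have "nrm A (adj A z \<ominus> e \<otimes> adj A z) \<le> nrm A (adj A z)"
    using assms(1) adj_closed[OF assms(2)] unfolding approx_unit_def by blast
  ultimately show "nrm A (z \<ominus> z \<otimes> e) \<le> nrm A z"
    using assms(2) e by (simp add: algebra_closed)
qed

text \<open>
  The step above is applied to \<open>h\<close>, \<open>h(1 - c\<^sub>1)\<close>, and so on; \<open>1 - e\<close> is the product of the factors \<open>1 - c\<^sub>i\<close>.
\<close>

lemma approx_unit_self_adjoint:
  assumes I: "I \<in> closed_ideals A" and h: "h \<in> I" "adj A h = h" and "\<epsilon> > 0"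
  obtains e where "e \<in> approx_unit I" "nrm A (h \<ominus> e \<otimes> h) \<le> \<epsilon>"
proof -
  note ID = closed_idealD[OF I]
  have hc: "h \<in> carrier A" using h ID(2) by auto
  have "\<exists>e\<in>approx_unit I. e \<otimes> h = h \<otimes> e \<and> nrm A (h \<ominus> e \<otimes> h) \<le> (3/4)^n * nrm A h" for n
  proof (induction n)
    case 0
    have "\<zero> \<in> approx_unit I" using ID by (auto simp: approx_unit_def)
    then show ?case using hc by (intro bexI[of _ \<zero>]) auto
  next
    case (Suc n)
    then obtain e where e: "e \<in> approx_unit I" "e \<otimes> h = h \<otimes> e" "nrm A (h \<ominus> e \<otimes> h) \<le> (3/4)^n * nrm A h"
      by blast
    note eD = approx_unitD[OF e(1) _ ID(2)]
    define k where "k = h \<ominus> e \<otimes> h"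
    have ec: "e \<in> carrier A" "adj A e = e" "e \<in> I" using eD hc by auto
    have k: "k \<in> I" "k \<in> carrier A" "adj A k = k"
      using ID ec h hc e(2) by (simp_all add: k_def a_minus_def adj_add adj_minus adj_mult algebra_closed)
    have ehe: "e \<otimes> (e \<otimes> h) = e \<otimes> h \<otimes> e" "h \<otimes> (e \<otimes> h) = e \<otimes> h \<otimes> h"
      using e(2) ec hc by (metis m_assoc)+
    have hk: "h \<otimes> k = k \<otimes> h" and ek: "e \<otimes> k = k \<otimes> e"
      using ec hc e(2) ehe by (simp_all add: k_def mult_minus_distrib m_closed)
    obtain c where c: "c \<in> I" "adj A c = c" "\<And>w. \<lbrakk>w \<in> carrier A; w \<otimes> k = k \<otimes> w\<rbrakk> \<Longrightarrow> w \<otimes> c = c \<otimes> w"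
      "\<And>z. z \<in> carrier A \<Longrightarrow> nrm A (z \<ominus> c \<otimes> z) \<le> nrm A z" "nrm A (k \<ominus> c \<otimes> k) \<le> 3/4 * nrm A k"
      using ideal_decrease[OF I k(1,3)] by metis
    have cc: "c \<in> carrier A" using c ID(2) by auto
    have com: "h \<otimes> c = c \<otimes> h" "e \<otimes> c = c \<otimes> e" using c(3) hk ek hc ec by auto
    \<comment> \<open>\<open>1 - f = (1 - c)(1 - e)\<close>\<close>
    define f where "f = (e \<oplus> c) \<ominus> c \<otimes> e"
    have f: "f \<in> I" "f \<in> carrier A" "adj A f = f"
      using ID ec c cc com by (simp_all add: f_def a_minus_def adj_add adj_minus adj_mult algebra_closed)
    have fz: "z \<ominus> f \<otimes> z = (z \<ominus> e \<otimes> z) \<ominus> c \<otimes> (z \<ominus> e \<otimes> z)" if "z \<in> carrier A" for z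
      using that ec cc by (simp add: f_def star_expand algebra_closed M.a_ac)
    have "nrm A (z \<ominus> f \<otimes> z) \<le> nrm A z" if "z \<in> carrier A" for z
      using c(4)[of "z \<ominus> e \<otimes> z"] eD(4)[OF that] that ec by (simp add: fz m_closed)
    then have "f \<in> approx_unit I" using f by (simp add: approx_unit_def)
    moreover have "f \<otimes> h = h \<otimes> f"
    proof -
      have "h \<otimes> (c \<otimes> e) = c \<otimes> e \<otimes> h" using com e(2) cc ec hc by (metis m_assoc)
      then show ?thesis using com e(2) cc ec hc by (simp add: f_def a_minus_def l_distr r_distr
        mult_minus_left mult_minus_right m_closed)
    qed
    moreover have "nrm A (h \<ominus> f \<otimes> h) \<le> (3/4)^Suc n * nrm A h"
      using c(5) e(3) hc by (simp add: fz k_def)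
    ultimately show ?case by blast
  qed
  moreover have "\<exists>n. (3/4)^n * nrm A h < \<epsilon>"
  proof (cases "nrm A h = 0")
    case False
    then have "nrm A h > 0" using nrm_nonneg[OF hc] by simp
    moreover obtain n where "(3/4::real)^n < \<epsilon> / nrm A h"
      using real_arch_pow_inv[of "\<epsilon> / nrm A h" "3/4"] \<open>\<epsilon> > 0\<close> \<open>nrm A h > 0\<close> by auto
    ultimately show ?thesis by (intro exI[of _ n]) (simp add: field_simps)
  qed (use \<open>\<epsilon> > 0\<close> in simp)
  ultimately show thesis using that by (meson less_imp_le order_trans)
qed

text \<open>
  With \<open>h = x\<^sup>*x\<close>, \<open>\<parallel>x(1 - e)\<parallel>\<^sup>2 = \<parallel>(1 - e)h(1 - e)\<parallel> \<le> \<parallel>h(1 - e)\<parallel>\<close>. Only \<open>x\<^sup>*x\<close> has to lie in the ideal; it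
  follows that \<open>x\<close> does, and with it that closed ideals are self-adjoint.
\<close>

lemma approx_unit_right:
  assumes I: "I \<in> closed_ideals A" and x: "x \<in> carrier A" "adj A x \<otimes> x \<in> I" and "\<epsilon> > 0"
  obtains e where "e \<in> approx_unit I" "nrm A (x \<ominus> x \<otimes> e) \<le> \<epsilon>"
proof -
  note ID = closed_idealD[OF I]
  define h where "h = adj A x \<otimes> x"
  have h: "h \<in> I" "h \<in> carrier A" "adj A h = h" using x by (simp_all add: h_def star_expand algebra_closed)
  obtain e where e: "e \<in> approx_unit I" "nrm A (h \<ominus> e \<otimes> h) \<le> \<epsilon>\<^sup>2"
    using approx_unit_self_adjoint[OF I h(1,3), of "\<epsilon>\<^sup>2"] \<open>\<epsilon> > 0\<close> by auto
  note eD = approx_unitD[OF e(1) _ ID(2)]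
  have ec: "e \<in> carrier A" "adj A e = e" using eD x by auto
  have "adj A (x \<ominus> x \<otimes> e) \<otimes> (x \<ominus> x \<otimes> e) = (h \<ominus> h \<otimes> e) \<ominus> e \<otimes> (h \<ominus> h \<otimes> e)"
    using x ec by (simp add: h_def star_expand algebra_closed M.a_ac)
  then have "nrm A (adj A (x \<ominus> x \<otimes> e) \<otimes> (x \<ominus> x \<otimes> e)) \<le> nrm A (h \<ominus> h \<otimes> e)"
    using eD(4)[of "h \<ominus> h \<otimes> e"] ec h by (simp add: m_closed)
  also have "h \<ominus> h \<otimes> e = adj A (h \<ominus> e \<otimes> h)" using ec h by (simp add: star_expand algebra_closed)
  also have "nrm A \<dots> \<le> \<epsilon>\<^sup>2" using e(2) ec h by (simp add: algebra_closed)
  finally have "nrm A (adj A (x \<ominus> x \<otimes> e) \<otimes> (x \<ominus> x \<otimes> e)) \<le> \<epsilon>\<^sup>2" .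
  then have "nrm A (x \<ominus> x \<otimes> e) \<le> \<epsilon>"
    using nrm_le_of_square_le[of "x \<ominus> x \<otimes> e" \<epsilon>] \<open>\<epsilon> > 0\<close> x ec by (simp add: m_closed)
  then show thesis using that e(1) by blast
qed

lemma mem_ideal_of_square_mem:
  assumes I: "I \<in> closed_ideals A" and x: "x \<in> carrier A" "adj A x \<otimes> x \<in> I"
  shows "x \<in> I"
proof (rule norm_closedD[OF closed_idealD(1)[OF I] x(1)])
  fix e :: real assume "e > 0"
  then obtain u where "u \<in> approx_unit I" "nrm A (x \<ominus> x \<otimes> u) \<le> e/2"
    using approx_unit_right[OF I x, of "e/2"] by auto
  then show "\<exists>y\<in>I. nrm A (x \<ominus> y) < e"
    using closed_idealD(6)[OF I x(1), of u] \<open>e > 0\<close>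
    by (intro bexI[of _ "x \<otimes> u"]) (auto simp: approx_unit_def)
qed

lemma adj_mem_ideal:
  assumes I: "I \<in> closed_ideals A" and x: "x \<in> I"
  shows "adj A x \<in> I"
proof -
  have "x \<in> carrier A" using x closed_idealD(2)[OF I] by auto
  then show ?thesis
    using mem_ideal_of_square_mem[OF I, of "adj A x"] closed_idealD(7)[OF I _ x]
    by (simp add: adj_adj adj_closed)
qed

lemma approx_unit_ideal:
  assumes I: "I \<in> closed_ideals A" and x: "x \<in> I" and "\<epsilon> > 0"
  shows "\<exists>e\<in>approx_unit I. nrm A (x \<ominus> x \<otimes> e) \<le> \<epsilon>" "\<exists>e\<in>approx_unit I. nrm A (x \<ominus> e \<otimes> x) \<le> \<epsilon>"
proof -
  note ID = closed_idealD[OF I]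
  have *: "\<exists>e\<in>approx_unit I. nrm A (x \<ominus> x \<otimes> e) \<le> \<epsilon>" if "x \<in> I" for x
    using approx_unit_right[OF I _ _ \<open>\<epsilon> > 0\<close>, of x] that ID by (metis adj_closed subsetD)
  from *[OF x] show "\<exists>e\<in>approx_unit I. nrm A (x \<ominus> x \<otimes> e) \<le> \<epsilon>" .
  obtain e where e: "e \<in> approx_unit I" "nrm A (adj A x \<ominus> adj A x \<otimes> e) \<le> \<epsilon>"
    using *[OF adj_mem_ideal[OF I x]] by blast
  have c: "e \<in> carrier A" "adj A e = e" "x \<in> carrier A" using e ID x by (auto simp: approx_unit_def)
  then have "x \<ominus> e \<otimes> x = adj A (adj A x \<ominus> adj A x \<otimes> e)" by (simp add: star_expand algebra_closed)
  then show "\<exists>e\<in>approx_unit I. nrm A (x \<ominus> e \<otimes> x) \<le> \<epsilon>"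
    using e c by (intro bexI[of _ e]) (auto simp: algebra_closed)
qed

end

section \<open>Completeness and closed ideals as algebras\<close>

text \<open>
  Subtraction written with addition and scaling. Unlike \<open>a_minus\<close>, which involves an inverse in the
  carrier, it is literally the same operation in a subalgebra.
\<close>
definition diff :: "'a cstar \<Rightarrow> 'a \<Rightarrow> 'a \<Rightarrow> 'a" where
  "diff X x y = x \<oplus>\<^bsub>X\<^esub> ((-1) \<odot>\<^bsub>X\<^esub> y)"

lemma module_minus_eq_diff:
  assumes "module complex_ring X" "x \<in> carrier X" "y \<in> carrier X"
  shows "x \<ominus>\<^bsub>X\<^esub> y = diff X x y"
proof -
  interpret module complex_ring X by fact
  have one: "1 \<odot>\<^bsub>X\<^esub> y = y" and null: "0 \<odot>\<^bsub>X\<^esub> y = \<zero>\<^bsub>X\<^esub>" and clo: "(-1) \<odot>\<^bsub>X\<^esub> y \<in> carrier X"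
    using smult_one[of y] smult_l_null[of y] smult_closed[of "-1" y] assms by (simp_all add: complex_ring_def)
  have "(-1) \<odot>\<^bsub>X\<^esub> y \<oplus>\<^bsub>X\<^esub> y = \<zero>\<^bsub>X\<^esub>"
    using smult_l_distr[of "-1" 1 y] assms one null by (simp add: complex_ring_def)
  then have "\<ominus>\<^bsub>X\<^esub> y = (-1) \<odot>\<^bsub>X\<^esub> y" using M.minus_equality clo assms by simp
  then show ?thesis by (simp add: a_minus_def diff_def)
qed

lemma mcomplete_cdistI:
  fixes X :: "'a cstar"
  assumes X: "module complex_ring X"
    and nonneg: "\<And>x. x \<in> carrier X \<Longrightarrow> 0 \<le> nrm X x"
    and eq0: "\<And>x. x \<in> carrier X \<Longrightarrow> nrm X x = 0 \<longleftrightarrow> x = \<zero>\<^bsub>X\<^esub>"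
    and tri: "\<And>x y. x \<in> carrier X \<Longrightarrow> y \<in> carrier X \<Longrightarrow> nrm X (x \<oplus>\<^bsub>X\<^esub> y) \<le> nrm X x + nrm X y"
    and hom: "\<And>c x. x \<in> carrier X \<Longrightarrow> nrm X (c \<odot>\<^bsub>X\<^esub> x) = cmod c * nrm X x"
    and lim: "\<And>\<sigma> :: nat \<Rightarrow> 'a. (\<And>n. \<sigma> n \<in> carrier X) \<Longrightarrow>
        (\<And>\<epsilon>. \<epsilon> > 0 \<Longrightarrow> \<exists>N. \<forall>m\<ge>N. \<forall>n\<ge>N. nrm X (diff X (\<sigma> m) (\<sigma> n)) < \<epsilon>) \<Longrightarrow>
        \<exists>x\<in>carrier X. \<forall>\<epsilon>>0. \<exists>N. \<forall>n\<ge>N. nrm X (diff X (\<sigma> n) x) < \<epsilon>"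
  shows "Metric_space.mcomplete (carrier X) (cdist X)"
proof -
  interpret module complex_ring X by fact
  have sc: "c \<odot>\<^bsub>X\<^esub> x \<in> carrier X" if "x \<in> carrier X" for c x
    using smult_closed[of c x] that by (simp add: complex_ring_def)
  have dc: "diff X x y \<in> carrier X" if "x \<in> carrier X" "y \<in> carrier X" for x y
    using that sc by (simp add: diff_def)
  have cd: "cdist X x y = (if x \<in> carrier X \<and> y \<in> carrier X then nrm X (diff X x y) else 0)" for x y
    using module_minus_eq_diff[OF X] by (simp add: cdist_def)
  have MS: "Metric_space (carrier X) (cdist X)"
  proof
    fix x y z
    show "0 \<le> cdist X x y" using nonneg dc by (simp add: cd)
    show "cdist X x y = cdist X y x"
    proof (cases "x \<in> carrier X \<and> y \<in> carrier X")
      case True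
      then have "diff X y x = \<ominus>\<^bsub>X\<^esub> (diff X x y)"
        using module_minus_eq_diff[OF X] M.a_comm[of "\<ominus>\<^bsub>X\<^esub> x" y]
        by (simp add: M.minus_add a_minus_def flip: module_minus_eq_diff[OF X])
      moreover have "\<ominus>\<^bsub>X\<^esub> w = (-1) \<odot>\<^bsub>X\<^esub> w" if "w \<in> carrier X" for w
        using module_minus_eq_diff[OF X M.zero_closed that] that sc by (simp add: diff_def a_minus_def)
      ultimately have "nrm X (diff X y x) = nrm X (diff X x y)"
        using True dc hom by simp
      then show ?thesis using True by (simp add: cd)
    qed (auto simp: cd)
    assume x: "x \<in> carrier X" and y: "y \<in> carrier X"
    show "cdist X x y = 0 \<longleftrightarrow> x = y"
      using x y M.add.inv_solve_right[of "\<zero>\<^bsub>X\<^esub>" x y] by (auto simp: cdist_def eq0 a_minus_def)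
    assume z: "z \<in> carrier X"
    have "x \<ominus>\<^bsub>X\<^esub> z = (x \<ominus>\<^bsub>X\<^esub> y) \<oplus>\<^bsub>X\<^esub> (y \<ominus>\<^bsub>X\<^esub> z)"
      using x y z by (simp add: a_minus_def M.a_assoc M.r_neg1)
    then show "cdist X x z \<le> cdist X x y + cdist X y z"
      using x y z tri[of "x \<ominus>\<^bsub>X\<^esub> y" "y \<ominus>\<^bsub>X\<^esub> z"] by (simp add: cdist_def)
  qed
  interpret MS: Metric_space "carrier X" "cdist X" by (rule MS)
  show ?thesis
    unfolding MS.mcomplete_def
  proof (intro allI impI)
    fix \<sigma> assume "MS.MCauchy \<sigma>"
    then have \<sigma>: "\<And>n. \<sigma> n \<in> carrier X"
      and C: "\<And>\<epsilon>. \<epsilon> > 0 \<Longrightarrow> \<exists>N. \<forall>n n'. N \<le> n \<longrightarrow> N \<le> n' \<longrightarrow> cdist X (\<sigma> n) (\<sigma> n') < \<epsilon>"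
      by (auto simp: MS.MCauchy_def)
    have "\<exists>N. \<forall>m\<ge>N. \<forall>n\<ge>N. nrm X (diff X (\<sigma> m) (\<sigma> n)) < \<epsilon>" if "\<epsilon> > 0" for \<epsilon>
      using C[OF that] \<sigma> by (simp add: cd)
    then have "\<exists>x\<in>carrier X. \<forall>\<epsilon>>0. \<exists>N. \<forall>n\<ge>N. nrm X (diff X (\<sigma> n) x) < \<epsilon>"
      using lim \<sigma> by blast
    then show "\<exists>x. limitin MS.mtopology \<sigma> x sequentially"
      using \<sigma> by (auto simp: MS.limit_metric_sequentially cd)
  qed
qed

lemma (in cstar_algebra) minus_eq_diff: "\<lbrakk>x \<in> carrier A; y \<in> carrier A\<rbrakk> \<Longrightarrow> x \<ominus> y = diff A x y"
  by (simp add: a_minus_def diff_def minus_eq_scale)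

lemma (in cstar_algebra) Cauchy_limit:
  fixes \<sigma> :: "nat \<Rightarrow> 'a"
  assumes \<sigma>: "\<And>n. \<sigma> n \<in> carrier A"
    and C: "\<And>\<epsilon>. \<epsilon> > 0 \<Longrightarrow> \<exists>N. \<forall>m\<ge>N. \<forall>n\<ge>N. nrm A (\<sigma> m \<ominus> \<sigma> n) < \<epsilon>"
  obtains x where "x \<in> carrier A" "\<And>\<epsilon>. \<epsilon> > 0 \<Longrightarrow> \<exists>N. \<forall>n\<ge>N. nrm A (\<sigma> n \<ominus> x) < \<epsilon>"
proof -
  interpret MS: Metric_space "carrier A" "cdist A" by (rule Metric_space)
  have "MS.MCauchy \<sigma>"
    using \<sigma> C unfolding MS.MCauchy_def cdist_def by (auto; meson)
  then obtain x where "limitin MS.mtopology \<sigma> x sequentially"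
    using complete by (auto simp: MS.mcomplete_def)
  then show thesis
    using \<sigma> that by (auto simp: MS.limit_metric_sequentially cdist_def)
qed

lemma subalgebra_simps [simp]:
  "carrier (subalgebra_on A J) = J" "add (subalgebra_on A J) = add A" "monoid.mult (subalgebra_on A J) = monoid.mult A"
  "ring.zero (subalgebra_on A J) = ring.zero A" "smult (subalgebra_on A J) = smult A"
  "adj (subalgebra_on A J) = adj A" "nrm (subalgebra_on A J) = nrm A" "diff (subalgebra_on A J) = diff A"
  "subalgebra_on (subalgebra_on A J) K = subalgebra_on A K"
  by (simp_all add: subalgebra_on_def diff_def fun_eq_iff)

lemma (in cstar_algebra) cstar_algebra_ideal:
  assumes J: "J \<in> closed_ideals A"
  shows "cstar_algebra (subalgebra_on A J)"
proof -
  note JD = closed_idealD[OF J]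
  have Jc: "x \<in> carrier A" if "x \<in> J" for x using that JD(2) by auto
  have "submodule J complex_ring A" using J by (simp add: closed_ideals_def)
  then have mod: "module complex_ring (subalgebra_on A J)"
    unfolding subalgebra_on_def using module_axioms by (rule submodule.submodule_is_module)
  show ?thesis
  proof (intro cstar_algebra.intro[OF mod] cstar_algebra_axioms.intro)
    show "Metric_space.mcomplete (carrier (subalgebra_on A J)) (cdist (subalgebra_on A J))"
    proof (rule mcomplete_cdistI[OF mod])
      fix \<sigma> :: "nat \<Rightarrow> 'a" assume \<sigma>: "\<And>n. \<sigma> n \<in> carrier (subalgebra_on A J)"
        and C: "\<And>\<epsilon>. \<epsilon> > 0 \<Longrightarrow> \<exists>N. \<forall>m\<ge>N. \<forall>n\<ge>N.
            nrm (subalgebra_on A J) (diff (subalgebra_on A J) (\<sigma> m) (\<sigma> n)) < \<epsilon>"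
      have \<sigma>c: "\<And>n. \<sigma> n \<in> carrier A" "\<And>n. \<sigma> n \<in> J" using \<sigma> Jc by auto
      obtain x where x: "x \<in> carrier A" "\<And>\<epsilon>. \<epsilon> > 0 \<Longrightarrow> \<exists>N. \<forall>n\<ge>N. nrm A (\<sigma> n \<ominus> x) < \<epsilon>"
      proof (rule Cauchy_limit[of \<sigma>])
        show "\<exists>N. \<forall>m\<ge>N. \<forall>n\<ge>N. nrm A (\<sigma> m \<ominus> \<sigma> n) < \<epsilon>" if "\<epsilon> > 0" for \<epsilon>
          using C[OF that] \<sigma>c(1) by (simp add: minus_eq_diff)
      qed (use \<sigma>c in auto)
      have "x \<in> J"
      proof (rule norm_closedD[OF JD(1) x(1)])
        fix e :: real assume "e > 0"
        then obtain N where "nrm A (\<sigma> N \<ominus> x) < e" using x(2) by blast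
        then show "\<exists>y\<in>J. nrm A (x \<ominus> y) < e"
          using \<sigma>c x(1) nrm_minus_commute by (intro bexI[of _ "\<sigma> N"]) auto
      qed
      then show "\<exists>x\<in>carrier (subalgebra_on A J). \<forall>\<epsilon>>0. \<exists>N. \<forall>n\<ge>N.
          nrm (subalgebra_on A J) (diff (subalgebra_on A J) (\<sigma> n) x) < \<epsilon>"
        using x \<sigma>c(1) by (auto simp: minus_eq_diff)
    qed (use Jc nrm_nonneg nrm_eq_0 nrm_triangle nrm_smult in auto)
  qed (use Jc JD adj_mem_ideal[OF J] in \<open>auto simp: m_assoc l_distr r_distr smult_m_left smult_m_right
       adj_adj adj_add adj_smult adj_mult nrm_nonneg nrm_eq_0 nrm_triangle nrm_smult nrm_mult cstar_identity\<close>)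
qed

text \<open>
  An element \<open>k \<in> K\<close> is a limit of elements \<open>ek\<close> with \<open>e \<in> K\<close>, and \<open>a(ek) = (ae)k\<close> with \<open>ae \<in> J\<close> for every
  \<open>a\<close> of the whole algebra. Multiplication from the right follows by taking adjoints.
\<close>

lemma (in cstar_algebra) closed_ideals_ideal:
  assumes J: "J \<in> closed_ideals A"
  shows "closed_ideals (subalgebra_on A J) = {K \<in> closed_ideals A. K \<subseteq> J}"
proof -
  note JD = closed_idealD[OF J]
  interpret J: cstar_algebra "subalgebra_on A J" by (rule cstar_algebra_ideal[OF J])
  have minus: "x \<ominus>\<^bsub>subalgebra_on A J\<^esub> y = x \<ominus> y" if "x \<in> J" "y \<in> J" for x y
    using that JD(2) minus_eq_diff[of x y] J.minus_eq_diff[of x y] by (simp add: subset_iff)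
  have closed: "J.norm_closed K \<longleftrightarrow> norm_closed K" if K: "K \<subseteq> J" for K
  proof
    assume "norm_closed K"
    then show "J.norm_closed K"
      using K minus JD(2) unfolding norm_closed_def J.norm_closed_def
      by (simp add: subset_iff)
  next
    assume n: "J.norm_closed K"
    have "x \<in> K" if x: "x \<in> carrier A" and lim: "\<forall>e>0. \<exists>y\<in>K. nrm A (x \<ominus> y) < e" for x
    proof -
      have "x \<in> J" using lim K by (intro norm_closedD[OF JD(1) x]) blast
      then show ?thesis
        using lim K minus by (intro J.norm_closedD[OF n]) (auto simp: subset_iff)
    qed
    then show "norm_closed K" using K JD(2) by (auto simp: norm_closed_def)
  qed
  have "K \<in> closed_ideals A" if K: "K \<in> closed_ideals (subalgebra_on A J)" for K
  proof -
    note KD = J.closed_idealD[OF K, simplified]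
    have nK: "norm_closed K" using KD(1,2) closed by simp
    have left: "a \<otimes> k \<in> K" if a: "a \<in> carrier A" and k: "k \<in> K" for a k
    proof -
      have kJ: "k \<in> J" "k \<in> carrier A" using k KD(2) JD(2) by auto
      define C where "C = nrm A a + 1"
      have C: "C > 0" "nrm A a \<le> C" using nrm_nonneg[OF a] by (auto simp: C_def)
      have small: "nrm A a * d < e" if "d \<le> e / (2 * C)" "0 \<le> d" "e > 0" for d e
      proof -
        have "nrm A a * d \<le> C * d" using C that by (simp add: mult_right_mono)
        also have "\<dots> \<le> C * (e / (2 * C))" using C that by (intro mult_left_mono) auto
        also have "\<dots> < e" using C that by simp
        finally show ?thesis .
      qed
      show "a \<otimes> k \<in> K"
      proof (rule norm_closedD[OF nK])
        fix e :: real assume e: "e > 0"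
        obtain u where u: "u \<in> J.approx_unit K" and n: "nrm A (k \<ominus>\<^bsub>subalgebra_on A J\<^esub> u \<otimes> k) \<le> e / (2 * C)"
          using J.approx_unit_ideal(2)[OF K k, of "e / (2 * C)"] e C by auto
        have uK: "u \<in> K" "u \<in> carrier A" using u KD(2) JD(2) by (auto simp: J.approx_unit_def)
        have n: "nrm A (k \<ominus> u \<otimes> k) \<le> e / (2 * C)" using n minus[of k "u \<otimes> k"] kJ uK JD by auto
        have "a \<otimes> (u \<otimes> k) = (a \<otimes> u) \<otimes> k" using a uK kJ by (simp add: m_assoc)
        moreover have "a \<otimes> u \<in> J" using JD(6)[OF a] uK KD(2) by auto
        ultimately have mem: "a \<otimes> (u \<otimes> k) \<in> K" using KD(6) k by simp
        have "nrm A (a \<otimes> k \<ominus> a \<otimes> (u \<otimes> k)) \<le> nrm A a * nrm A (k \<ominus> u \<otimes> k)"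
          using nrm_mult[of a "k \<ominus> u \<otimes> k"] a kJ uK by (simp add: mult_minus_distrib m_closed)
        also have "\<dots> < e" using small[OF n] e kJ uK by (simp add: nrm_nonneg m_closed)
        finally show "\<exists>y\<in>K. nrm A (a \<otimes> k \<ominus> y) < e" using mem by blast
      qed (use a kJ in \<open>simp add: m_closed\<close>)
    qed
    have "k \<otimes> a \<in> K" if a: "a \<in> carrier A" and k: "k \<in> K" for a k
    proof -
      have "k \<in> carrier A" using k KD(2) JD(2) by auto
      then have "k \<otimes> a = adj A (adj A a \<otimes> adj A k)" using a by (simp add: star_expand algebra_closed)
      moreover have "adj A a \<otimes> adj A k \<in> K"
        using left[of "adj A a" "adj A k"] J.adj_mem_ideal[OF K k] a by (simp add: adj_closed)
      ultimately show ?thesis using J.adj_mem_ideal[OF K] by simp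
    qed
    then show ?thesis using left nK KD by (simp add: closed_ideals_iff)
  qed
  moreover have "K \<in> closed_ideals (subalgebra_on A J)" if "K \<in> closed_ideals A" "K \<subseteq> J" for K
    using that closed_idealD[OF that(1)] JD(2) closed by (auto simp: J.closed_ideals_iff)
  moreover have "K \<subseteq> J" if "K \<in> closed_ideals (subalgebra_on A J)" for K
    using J.closed_idealD(2)[OF that] by simp
  ultimately show ?thesis by blast
qed

section \<open>Images with the quotient norm\<close>

definition star_epi :: "'a cstar \<Rightarrow> 'b cstar \<Rightarrow> ('a \<Rightarrow> 'b) \<Rightarrow> bool" where
  "star_epi A B f \<longleftrightarrow> f ` carrier A = carrier B \<and>
     (\<forall>x\<in>carrier A. \<forall>y\<in>carrier A. f (x \<oplus>\<^bsub>A\<^esub> y) = f x \<oplus>\<^bsub>B\<^esub> f y) \<and>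
     (\<forall>x\<in>carrier A. \<forall>y\<in>carrier A. f (x \<otimes>\<^bsub>A\<^esub> y) = f x \<otimes>\<^bsub>B\<^esub> f y) \<and>
     (\<forall>c. \<forall>x\<in>carrier A. f (c \<odot>\<^bsub>A\<^esub> x) = c \<odot>\<^bsub>B\<^esub> f x) \<and>
     (\<forall>x\<in>carrier A. f (adj A x) = adj B (f x))"

definition star_kernel :: "'a cstar \<Rightarrow> 'b cstar \<Rightarrow> ('a \<Rightarrow> 'b) \<Rightarrow> 'a set" where
  "star_kernel A B f = {x \<in> carrier A. f x = \<zero>\<^bsub>B\<^esub>}"

lemma star_epiD:
  assumes "star_epi A B f"
  shows "f ` carrier A = carrier B" "\<And>x. x \<in> carrier A \<Longrightarrow> f x \<in> carrier B"
    and "\<And>x y. x \<in> carrier A \<Longrightarrow> y \<in> carrier A \<Longrightarrow> f (x \<oplus>\<^bsub>A\<^esub> y) = f x \<oplus>\<^bsub>B\<^esub> f y"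
    and "\<And>x y. x \<in> carrier A \<Longrightarrow> y \<in> carrier A \<Longrightarrow> f (x \<otimes>\<^bsub>A\<^esub> y) = f x \<otimes>\<^bsub>B\<^esub> f y"
    and "\<And>c x. x \<in> carrier A \<Longrightarrow> f (c \<odot>\<^bsub>A\<^esub> x) = c \<odot>\<^bsub>B\<^esub> f x"
    and "\<And>x. x \<in> carrier A \<Longrightarrow> f (adj A x) = adj B (f x)"
    and "\<And>x y. x \<in> carrier A \<Longrightarrow> y \<in> carrier A \<Longrightarrow> (\<And>c x. x \<in> carrier A \<Longrightarrow> c \<odot>\<^bsub>A\<^esub> x \<in> carrier A) \<Longrightarrow>
           f (diff A x y) = diff B (f x) (f y)"
  using assms unfolding star_epi_def diff_def by auto

text \<open>
  Infima of norms are only approached; this turns products of approximations into a product bound.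
\<close>

lemma mult_le_of_all_greater:
  fixes p q r :: real
  assumes "0 \<le> p" "0 \<le> q" and le: "\<And>\<delta>. \<delta> > 0 \<Longrightarrow> r \<le> (p + \<delta>) * (q + \<delta>)"
  shows "r \<le> p * q"
proof (rule field_le_epsilon)
  fix e :: real assume e: "e > 0"
  define \<delta> where "\<delta> = min 1 (e / (p + q + 1))"
  have d: "\<delta> > 0" "\<delta> \<le> 1" "\<delta> * (p + q + 1) \<le> e"
    using e assms(1,2) pos_le_divide_eq[of "p + q + 1" \<delta> e] by (auto simp: \<delta>_def)
  have "r \<le> p * q + \<delta> * (p + q + \<delta>)" using le[OF d(1)] by (simp add: algebra_simps)
  also have "\<delta> * (p + q + \<delta>) \<le> \<delta> * (p + q + 1)" using d by (intro mult_left_mono) auto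
  finally show "r \<le> p * q + e" using d(3) by simp
qed

text \<open>
  A target with the algebraic structure of an image of \<open>A\<close> and the quotient norm. It covers
  both quotients and copies of \<open>A\<close> along injections into another type.
\<close>

locale star_image = cstar_algebra A for A :: "'a cstar" (structure) +
  fixes B :: "'b cstar" and f :: "'a \<Rightarrow> 'b"
  assumes epi: "star_epi A B f" and f_zero: "f \<zero> = \<zero>\<^bsub>B\<^esub>"
    and kernel: "star_kernel A B f \<in> closed_ideals A"
    and image_nrm: "\<And>x. x \<in> carrier A \<Longrightarrow> nrm B (f x) = Inf (nrm A ` {y \<in> carrier A. f y = f x})"
begin

lemmas f = star_epiD[OF epi]

lemma image_cases: "\<lbrakk>b \<in> carrier B; \<And>x. \<lbrakk>x \<in> carrier A; b = f x\<rbrakk> \<Longrightarrow> P\<rbrakk> \<Longrightarrow> P"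
  using f(1) by blast

lemma abelian_group_image: "abelian_group B"
proof (rule abelian_groupI)
  show "\<zero>\<^bsub>B\<^esub> \<in> carrier B" using f(2)[OF M.zero_closed] f_zero by simp
  fix u assume u: "u \<in> carrier B"
  then obtain x where x: "x \<in> carrier A" "u = f x" by (rule image_cases)
  show "\<zero>\<^bsub>B\<^esub> \<oplus>\<^bsub>B\<^esub> u = u" using f(3)[of \<zero> x] x f_zero by simp
  show "\<exists>v\<in>carrier B. v \<oplus>\<^bsub>B\<^esub> u = \<zero>\<^bsub>B\<^esub>"
    using f(2)[of "\<ominus> x"] f(3)[of "\<ominus> x" x] x f_zero by (intro bexI[of _ "f (\<ominus> x)"]) (auto simp: M.l_neg)
  fix v assume "v \<in> carrier B"
  then obtain y where y: "y \<in> carrier A" "v = f y" by (rule image_cases)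
  show "u \<oplus>\<^bsub>B\<^esub> v \<in> carrier B" using x y f(2,3) by (metis M.a_closed)
  show "u \<oplus>\<^bsub>B\<^esub> v = v \<oplus>\<^bsub>B\<^esub> u" using x y f(3) by (metis M.a_comm)
  fix w assume "w \<in> carrier B"
  then obtain z where z: "z \<in> carrier A" "w = f z" by (rule image_cases)
  show "u \<oplus>\<^bsub>B\<^esub> v \<oplus>\<^bsub>B\<^esub> w = u \<oplus>\<^bsub>B\<^esub> (v \<oplus>\<^bsub>B\<^esub> w)"
    using x y z by (simp add: M.a_assoc flip: f(3))
qed

lemma module_image: "module complex_ring B"
proof (rule moduleI)
  show "cring complex_ring" by (rule R.is_cring)
  show "abelian_group B" by (rule abelian_group_image)
  fix a b :: complex and u assume "u \<in> carrier B"
  then obtain x where x: "x \<in> carrier A" "u = f x" by (rule image_cases)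
  show "a \<odot>\<^bsub>B\<^esub> u \<in> carrier B" using f(2)[of "a \<odot> x"] f(5) x by simp
  show "(a \<oplus>\<^bsub>complex_ring\<^esub> b) \<odot>\<^bsub>B\<^esub> u = a \<odot>\<^bsub>B\<^esub> u \<oplus>\<^bsub>B\<^esub> b \<odot>\<^bsub>B\<^esub> u"
    using x by (simp add: complex_ring_def scale_add_left flip: f(3,5))
  show "(a \<otimes>\<^bsub>complex_ring\<^esub> b) \<odot>\<^bsub>B\<^esub> u = a \<odot>\<^bsub>B\<^esub> (b \<odot>\<^bsub>B\<^esub> u)"
    using x by (simp add: complex_ring_def scale_scale flip: f(5))
  show "\<one>\<^bsub>complex_ring\<^esub> \<odot>\<^bsub>B\<^esub> u = u"
    using x by (simp add: complex_ring_def flip: f(5))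
  fix v assume "v \<in> carrier B"
  then obtain y where y: "y \<in> carrier A" "v = f y" by (rule image_cases)
  show "a \<odot>\<^bsub>B\<^esub> (u \<oplus>\<^bsub>B\<^esub> v) = a \<odot>\<^bsub>B\<^esub> u \<oplus>\<^bsub>B\<^esub> a \<odot>\<^bsub>B\<^esub> v"
    using x y by (simp add: scale_add_right flip: f(3,5))
qed

lemma image_diff: "\<lbrakk>x \<in> carrier A; y \<in> carrier A\<rbrakk> \<Longrightarrow> f (x \<ominus> y) = diff B (f x) (f y)"
  using f(7) by (simp add: minus_eq_diff)

lemma image_diff_eq: "\<lbrakk>x \<in> carrier A; y \<in> carrier A\<rbrakk> \<Longrightarrow> f x = f y \<longleftrightarrow> x \<ominus> y \<in> star_kernel A B f"
proof -
  assume xy: "x \<in> carrier A" "y \<in> carrier A"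
  interpret B: module complex_ring B by (rule module_image)
  have "f (x \<ominus> y) = f x \<ominus>\<^bsub>B\<^esub> f y"
    using xy f(2) module_minus_eq_diff[OF module_image] image_diff by simp
  moreover have "f x = (f x \<ominus>\<^bsub>B\<^esub> f y) \<oplus>\<^bsub>B\<^esub> f y"
    using xy f(2) by (simp add: a_minus_def B.M.a_assoc B.M.l_neg)
  moreover have "f y \<ominus>\<^bsub>B\<^esub> f y = \<zero>\<^bsub>B\<^esub>" using xy f(2) by (simp add: a_minus_def B.M.r_neg)
  ultimately show ?thesis using xy f(2) unfolding star_kernel_def
    by (metis (mono_tags, lifting) B.M.l_zero M.minus_closed mem_Collect_eq)
qed

lemma image_nrm_le: "\<lbrakk>x \<in> carrier A; y \<in> carrier A; f y = f x\<rbrakk> \<Longrightarrow> nrm B (f x) \<le> nrm A y"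
  unfolding image_nrm
  by (rule cInf_lower) (auto intro!: bdd_belowI[of _ 0] nrm_nonneg)

lemma image_nrm_lift:
  assumes "x \<in> carrier A" "\<delta> > 0"
  obtains y where "y \<in> carrier A" "f y = f x" "nrm A y < nrm B (f x) + \<delta>"
proof -
  have "nrm A ` {y \<in> carrier A. f y = f x} \<noteq> {}" using assms by auto
  then have "\<exists>r\<in>nrm A ` {y \<in> carrier A. f y = f x}. r < nrm B (f x) + \<delta>"
    using cInf_lessD[of "nrm A ` {y \<in> carrier A. f y = f x}" "nrm B (f x) + \<delta>"] assms
    by (auto simp: image_nrm)
  then show thesis using that by auto
qed

lemma image_nrm_nonneg: "x \<in> carrier A \<Longrightarrow> 0 \<le> nrm B (f x)"
  unfolding image_nrm by (rule cInf_greatest) (auto simp: nrm_nonneg)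

lemma image_nrm_eq_0:
  assumes x: "x \<in> carrier A"
  shows "nrm B (f x) = 0 \<longleftrightarrow> f x = \<zero>\<^bsub>B\<^esub>"
proof
  assume "f x = \<zero>\<^bsub>B\<^esub>"
  then show "nrm B (f x) = 0"
    using image_nrm_le[OF x M.zero_closed] f_zero image_nrm_nonneg[OF x] by simp
next
  assume n: "nrm B (f x) = 0"
  note K = closed_idealD[OF kernel]
  have "x \<in> star_kernel A B f"
  proof (rule norm_closedD[OF K(1) x])
    fix e :: real assume "e > 0"
    then obtain y where y: "y \<in> carrier A" "f y = f x" "nrm A y < e"
      using image_nrm_lift[OF x] n by auto
    then have "x \<ominus> y \<in> star_kernel A B f" using image_diff_eq[OF x y(1)] by simp
    moreover have "x \<ominus> (x \<ominus> y) = y"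
      using x y(1) by (simp add: a_minus_def M.minus_add M.r_neg1 flip: M.a_assoc) (simp add: M.r_neg)
    ultimately show "\<exists>y\<in>star_kernel A B f. nrm A (x \<ominus> y) < e"
      using y by (intro bexI[of _ "x \<ominus> y"]) auto
  qed
  then show "f x = \<zero>\<^bsub>B\<^esub>" by (simp add: star_kernel_def)
qed

lemma image_nrm_triangle:
  assumes x: "x \<in> carrier A" and y: "y \<in> carrier A"
  shows "nrm B (f (x \<oplus> y)) \<le> nrm B (f x) + nrm B (f y)"
proof (rule field_le_epsilon)
  fix e :: real assume e: "e > 0"
  obtain u where u: "u \<in> carrier A" "f u = f x" "nrm A u < nrm B (f x) + e/2"
    using image_nrm_lift[OF x, of "e/2"] e by auto
  obtain v where v: "v \<in> carrier A" "f v = f y" "nrm A v < nrm B (f y) + e/2"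
    using image_nrm_lift[OF y, of "e/2"] e by auto
  have "nrm B (f (x \<oplus> y)) \<le> nrm A (u \<oplus> v)"
    using x y u v by (intro image_nrm_le) (auto simp: f(3))
  then show "nrm B (f (x \<oplus> y)) \<le> nrm B (f x) + nrm B (f y) + e"
    using nrm_triangle[OF u(1) v(1)] u v by simp
qed

lemma image_nrm_scale_le:
  assumes x: "x \<in> carrier A"
  shows "nrm B (f (c \<odot> x)) \<le> cmod c * nrm B (f x)"
proof (rule mult_le_of_all_greater)
  fix \<delta> :: real assume d: "\<delta> > 0"
  obtain u where u: "u \<in> carrier A" "f u = f x" "nrm A u < nrm B (f x) + \<delta>"
    using image_nrm_lift[OF x d] by auto
  have "nrm B (f (c \<odot> x)) \<le> nrm A (c \<odot> u)"
    using x u by (intro image_nrm_le) (auto simp: f(5))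
  also have "\<dots> \<le> (cmod c + \<delta>) * (nrm B (f x) + \<delta>)"
    unfolding nrm_smult[OF u(1)] using u d by (intro mult_mono) (auto simp: nrm_nonneg)
  finally show "nrm B (f (c \<odot> x)) \<le> (cmod c + \<delta>) * (nrm B (f x) + \<delta>)" .
qed (use x image_nrm_nonneg in auto)

lemma image_nrm_scale:
  assumes x: "x \<in> carrier A"
  shows "nrm B (f (c \<odot> x)) = cmod c * nrm B (f x)"
proof (cases "c = 0")
  case True
  then show ?thesis using x image_nrm_eq_0[OF M.zero_closed] f_zero by simp
next
  case False
  then have "x = (1 / c) \<odot> (c \<odot> x)" using x by (simp add: scale_scale)
  then have "nrm B (f x) \<le> cmod (1 / c) * nrm B (f (c \<odot> x))"
    using image_nrm_scale_le[of "c \<odot> x" "1 / c"] x by simp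
  then have "cmod c * nrm B (f x) \<le> nrm B (f (c \<odot> x))"
    using False by (simp add: norm_divide field_simps)
  then show ?thesis using image_nrm_scale_le[OF x, of c] by simp
qed

lemma image_nrm_mult:
  assumes x: "x \<in> carrier A" and y: "y \<in> carrier A"
  shows "nrm B (f (x \<otimes> y)) \<le> nrm B (f x) * nrm B (f y)"
proof (rule mult_le_of_all_greater)
  fix \<delta> :: real assume d: "\<delta> > 0"
  obtain u where u: "u \<in> carrier A" "f u = f x" "nrm A u < nrm B (f x) + \<delta>"
    using image_nrm_lift[OF x d] by auto
  obtain v where v: "v \<in> carrier A" "f v = f y" "nrm A v < nrm B (f y) + \<delta>"
    using image_nrm_lift[OF y d] by auto
  have "nrm B (f (x \<otimes> y)) \<le> nrm A (u \<otimes> v)"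
    using x y u v by (intro image_nrm_le) (auto simp: f(4) m_closed)
  also have "\<dots> \<le> nrm A u * nrm A v" by (rule nrm_mult[OF u(1) v(1)])
  also have "\<dots> \<le> (nrm B (f x) + \<delta>) * (nrm B (f y) + \<delta>)"
    using u v d image_nrm_nonneg[OF x] image_nrm_nonneg[OF y] by (intro mult_mono) (auto simp: nrm_nonneg)
  finally show "nrm B (f (x \<otimes> y)) \<le> (nrm B (f x) + \<delta>) * (nrm B (f y) + \<delta>)" .
qed (use x y image_nrm_nonneg in auto)

lemma image_nrm_adj_le:
  assumes x: "x \<in> carrier A"
  shows "nrm B (f (adj A x)) \<le> nrm B (f x)"
proof (rule field_le_epsilon)
  fix e :: real assume e: "e > 0"
  obtain u where u: "u \<in> carrier A" "f u = f x" "nrm A u < nrm B (f x) + e"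
    using image_nrm_lift[OF x e] by auto
  have "nrm B (f (adj A x)) \<le> nrm A (adj A u)"
    using x u by (intro image_nrm_le) (auto simp: f(6) adj_closed)
  then show "nrm B (f (adj A x)) \<le> nrm B (f x) + e" using u by simp
qed

text \<open>
  For a near optimal representative \<open>y = x\<^sup>*x - m\<close> of \<open>x\<^sup>*x\<close>, with \<open>m\<close> in the kernel, take \<open>e\<close> in the
  kernel with \<open>m(1 - e)\<close> small. Then \<open>x(1 - e)\<close> represents \<open>x\<close> and
  \<open>\<parallel>x(1 - e)\<parallel>\<^sup>2 \<le> \<parallel>x\<^sup>*x(1 - e)\<parallel> \<le> \<parallel>y\<parallel> + \<parallel>m(1 - e)\<parallel>\<close>.
\<close>

lemma image_cstar_identity:
  assumes x: "x \<in> carrier A"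
  shows "nrm B (f (adj A x \<otimes> x)) = (nrm B (f x))\<^sup>2"
proof (rule antisym)
  have "nrm B (f (adj A x \<otimes> x)) \<le> nrm B (f (adj A x)) * nrm B (f x)"
    using x by (intro image_nrm_mult) (auto simp: adj_closed)
  also have "\<dots> \<le> nrm B (f x) * nrm B (f x)"
    using image_nrm_adj_le[OF x] image_nrm_nonneg[OF x] by (rule mult_right_mono)
  finally show "nrm B (f (adj A x \<otimes> x)) \<le> (nrm B (f x))\<^sup>2" by (simp add: power2_eq_square)
next
  show "(nrm B (f x))\<^sup>2 \<le> nrm B (f (adj A x \<otimes> x))"
  proof (rule field_le_epsilon)
    fix \<epsilon> :: real assume e: "\<epsilon> > 0"
    define h where "h = adj A x \<otimes> x"
    have h: "h \<in> carrier A" using x by (simp add: h_def algebra_closed)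
    obtain y where y: "y \<in> carrier A" "f y = f h" "nrm A y < nrm B (f h) + \<epsilon>/2"
      using image_nrm_lift[OF h, of "\<epsilon>/2"] e by auto
    note K = closed_idealD[OF kernel]
    define m where "m = h \<ominus> y"
    have m: "m \<in> star_kernel A B f" "m \<in> carrier A"
      using image_diff_eq[OF h y(1)] y h by (auto simp: m_def)
    obtain e where e: "e \<in> approx_unit (star_kernel A B f)" "nrm A (m \<ominus> m \<otimes> e) \<le> \<epsilon>/2"
      using approx_unit_ideal(1)[OF kernel m(1), of "\<epsilon>/2"] \<open>\<epsilon> > 0\<close> by auto
    note eD = approx_unitD[OF e(1) _ K(2)]
    have ec: "e \<in> carrier A" "adj A e = e" "e \<in> star_kernel A B f" using eD x by auto
    have "x \<otimes> e \<in> star_kernel A B f" using K(6)[OF x] ec by auto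
    moreover have "x \<ominus> (x \<ominus> x \<otimes> e) = x \<otimes> e"
      using x ec by (simp add: a_minus_def M.minus_add m_closed M.r_neg1 flip: M.a_assoc) (simp add: M.r_neg m_closed)
    ultimately have "f (x \<ominus> x \<otimes> e) = f x"
      using image_diff_eq[of x "x \<ominus> x \<otimes> e"] x ec by (simp add: m_closed)
    then have "(nrm B (f x))\<^sup>2 \<le> (nrm A (x \<ominus> x \<otimes> e))\<^sup>2"
      using x ec by (intro power_mono image_nrm_le image_nrm_nonneg) (auto simp: m_closed)
    also have "\<dots> = nrm A (adj A (x \<ominus> x \<otimes> e) \<otimes> (x \<ominus> x \<otimes> e))"
      using x ec by (simp add: cstar_identity m_closed)
    also have "adj A (x \<ominus> x \<otimes> e) \<otimes> (x \<ominus> x \<otimes> e) = (h \<ominus> h \<otimes> e) \<ominus> e \<otimes> (h \<ominus> h \<otimes> e)"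
      using x ec by (simp add: h_def star_expand algebra_closed M.a_ac)
    also have "nrm A \<dots> \<le> nrm A (h \<ominus> h \<otimes> e)"
      using eD(4) h ec by (simp add: m_closed)
    also have "h \<ominus> h \<otimes> e = (m \<ominus> m \<otimes> e) \<oplus> (y \<ominus> y \<otimes> e)"
    proof -
      have "h = m \<oplus> y" using h y(1) by (simp add: m_def a_minus_def M.a_assoc M.l_neg)
      then show ?thesis using m(2) y(1) ec by (simp add: star_expand algebra_closed M.a_ac)
    qed
    also have "nrm A \<dots> \<le> nrm A (m \<ominus> m \<otimes> e) + nrm A (y \<ominus> y \<otimes> e)"
      using m y ec by (intro nrm_triangle) (auto simp: m_closed)
    also have "\<dots> \<le> \<epsilon>/2 + nrm A y" using e(2) eD(5)[OF y(1)] by simp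
    finally show "(nrm B (f x))\<^sup>2 \<le> nrm B (f (adj A x \<otimes> x)) + \<epsilon>"
      using y(3) by (simp add: h_def)
  qed
qed

text \<open>
  A subsequence whose consecutive distances are below \<open>2\<^sup>-\<^sup>k\<close> is lifted term by term, each lift
  chosen that close to the preceding one; the image of the limit is the limit.
\<close>

lemma image_Cauchy_limit:
  assumes \<sigma>: "\<And>n :: nat. \<sigma> n \<in> carrier B"
    and C: "\<And>\<epsilon>. \<epsilon> > 0 \<Longrightarrow> \<exists>N. \<forall>m\<ge>N. \<forall>n\<ge>N. nrm B (diff B (\<sigma> m) (\<sigma> n)) < \<epsilon>"
  shows "\<exists>b\<in>carrier B. \<forall>\<epsilon>>0. \<exists>N. \<forall>n\<ge>N. nrm B (diff B (\<sigma> n) b) < \<epsilon>"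
proof -
  have "\<exists>N. \<forall>k. (\<forall>m\<ge>N k. \<forall>n\<ge>N k. nrm B (diff B (\<sigma> m) (\<sigma> n)) < (1/2)^k)"
    using C by (intro choice allI) simp
  then obtain N where N: "\<And>k m n. m \<ge> N k \<Longrightarrow> n \<ge> N k \<Longrightarrow> nrm B (diff B (\<sigma> m) (\<sigma> n)) < (1/2)^k"
    by blast
  \<comment> \<open>Makes the thresholds monotone in \<open>k\<close>.\<close>
  define r where "r k = Max (N ` {..k}) " for k
  have r: "N k \<le> r k" "r k \<le> r (Suc k)" for k
    by (auto simp: r_def intro!: Max_ge Max_mono)
  have rmono: "r j \<le> r k" if "j \<le> k" for j k using r(2) that by (rule lift_Suc_mono_le)
  have "\<exists>x. \<forall>k. (x k \<in> carrier A \<and> f (x k) = \<sigma> (r k)) \<and> nrm A (x (Suc k) \<ominus> x k) < (1/2)^k"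
  proof (rule dependent_nat_choice)
    show "\<exists>x. x \<in> carrier A \<and> f x = \<sigma> (r 0)" using f(1) \<sigma>[of "r 0"] by (metis imageE)
  next
    fix x k assume x: "x \<in> carrier A \<and> f x = \<sigma> (r k)"
    obtain z where z: "z \<in> carrier A" "f z = \<sigma> (r (Suc k))" using f(1) \<sigma>[of "r (Suc k)"] by (metis imageE)
    have "nrm B (f (z \<ominus> x)) < (1/2)^k"
      using N[of k "r (Suc k)" "r k"] r(1)[of k] r(2)[of k] x z by (simp add: image_diff)
    then obtain d where d: "d \<in> carrier A" "f d = f (z \<ominus> x)" "nrm A d < (1/2)^k"
      using image_nrm_lift[of "z \<ominus> x" "(1/2)^k - nrm B (f (z \<ominus> x))"] x z by auto
    have "f (d \<oplus> x) = f ((z \<ominus> x) \<oplus> x)" using d x z by (simp add: f(3))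
    also have "(z \<ominus> x) \<oplus> x = z" using x z by (simp add: a_minus_def M.a_assoc M.l_neg)
    finally have "f (d \<oplus> x) = \<sigma> (r (Suc k))" using z by simp
    moreover have "(d \<oplus> x) \<ominus> x = d" using x d by (simp add: a_minus_def M.a_assoc M.r_neg)
    ultimately show "\<exists>y. (y \<in> carrier A \<and> f y = \<sigma> (r (Suc k))) \<and> nrm A (y \<ominus> x) < (1/2)^k"
      using d x by (intro exI[of _ "d \<oplus> x"]) auto
  qed
  then obtain x where x: "\<And>k. x k \<in> carrier A" "\<And>k. f (x k) = \<sigma> (r k)"
      "\<And>k. nrm A (x (Suc k) \<ominus> x k) < (1/2)^k" by blast
  have tail: "nrm A (x (k + j) \<ominus> x k) \<le> 2 * (1/2)^k - 2 * (1/2)^(k + j)" for k j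
  proof (induction j)
    case 0
    then show ?case using x(1) by (simp add: a_minus_def M.r_neg)
  next
    case (Suc j)
    have "nrm A (x (k + Suc j) \<ominus> x k) \<le> nrm A (x (Suc (k + j)) \<ominus> x (k + j)) + nrm A (x (k + j) \<ominus> x k)"
      using nrm_minus_triangle[of "x (Suc (k + j))" "x (k + j)" "x k"] x(1) by simp
    also have "\<dots> \<le> (1/2)^(k + j) + (2 * (1/2)^k - 2 * (1/2)^(k + j))"
      using Suc x(3)[of "k + j"] by simp
    finally show ?case by simp
  qed
  have small: "\<exists>k. 4 * (1/2)^k < \<epsilon>" if "\<epsilon> > 0" for \<epsilon> :: real
    using real_arch_pow_inv[of "\<epsilon>/4" "1/2"] that by (auto simp: field_simps)
  have near: "nrm A (x m \<ominus> x k) \<le> 2 * (1/2)^k" if "k \<le> m" for k m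
  proof -
    have "nrm A (x m \<ominus> x k) \<le> 2 * (1/2)^k - 2 * (1/2)^m" using tail[of k "m - k"] that by simp
    moreover have "(0::real) \<le> (1/2)^m" by simp
    ultimately show ?thesis by linarith
  qed
  obtain a where a: "a \<in> carrier A" "\<And>\<epsilon>. \<epsilon> > 0 \<Longrightarrow> \<exists>N. \<forall>n\<ge>N. nrm A (x n \<ominus> a) < \<epsilon>"
  proof (rule Cauchy_limit[of x])
    fix \<epsilon> :: real assume "\<epsilon> > 0"
    then obtain k where k: "4 * (1/2)^k < \<epsilon>" using small by blast
    have "nrm A (x m \<ominus> x n) < \<epsilon>" if "m \<ge> k" "n \<ge> k" for m n
      using nrm_minus_triangle[of "x m" "x k" "x n"] near[OF that(1)] near[OF that(2)]
        nrm_minus_commute[of "x k" "x n"] x(1) k by simp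
    then show "\<exists>N. \<forall>m\<ge>N. \<forall>n\<ge>N. nrm A (x m \<ominus> x n) < \<epsilon>" by blast
  qed (use x in auto)
  have "\<exists>M. \<forall>n\<ge>M. nrm B (diff B (\<sigma> n) (f a)) < \<epsilon>" if \<epsilon>: "\<epsilon> > 0" for \<epsilon>
  proof -
    obtain M where M: "\<And>n. n \<ge> M \<Longrightarrow> nrm A (x n \<ominus> a) < \<epsilon>/2" using a(2)[of "\<epsilon>/2"] \<epsilon> by auto
    obtain k0 where k0: "4 * (1/2)^k0 < \<epsilon>/2" using small[of "\<epsilon>/2"] \<epsilon> by auto
    define k where "k = max M k0"
    have "nrm B (diff B (\<sigma> n) (f a)) < \<epsilon>" if n: "n \<ge> r k" for n
    proof -
      obtain z where z: "z \<in> carrier A" "f z = \<sigma> n" using f(1) \<sigma>[of n] by (metis imageE)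
      have "N k0 \<le> r k" using r(1)[of k0] rmono[of k0 k] by (simp add: k_def)
      then have "nrm B (f (z \<ominus> x k)) < (1/2)^k0"
        using N[of k0 n "r k"] n z x by (simp add: image_diff)
      moreover have "nrm B (f (x k \<ominus> a)) < \<epsilon>/2"
        using image_nrm_le[of "x k \<ominus> a" "x k \<ominus> a"] M[of k] x(1) a(1) by (simp add: k_def)
      moreover have "f (z \<ominus> a) = f ((z \<ominus> x k) \<oplus> (x k \<ominus> a))"
        using minus_telescope[of z "x k" a] z x(1) a(1) by simp
      ultimately have "nrm B (f (z \<ominus> a)) < (1/2)^k0 + \<epsilon>/2"
        using image_nrm_triangle[of "z \<ominus> x k" "x k \<ominus> a"] z x(1) a(1) by simp
      also have "\<dots> \<le> \<epsilon>" using k0 zero_le_power[of "1/2::real" k0] by linarith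
      finally show ?thesis using z a(1) by (simp add: image_diff)
    qed
    then show ?thesis by blast
  qed
  then show ?thesis using f(2)[OF a(1)] by blast
qed

lemma cstar_algebra_image: "cstar_algebra B"
proof (intro cstar_algebra.intro[OF module_image] cstar_algebra_axioms.intro)
  show "Metric_space.mcomplete (carrier B) (cdist B)"
  proof (rule mcomplete_cdistI[OF module_image _ _ _ _ image_Cauchy_limit])
    fix u c assume "u \<in> carrier B"
    then obtain x where x: "x \<in> carrier A" "u = f x" by (rule image_cases)
    show "0 \<le> nrm B u" "nrm B u = 0 \<longleftrightarrow> u = \<zero>\<^bsub>B\<^esub>" "nrm B (c \<odot>\<^bsub>B\<^esub> u) = cmod c * nrm B u"
      using x image_nrm_nonneg image_nrm_eq_0 image_nrm_scale by (auto simp flip: f(5))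
    fix v assume "v \<in> carrier B"
    then obtain y where y: "y \<in> carrier A" "v = f y" by (rule image_cases)
    show "nrm B (u \<oplus>\<^bsub>B\<^esub> v) \<le> nrm B u + nrm B v"
      using x y image_nrm_triangle by (simp flip: f(3))
  qed
next
  fix u c assume "u \<in> carrier B"
  then obtain x where x: "x \<in> carrier A" "u = f x" by (rule image_cases)
  show "adj B u \<in> carrier B" using x f(2)[of "adj A x"] by (simp add: adj_closed f(6))
  show "adj B (adj B u) = u" using x by (simp add: adj_closed adj_adj flip: f(6))
  show "adj B (c \<odot>\<^bsub>B\<^esub> u) = cnj c \<odot>\<^bsub>B\<^esub> adj B u" using x by (simp add: adj_closed adj_smult flip: f(5,6))
  show "0 \<le> nrm B u" "nrm B u = 0 \<longleftrightarrow> u = \<zero>\<^bsub>B\<^esub>" "nrm B (c \<odot>\<^bsub>B\<^esub> u) = cmod c * nrm B u"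
    using x image_nrm_nonneg image_nrm_eq_0 image_nrm_scale by (auto simp flip: f(5))
  show "nrm B (adj B u \<otimes>\<^bsub>B\<^esub> u) = (nrm B u)\<^sup>2"
    using x image_cstar_identity by (simp add: adj_closed flip: f(4,6))
  fix v assume "v \<in> carrier B"
  then obtain y where y: "y \<in> carrier A" "v = f y" by (rule image_cases)
  show "u \<otimes>\<^bsub>B\<^esub> v \<in> carrier B" using x y f(2)[of "x \<otimes> y"] by (simp add: f(4) m_closed)
  show "(c \<odot>\<^bsub>B\<^esub> u) \<otimes>\<^bsub>B\<^esub> v = c \<odot>\<^bsub>B\<^esub> (u \<otimes>\<^bsub>B\<^esub> v)" "u \<otimes>\<^bsub>B\<^esub> (c \<odot>\<^bsub>B\<^esub> v) = c \<odot>\<^bsub>B\<^esub> (u \<otimes>\<^bsub>B\<^esub> v)"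
    using x y by (simp_all add: m_closed smult_m_left smult_m_right flip: f(4,5))
  show "adj B (u \<oplus>\<^bsub>B\<^esub> v) = adj B u \<oplus>\<^bsub>B\<^esub> adj B v" "adj B (u \<otimes>\<^bsub>B\<^esub> v) = adj B v \<otimes>\<^bsub>B\<^esub> adj B u"
    using x y by (simp_all add: m_closed adj_closed adj_add adj_mult flip: f(3,4,6))
  show "nrm B (u \<oplus>\<^bsub>B\<^esub> v) \<le> nrm B u + nrm B v" "nrm B (u \<otimes>\<^bsub>B\<^esub> v) \<le> nrm B u * nrm B v"
    using x y image_nrm_triangle image_nrm_mult by (simp_all flip: f(3,4))
  fix w assume "w \<in> carrier B"
  then obtain z where z: "z \<in> carrier A" "w = f z" by (rule image_cases)
  show "u \<otimes>\<^bsub>B\<^esub> v \<otimes>\<^bsub>B\<^esub> w = u \<otimes>\<^bsub>B\<^esub> (v \<otimes>\<^bsub>B\<^esub> w)"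
    "(u \<oplus>\<^bsub>B\<^esub> v) \<otimes>\<^bsub>B\<^esub> w = u \<otimes>\<^bsub>B\<^esub> w \<oplus>\<^bsub>B\<^esub> v \<otimes>\<^bsub>B\<^esub> w"
    "w \<otimes>\<^bsub>B\<^esub> (u \<oplus>\<^bsub>B\<^esub> v) = w \<otimes>\<^bsub>B\<^esub> u \<oplus>\<^bsub>B\<^esub> w \<otimes>\<^bsub>B\<^esub> v"
    using x y z by (simp_all add: m_closed m_assoc l_distr r_distr flip: f(3,4))
qed

end

context cstar_algebra
begin

lemma coset_mem:
  assumes "I \<subseteq> carrier A" "x \<in> carrier A"
  shows "z \<in> I +> x \<longleftrightarrow> z \<in> carrier A \<and> z \<ominus> x \<in> I"
proof
  assume "z \<in> I +> x"
  then obtain h where "h \<in> I" "z = h \<oplus> x" by (auto simp: a_r_coset_def')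
  then show "z \<in> carrier A \<and> z \<ominus> x \<in> I"
    using assms by (auto simp: a_minus_def M.a_assoc M.r_neg subset_iff)
next
  assume z: "z \<in> carrier A \<and> z \<ominus> x \<in> I"
  then have "z = (z \<ominus> x) \<oplus> x" using assms by (simp add: a_minus_def M.a_assoc M.l_neg)
  then show "z \<in> I +> x" using z unfolding a_r_coset_def' by blast
qed

lemma coset_eq:
  assumes I: "I \<in> closed_ideals A" and x: "x \<in> carrier A" and y: "y \<in> carrier A"
  shows "I +> x = I +> y \<longleftrightarrow> x \<ominus> y \<in> I"
proof -
  note ID = closed_idealD[OF I]
  have self: "y \<in> I +> y" "x \<in> I +> x" if "x \<in> carrier A" "y \<in> carrier A" for x y
    using coset_mem[OF ID(2)] that ID(3) by (auto simp: a_minus_def M.r_neg)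
  have sub: "I +> x \<subseteq> I +> y" if "x \<ominus> y \<in> I" "x \<in> carrier A" "y \<in> carrier A" for x y
  proof
    fix z assume "z \<in> I +> x"
    then have z: "z \<in> carrier A" "z \<ominus> x \<in> I" using coset_mem[OF ID(2)] that by auto
    then have "z \<ominus> y \<in> I" using minus_telescope[of z x y] that ID(4) by simp
    then show "z \<in> I +> y" using z coset_mem[OF ID(2)] that by auto
  qed
  show ?thesis
  proof
    assume "I +> x = I +> y"
    then have "x \<in> I +> y" using self x y by auto
    then show "x \<ominus> y \<in> I" using coset_mem[OF ID(2)] y by auto
  next
    assume d: "x \<ominus> y \<in> I"
    have "y \<ominus> x = \<ominus> (x \<ominus> y)"
      using x y M.a_comm[of "\<ominus> x" y] by (simp add: a_minus_def M.minus_add)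
    then have "y \<ominus> x \<in> I" using ID(8)[OF d] by simp
    then show "I +> x = I +> y" using sub[OF d x y] sub[of y x] x y by blast
  qed
qed

lemma star_image_quotient:
  assumes I: "I \<in> closed_ideals A"
  shows "star_image A (cstar_quotient A I) (\<lambda>x. I +> x)"
    and "star_kernel A (cstar_quotient A I) (\<lambda>x. I +> x) = I"
proof -
  note ID = closed_idealD[OF I]
  let ?Q = "cstar_quotient A I"
  have Ic: "y \<in> carrier A" if "y \<in> I" for y using that ID(2) by auto
  have rep: "y \<in> I +> x \<longleftrightarrow> y \<in> carrier A \<and> I +> y = I +> x" if "x \<in> carrier A" for x y
    using coset_mem[OF ID(2) that] coset_eq[OF I _ that] by blast
  have eqI: "S = I +> w" if "S \<subseteq> carrier A" "w \<in> S" "w \<in> carrier A" "\<And>y. y \<in> carrier A \<Longrightarrow> y \<in> S \<longleftrightarrow> y \<ominus> w \<in> I" for S w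
    using that coset_mem[OF ID(2) that(3)] by blast
  interpret S: abelian_subgroup I A
  proof (rule abelian_subgroupI3)
    show "additive_subgroup I A"
      using I by (simp add: additive_subgroup_def closed_ideals_def submodule_def)
  qed (rule M.abelian_group_axioms)
  have mult: "rcoset_mult A I (I +> x) (I +> y) = I +> (x \<otimes> y)"
    if x: "x \<in> carrier A" and y: "y \<in> carrier A" for x y
  proof -
    have "I +> (u \<otimes> v) = I +> (x \<otimes> y)" if "u \<in> I +> x" "v \<in> I +> y" for u v
    proof -
      have uv: "u \<in> carrier A" "u \<ominus> x \<in> I" "v \<in> carrier A" "v \<ominus> y \<in> I"
        using that coset_mem[OF ID(2)] x y by auto
      have "u \<otimes> v \<ominus> x \<otimes> y = (u \<otimes> v \<ominus> x \<otimes> v) \<oplus> (x \<otimes> v \<ominus> x \<otimes> y)"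
        using x y uv by (intro minus_telescope) (auto simp: m_closed)
      also have "\<dots> = (u \<ominus> x) \<otimes> v \<oplus> x \<otimes> (v \<ominus> y)"
        using x y uv by (simp add: mult_minus_distrib)
      also have "\<dots> \<in> I" using ID(4,6,7) uv x by simp
      finally show ?thesis using coset_eq[OF I] x y uv by (simp add: m_closed)
    qed
    moreover have "x \<in> I +> x" "y \<in> I +> y" using rep x y by auto
    ultimately show ?thesis unfolding rcoset_mult_def by blast
  qed
  have scale: "(\<Union>y\<in>I +> x. I +> (c \<odot> y)) = I +> (c \<odot> x)" if x: "x \<in> carrier A" for c x
  proof -
    have "I +> (c \<odot> y) = I +> (c \<odot> x)" if y: "y \<in> I +> x" for y
    proof -
      have yc: "y \<in> carrier A" "y \<ominus> x \<in> I" using y coset_mem[OF ID(2)] x by auto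
      then have "c \<odot> y \<ominus> c \<odot> x = c \<odot> (y \<ominus> x)"
        using x by (simp add: a_minus_def scale_add_right scale_minus_right)
      then show ?thesis using coset_eq[OF I] x yc ID(5) by simp
    qed
    moreover have "x \<in> I +> x" using rep x by auto
    ultimately show ?thesis by blast
  qed
  have adj: "adj A ` (I +> x) = I +> adj A x" if x: "x \<in> carrier A" for x
  proof -
    have sub: "adj A ` (I +> x) \<subseteq> I +> adj A x" if x: "x \<in> carrier A" for x
    proof
      fix z assume "z \<in> adj A ` (I +> x)"
      then obtain y where y: "y \<in> carrier A" "y \<ominus> x \<in> I" "z = adj A y"
        using coset_mem[OF ID(2)] x by auto
      have "adj A y \<ominus> adj A x = adj A (y \<ominus> x)"
        using x y by (simp add: a_minus_def adj_add adj_minus)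
      then show "z \<in> I +> adj A x"
        using adj_mem_ideal[OF I y(2)] coset_mem[OF ID(2)] x y by (simp add: adj_closed)
    qed
    have "z \<in> adj A ` (I +> x)" if "z \<in> I +> adj A x" for z
    proof -
      have z: "z \<in> carrier A" using that coset_mem[OF ID(2)] x by (simp add: adj_closed)
      have "adj A z \<in> I +> x" using sub[of "adj A x"] that x by (auto simp: adj_closed adj_adj)
      then show ?thesis using z adj_adj[OF z] by (metis imageI)
    qed
    then show ?thesis using sub[OF x] by blast
  qed
  have epi: "star_epi A ?Q (\<lambda>x. I +> x)"
    unfolding star_epi_def cstar_quotient_def
    using S.a_rcos_sum mult scale adj by (auto simp: A_RCOSETS_def')
  have zero: "I +> \<zero> = I" using ID(2) by (rule M.a_coset_add_zero)
  show ker: "star_kernel A ?Q (\<lambda>x. I +> x) = I"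
  proof -
    have "I +> x = I \<longleftrightarrow> x \<in> I" if "x \<in> carrier A" for x
      using coset_eq[OF I that M.zero_closed] that zero by simp
    then have "{x \<in> carrier A. I +> x = I} = {x \<in> carrier A. x \<in> I}" by blast
    then show ?thesis using ID(2) unfolding star_kernel_def cstar_quotient_def by auto
  qed
  have nrm: "nrm ?Q (I +> x) = Inf (nrm A ` {y \<in> carrier A. I +> y = I +> x})" if "x \<in> carrier A" for x
  proof -
    have "{y \<in> carrier A. I +> y = I +> x} = I +> x" using rep[OF that] by blast
    then show ?thesis by (simp add: cstar_quotient_def)
  qed
  show "star_image A ?Q (\<lambda>x. I +> x)"
    by (intro star_image.intro star_image_axioms.intro cstar_algebra_axioms epi nrm)
      (use ker I zero in \<open>simp_all add: cstar_quotient_def\<close>)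
qed

lemma cstar_algebra_quotient: "I \<in> closed_ideals A \<Longrightarrow> cstar_algebra (cstar_quotient A I)"
  by (rule star_image.cstar_algebra_image[OF star_image_quotient(1)])

lemma star_epi_quotient: "I \<in> closed_ideals A \<Longrightarrow> star_epi A (cstar_quotient A I) (\<lambda>x. I +> x)"
  by (rule star_image.epi[OF star_image_quotient(1)])

end

section \<open>Surjective *-homomorphisms\<close>

lemma star_epi_of_factorization:
  assumes A: "cstar_algebra A" and f: "star_epi A B f" and g: "star_epi A C g"
    and h: "\<And>x. x \<in> carrier A \<Longrightarrow> h (f x) = g x"
  shows "star_epi B C h"
proof -
  interpret cstar_algebra A by fact
  note f = star_epiD[OF f] and g = star_epiD[OF g]
  have img: "h ` carrier B = carrier C"
    unfolding f(1)[symmetric] g(1)[symmetric] using h by (auto simp: image_image)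
  have ex: "\<exists>x\<in>carrier A. u = f x" if "u \<in> carrier B" for u using that f(1) by blast
  show ?thesis
    unfolding star_epi_def
  proof (intro conjI ballI allI img)
    fix u c assume "u \<in> carrier B"
    then obtain x where x: "x \<in> carrier A" "u = f x" using ex by blast
    show "h (c \<odot>\<^bsub>B\<^esub> u) = c \<odot>\<^bsub>C\<^esub> h u" using x h[of "c \<odot>\<^bsub>A\<^esub> x"] by (simp add: h f(5) g(5))
    show "h (adj B u) = adj C (h u)" using x h[of "adj A x"] by (simp add: h f(6) g(6) adj_closed)
    fix v assume "v \<in> carrier B"
    then obtain y where y: "y \<in> carrier A" "v = f y" using ex by blast
    show "h (u \<oplus>\<^bsub>B\<^esub> v) = h u \<oplus>\<^bsub>C\<^esub> h v" using x y h[of "x \<oplus>\<^bsub>A\<^esub> y"] by (simp add: h f(3) g(3))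
    show "h (u \<otimes>\<^bsub>B\<^esub> v) = h u \<otimes>\<^bsub>C\<^esub> h v" using x y h[of "x \<otimes>\<^bsub>A\<^esub> y"] by (simp add: h f(4) g(4) m_closed)
  qed
qed

locale cstar_epi = A: cstar_algebra A + B: cstar_algebra B
  for A :: "'a cstar" (structure) and B :: "'b cstar" +
  fixes f :: "'a \<Rightarrow> 'b"
  assumes epi: "star_epi A B f"
begin

lemmas f = star_epiD[OF epi]

lemma f_zero: "f \<zero> = \<zero>\<^bsub>B\<^esub>"
  using f(5)[of "\<zero>" 0] f(2)[of "\<zero>"] by simp

lemma f_minus: "\<lbrakk>x \<in> carrier A; y \<in> carrier A\<rbrakk> \<Longrightarrow> f (x \<ominus> y) = f x \<ominus>\<^bsub>B\<^esub> f y"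
  using f(7)[of x y] f(2) by (simp add: A.minus_eq_diff B.minus_eq_diff)

text \<open>
  The equation relating \<open>c\<close> to \<open>u\<close> is algebraic, so it holds for the images, and in \<open>B\<close> it forces \<open>f u\<close> to
  have norm at most 1. Thus every self-adjoint \<open>u\<close> of norm below 1 has an image of norm at most 1.
\<close>

lemma contractive_self_adjoint:
  assumes g: "g \<in> carrier A" "adj A g = g"
  shows "nrm B (f g) \<le> nrm A g"
proof (rule dense_ge)
  fix s assume s: "nrm A g < s"
  then have s0: "s > 0" using A.nrm_nonneg[OF g(1)] by simp
  define u where "u = complex_of_real (1 / s) \<odot> g"
  have u: "u \<in> carrier A" "adj A u = u" "nrm A u < 1"
    using g s s0 by (simp_all add: u_def A.adj_smult A.nrm_smult norm_divide)
  define S where "S = {c \<in> carrier A. adj A c = c \<and> (\<forall>w\<in>{u}. w \<otimes> c = c \<otimes> w)}"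
  obtain c where c: "c \<in> S" "c \<oplus> c = u \<otimes> u \<oplus> c \<otimes> c"
  proof (rule A.exists_sqrt_complement[of "u \<otimes> u" S])
    show "u \<otimes> u \<in> carrier A" using u by (simp add: A.m_closed)
    have "nrm A (u \<otimes> u) \<le> nrm A u * nrm A u" by (rule A.nrm_mult[OF u(1) u(1)])
    also have "\<dots> \<le> nrm A u * 1" using u A.nrm_nonneg by (intro mult_left_mono) auto
    finally show "nrm A (u \<otimes> u) < 1" using u(3) by simp
    have "A.norm_closed (carrier A)" by (simp add: A.norm_closed_def)
    then show "A.norm_closed S"
      unfolding S_def using u by (intro A.norm_closed_self_adjoint_commuting) auto
    show "\<zero> \<in> S" using u by (simp add: S_def)
    fix c assume "c \<in> S"
    then have c: "c \<in> carrier A" "adj A c = c" "u \<otimes> c = c \<otimes> u" by (auto simp: S_def)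
    have "u \<otimes> (c \<otimes> c) = (c \<otimes> c) \<otimes> u" using c u(1) by (metis A.m_assoc)
    then show "(1/2) \<odot> (u \<otimes> u \<oplus> c \<otimes> c) \<in> S"
      using c u by (simp add: S_def A.m_closed A.adj_smult A.adj_add A.adj_mult
          A.smult_m_left A.smult_m_right A.l_distr A.r_distr A.m_assoc)
  qed
  have cc: "c \<in> carrier A" "adj A c = c" "c \<otimes> u = u \<otimes> c" using c by (auto simp: S_def)
  have "nrm B (f u \<otimes>\<^bsub>B\<^esub> f u) \<le> nrm B (f u)"
  proof (rule B.cosine_contractive(2))
    show "f c \<oplus>\<^bsub>B\<^esub> f c = f u \<otimes>\<^bsub>B\<^esub> f u \<oplus>\<^bsub>B\<^esub> f c \<otimes>\<^bsub>B\<^esub> f c"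
      using c(2) cc u by (simp add: A.m_closed flip: f(3,4))
    show "f c \<otimes>\<^bsub>B\<^esub> f u = f u \<otimes>\<^bsub>B\<^esub> f c" using cc u by (simp flip: f(4))
  qed (use u cc f(2) in \<open>simp_all flip: f(6)\<close>)
  moreover have "nrm B (f u \<otimes>\<^bsub>B\<^esub> f u) = (nrm B (f u))\<^sup>2"
    using B.cstar_identity[of "f u"] u f(2) by (simp flip: f(6))
  ultimately have "(nrm B (f u))\<^sup>2 \<le> nrm B (f u)" by simp
  then have "nrm B (f u) \<le> 1"
    by (simp add: power2_eq_square mult_le_cancel_left2) linarith
  moreover have "nrm B (f u) = nrm B (f g) / s"
    unfolding u_def using g s0 f(2) by (simp add: f(5) B.nrm_smult norm_divide)
  ultimately show "nrm B (f g) \<le> s" using s0 by (simp add: field_simps)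
qed

lemma contractive:
  assumes x: "x \<in> carrier A"
  shows "nrm B (f x) \<le> nrm A x"
proof (rule B.nrm_le_of_square_le)
  have h: "adj A x \<otimes> x \<in> carrier A" "adj A (adj A x \<otimes> x) = adj A x \<otimes> x"
    using x by (simp_all add: A.star_expand A.algebra_closed)
  have "nrm B (f (adj A x \<otimes> x)) \<le> nrm A (adj A x \<otimes> x)" by (rule contractive_self_adjoint[OF h])
  then show "nrm B (adj B (f x) \<otimes>\<^bsub>B\<^esub> f x) \<le> (nrm A x)\<^sup>2"
    using x by (simp add: A.cstar_identity A.adj_closed f(4,6))
qed (use x f(2) A.nrm_nonneg in auto)

lemma preimage_closed_ideal:
  assumes M: "M \<in> closed_ideals B"
  shows "{x \<in> carrier A. f x \<in> M} \<in> closed_ideals A" (is "?K \<in> _")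
proof -
  note MD = B.closed_idealD[OF M]
  have "A.norm_closed ?K"
    unfolding A.norm_closed_def
  proof (intro conjI ballI impI)
    fix x assume x: "x \<in> carrier A" and lim: "\<forall>e>0. \<exists>y\<in>?K. nrm A (x \<ominus> y) < e"
    have "f x \<in> M"
    proof (rule B.norm_closedD[OF MD(1) f(2)[OF x]])
      fix e :: real assume "e > 0"
      then obtain y where y: "y \<in> carrier A" "f y \<in> M" "nrm A (x \<ominus> y) < e" using lim by blast
      then show "\<exists>y\<in>M. nrm B (f x \<ominus>\<^bsub>B\<^esub> y) < e"
        using contractive[of "x \<ominus> y"] x by (intro bexI[of _ "f y"]) (auto simp: f_minus)
    qed
    then show "x \<in> ?K" using x by simp
  qed auto
  then show ?thesis
    using MD f f_zero by (auto simp: A.closed_ideals_iff A.m_closed)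
qed

lemma kernel_closed_ideal: "star_kernel A B f \<in> closed_ideals A"
  using preimage_closed_ideal[OF B.zero_closed_ideal] by (simp add: star_kernel_def)

lemma f_eq_iff: "\<lbrakk>x \<in> carrier A; y \<in> carrier A\<rbrakk> \<Longrightarrow> f x = f y \<longleftrightarrow> x \<ominus> y \<in> star_kernel A B f"
  using B.minus_eq_zero_iff[of "f x" "f y"] f(2) by (auto simp: star_kernel_def f_minus)

text \<open>\<open>h\<close> is \<open>g\<close> after a section of \<open>f\<close>; the inclusion of kernels makes the choice immaterial.\<close>

lemma factor:
  fixes C :: "'c cstar"
  assumes C: "cstar_algebra C" and g: "star_epi A C g" and ker: "star_kernel A B f \<subseteq> star_kernel A C g"
  obtains h where "star_epi B C h" "\<And>x. x \<in> carrier A \<Longrightarrow> h (f x) = g x"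
proof -
  interpret G: cstar_epi A C g
    using C g A.cstar_algebra_axioms by (intro cstar_epi.intro cstar_epi_axioms.intro)
  define h where "h = g \<circ> inv_into (carrier A) f"
  have h: "h (f x) = g x" if x: "x \<in> carrier A" for x
  proof -
    define y where "y = inv_into (carrier A) f (f x)"
    have y: "y \<in> carrier A" "f y = f x"
      using x by (auto simp: y_def inv_into_into f_inv_into_f)
    then have "g y = g x" using f_eq_iff G.f_eq_iff x ker by blast
    then show ?thesis by (simp add: h_def y_def)
  qed
  have "star_epi B C h" using A.cstar_algebra_axioms epi g h by (rule star_epi_of_factorization)
  then show thesis using that h by blast
qed

end

lemma cstar_epiI: "\<lbrakk>cstar_algebra A; cstar_algebra B; star_epi A B f\<rbrakk> \<Longrightarrow> cstar_epi A B f"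
  by (intro cstar_epi.intro cstar_epi_axioms.intro)

lemma star_isomorphism_iff: "star_isomorphism A B f \<longleftrightarrow> star_epi A B f \<and> inj_on f (carrier A)"
  by (auto simp: star_isomorphism_def star_epi_def bij_betw_def)

lemma star_epi_comp:
  assumes "star_epi A B f" "star_epi B C g"
  shows "star_epi A C (g \<circ> f)"
proof -
  note f = star_epiD[OF assms(1)] and g = star_epiD[OF assms(2)]
  have "(g \<circ> f) ` carrier A = carrier C" using f(1) g(1) by (metis image_comp)
  then show ?thesis using f g by (simp add: star_epi_def)
qed

lemma star_isomorphism_inverse:
  assumes A: "cstar_algebra A" and f: "star_isomorphism A B f"
  shows "star_isomorphism B A (inv_into (carrier A) f)"
proof -
  interpret cstar_algebra A by fact
  have e: "star_epi A B f" and inj: "inj_on f (carrier A)" using f by (auto simp: star_isomorphism_iff)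
  note D = star_epiD[OF e]
  define g where "g = inv_into (carrier A) f"
  have g: "g (f x) = x" if "x \<in> carrier A" for x using inj that by (simp add: g_def)
  have "star_epi A A (\<lambda>x. x)" by (simp add: star_epi_def)
  with A e have "star_epi B A g" using g by (rule star_epi_of_factorization)
  moreover have "inj_on g (carrier B)"
    using D(1) by (auto simp: g_def intro: inj_on_inv_into)
  ultimately show ?thesis by (simp add: star_isomorphism_iff g_def)
qed

lemma star_epi_same_kernel:
  assumes "cstar_algebra A" "cstar_algebra B" "cstar_algebra C"
    and f: "star_epi A B f" and g: "star_epi A C g" and ker: "star_kernel A B f = star_kernel A C g"
  obtains h where "star_isomorphism B C h" "\<And>x. x \<in> carrier A \<Longrightarrow> h (f x) = g x"
proof -
  interpret F: cstar_epi A B f using assms by (intro cstar_epiI)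
  interpret G: cstar_epi A C g using assms by (intro cstar_epiI)
  obtain h where h: "star_epi B C h" "\<And>x. x \<in> carrier A \<Longrightarrow> h (f x) = g x"
    using F.factor[OF assms(3) g] ker by auto
  have "inj_on h (carrier B)"
  proof (rule inj_onI)
    fix u v assume "u \<in> carrier B" "v \<in> carrier B" "h u = h v"
    moreover from this obtain x y where "x \<in> carrier A" "y \<in> carrier A" "u = f x" "v = f y"
      using F.f(1) by (metis imageE)
    ultimately show "u = v" using h(2) F.f_eq_iff G.f_eq_iff ker by simp
  qed
  then show thesis using that h by (simp add: star_isomorphism_iff)
qed

lemma star_isomorphism_nrm:
  assumes "cstar_algebra A" "cstar_algebra B" "star_isomorphism A B f" "x \<in> carrier A"
  shows "nrm B (f x) = nrm A x"
proof -
  interpret F: cstar_epi A B f using assms by (intro cstar_epiI) (auto simp: star_isomorphism_iff)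
  interpret G: cstar_epi B A "inv_into (carrier A) f"
    using assms star_isomorphism_inverse by (intro cstar_epiI) (auto simp: star_isomorphism_iff)
  have "inv_into (carrier A) f (f x) = x"
    using assms by (intro inv_into_f_f) (auto simp: star_isomorphism_iff)
  then show ?thesis using F.contractive[of x] G.contractive[of "f x"] assms F.f(2) by auto
qed

context cstar_epi
begin

text \<open>
  \<open>B\<close> is *-isomorphic, hence isometric, to the quotient by the kernel, so its norm is the quotient norm.
\<close>

lemma nrm_lift:
  assumes x: "x \<in> carrier A" and "\<delta> > 0"
  obtains y where "y \<in> carrier A" "f y = f x" "nrm A y < nrm B (f x) + \<delta>"
proof -
  let ?I = "star_kernel A B f"
  let ?Q = "cstar_quotient A ?I" and ?q = "\<lambda>x. ?I +> x"
  note I = kernel_closed_ideal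
  interpret Q: star_image A ?Q ?q by (rule A.star_image_quotient(1)[OF I])
  have Q: "cstar_algebra ?Q" by (rule Q.cstar_algebra_image)
  obtain h where h: "star_isomorphism ?Q B h" "\<And>x. x \<in> carrier A \<Longrightarrow> h (?q x) = f x"
    using star_epi_same_kernel[OF A.cstar_algebra_axioms Q B.cstar_algebra_axioms Q.epi epi]
      A.star_image_quotient(2)[OF I] by metis
  have "nrm ?Q (?q x) = nrm B (f x)"
    using star_isomorphism_nrm[OF Q B.cstar_algebra_axioms h(1) Q.f(2)[OF x]] h(2)[OF x] by simp
  then obtain y where "y \<in> carrier A" "?q y = ?q x" "nrm A y < nrm B (f x) + \<delta>"
    using Q.image_nrm_lift[OF x \<open>\<delta> > 0\<close>] by metis
  then show thesis using that h(2) x by metis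
qed

text \<open>
  Lifting a small difference \<open>f x - f l\<close> to a small \<open>y\<close> shows that \<open>x\<close> is close to \<open>x - y\<close>, which differs
  from \<open>l \<in> L\<close> by an element of the kernel and so lies in \<open>L\<close>.
\<close>

lemma image_closed_ideal:
  assumes L: "L \<in> closed_ideals A" and ker: "star_kernel A B f \<subseteq> L"
  shows "f ` L \<in> closed_ideals B"
proof -
  note LD = A.closed_idealD[OF L]
  have "B.norm_closed (f ` L)"
    unfolding B.norm_closed_def
  proof (intro conjI ballI impI)
    show "f ` L \<subseteq> carrier B" using LD(2) f(2) by auto
    fix b assume "b \<in> carrier B" and lim: "\<forall>e>0. \<exists>y\<in>f ` L. nrm B (b \<ominus>\<^bsub>B\<^esub> y) < e"
    then obtain x where x: "x \<in> carrier A" "b = f x" using f(1) by blast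
    have "x \<in> L"
    proof (rule A.norm_closedD[OF LD(1) x(1)])
      fix e :: real assume "e > 0"
      then obtain l where l: "l \<in> L" "nrm B (f x \<ominus>\<^bsub>B\<^esub> f l) < e" using lim x by auto
      have lc: "l \<in> carrier A" using l LD(2) by auto
      obtain y where y: "y \<in> carrier A" "f y = f (x \<ominus> l)" "nrm A y < e"
        using nrm_lift[of "x \<ominus> l" "e - nrm B (f x \<ominus>\<^bsub>B\<^esub> f l)"] x lc l(2) by (auto simp: f_minus)
      have "(x \<ominus> l) \<ominus> y \<in> L" using f_eq_iff[of "x \<ominus> l" y] x lc y ker by auto
      then have m: "((x \<ominus> l) \<ominus> y) \<oplus> l \<in> L" using LD(4) l(1) by simp
      have "x \<ominus> (((x \<ominus> l) \<ominus> y) \<oplus> l) = y"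
      proof -
        have "((x \<ominus> l) \<ominus> y) \<oplus> l = (x \<ominus> y) \<oplus> (\<ominus> l \<oplus> l)"
          using x(1) lc y(1) by (simp add: a_minus_def A.M.a_ac)
        also have "\<dots> = x \<ominus> y" using x(1) lc y(1) by (simp add: A.M.l_neg)
        finally show ?thesis
          using x(1) y(1) by (simp add: a_minus_def A.M.minus_add A.M.r_neg flip: A.M.a_assoc)
      qed
      then show "\<exists>y\<in>L. nrm A (x \<ominus> y) < e" using m y(3) by metis
    qed
    then show "b \<in> f ` L" using x by simp
  qed
  moreover have "b \<otimes>\<^bsub>B\<^esub> u \<in> f ` L \<and> u \<otimes>\<^bsub>B\<^esub> b \<in> f ` L" if bu: "b \<in> carrier B" "u \<in> f ` L" for b u
  proof -
    obtain a l where "a \<in> carrier A" "b = f a" "l \<in> L" "u = f l" using bu f(1) by blast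
    moreover from this have "l \<in> carrier A" using LD(2) by auto
    ultimately show ?thesis
      using imageI[OF LD(6), of a l f] imageI[OF LD(7), of a l f] by (simp add: f(4))
  qed
  moreover have "\<zero>\<^bsub>B\<^esub> \<in> f ` L" using imageI[OF LD(3), of f] f_zero by simp
  moreover have "u \<oplus>\<^bsub>B\<^esub> v \<in> f ` L \<and> c \<odot>\<^bsub>B\<^esub> u \<in> f ` L" if uv: "u \<in> f ` L" "v \<in> f ` L" for u v c
  proof -
    obtain k l where kl: "k \<in> L" "u = f k" "l \<in> L" "v = f l" using uv by blast
    then have "k \<in> carrier A" "l \<in> carrier A" using LD(2) by auto
    then show ?thesis
      using kl imageI[OF LD(4), of k l f] imageI[OF LD(5), of k f c] by (simp add: f(3,5))
  qed
  ultimately show ?thesis by (simp add: B.closed_ideals_iff)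
qed

lemma restrict:
  assumes L: "L \<in> closed_ideals A"
  shows "star_epi (subalgebra_on A L) (subalgebra_on B (f ` L)) f"
    and "star_kernel (subalgebra_on A L) (subalgebra_on B (f ` L)) f = star_kernel A B f \<inter> L"
  using A.closed_idealD(2)[OF L] f by (auto simp: star_epi_def star_kernel_def subset_iff)

end

lemma exists_isomorphic_copy:
  fixes A :: "'a cstar" and g :: "'a \<Rightarrow> 'b"
  assumes A: "cstar_algebra A" and inj: "inj_on g (carrier A)"
  shows "\<exists>B. cstar_algebra B \<and> star_isomorphism A B g"
proof -
  interpret cstar_algebra A by fact
  define k where "k = inv_into (carrier A) g"
  have k: "k (g x) = x" if "x \<in> carrier A" for x using inj that by (simp add: k_def)
  define B :: "'b cstar" where "B = \<lparr>carrier = g ` carrier A,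
     monoid.mult = (\<lambda>u v. g (k u \<otimes>\<^bsub>A\<^esub> k v)), one = g \<one>\<^bsub>A\<^esub>, ring.zero = g \<zero>\<^bsub>A\<^esub>,
     add = (\<lambda>u v. g (k u \<oplus>\<^bsub>A\<^esub> k v)), smult = (\<lambda>c u. g (c \<odot>\<^bsub>A\<^esub> k u)),
     adj = (\<lambda>u. g (adj A (k u))), nrm = (\<lambda>u. nrm A (k u))\<rparr>"
  have epi: "star_epi A B g" by (auto simp: star_epi_def B_def k)
  have ker: "star_kernel A B g = {\<zero>\<^bsub>A\<^esub>}"
    using inj by (auto simp: star_kernel_def B_def inj_on_eq_iff)
  have "nrm B (g x) = Inf (nrm A ` {y \<in> carrier A. g y = g x})" if "x \<in> carrier A" for x
  proof -
    have "{y \<in> carrier A. g y = g x} = {x}" using inj that by (auto simp: inj_on_def)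
    then show ?thesis using that k by (simp add: B_def)
  qed
  then have "star_image A B g"
    using epi ker zero_closed_ideal A by (intro star_image.intro star_image_axioms.intro) (auto simp: B_def)
  then have "cstar_algebra B" by (rule star_image.cstar_algebra_image)
  then show ?thesis using epi inj by (auto simp: star_isomorphism_iff)
qed

section \<open>Sums of ideals\<close>

abbreviation subquotient :: "'a cstar \<Rightarrow> 'a set \<Rightarrow> 'a set \<Rightarrow> 'a set cstar" where
  "subquotient A J I \<equiv> cstar_quotient (subalgebra_on A J) I"

lemma (in ring) sum_residue_identity:
  assumes "x \<in> carrier R" "j \<in> carrier R" "k \<in> carrier R" "n \<in> carrier R" "w \<in> carrier R"
  shows "(x \<ominus> j) \<ominus> (k \<oplus> ((n \<ominus> j) \<ominus> w)) = (x \<ominus> (n \<oplus> k)) \<oplus> w"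
    and "j \<oplus> n \<otimes> k = (j \<ominus> n \<otimes> j) \<oplus> n \<otimes> (j \<oplus> k)"
    and "(j \<oplus> k) \<ominus> (n \<oplus> w) = (j \<ominus> n) \<oplus> (k \<ominus> w)"
  using assms by algebra+

context cstar_algebra
begin

lemma sum_residue_identity:
  assumes "x \<in> carrier A" "j \<in> carrier A" "k \<in> carrier A" "n \<in> carrier A" "w \<in> carrier A"
  shows "(x \<ominus> j) \<ominus> (k \<oplus> ((n \<ominus> j) \<ominus> w)) = (x \<ominus> (n \<oplus> k)) \<oplus> w"
    and "j \<oplus> n \<otimes> k = (j \<ominus> n \<otimes> j) \<oplus> n \<otimes> (j \<oplus> k)"
    and "(j \<oplus> k) \<ominus> (n \<oplus> w) = (j \<ominus> n) \<oplus> (k \<ominus> w)"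
  using U.sum_residue_identity[OF assms[THEN embed_closed]] assms
  by - (rule embed_eqI, simp only: embed_simps, simp only: embed_simps)+

lemma closed_ideals_Int: "\<lbrakk>J \<in> closed_ideals A; K \<in> closed_ideals A\<rbrakk> \<Longrightarrow> J \<inter> K \<in> closed_ideals A"
  using closed_ideals_Inter[of "{J, K}"] by simp

lemma ideal_coset [simp]: "I +>\<^bsub>subalgebra_on A J\<^esub> x = I +> x"
  by (simp add: a_r_coset_def')

lemma ideal_quotient:
  assumes J: "J \<in> closed_ideals A" and I: "I \<in> closed_ideals A" "I \<subseteq> J"
  shows "star_image (subalgebra_on A J) (subquotient A J I) (\<lambda>x. I +> x)" (is ?image)
    and "cstar_algebra (subquotient A J I)" (is ?cstar)
    and "star_epi (subalgebra_on A J) (subquotient A J I) (\<lambda>x. I +> x)" (is ?epi)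
    and "star_kernel (subalgebra_on A J) (subquotient A J I) (\<lambda>x. I +> x) = I" (is ?kernel)
proof -
  interpret J: cstar_algebra "subalgebra_on A J" by (rule cstar_algebra_ideal[OF J])
  have "I \<in> closed_ideals (subalgebra_on A J)" using closed_ideals_ideal[OF J] I by simp
  note Q = J.star_image_quotient[OF this] J.cstar_algebra_quotient[OF this] J.star_epi_quotient[OF this]
  show ?image and ?cstar and ?epi and ?kernel using Q by simp_all
qed

text \<open>
  The distance of \<open>j\<close> from \<open>J \<inter> K\<close> is at most twice its distance from \<open>K\<close>: for \<open>e \<in> J\<close> with \<open>ej\<close> close to
  \<open>j\<close>, the element \<open>ek\<close> lies in both ideals and \<open>j + ek\<close> is close to \<open>e(j + k)\<close>. The factor 2 bounds the
  multiplication by \<open>e = 1 - (1 - e)\<close>.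
\<close>

lemma nrm_coset_le:
  assumes J: "J \<in> closed_ideals A" and K: "K \<in> closed_ideals A" and j: "j \<in> J" and k: "k \<in> K"
  shows "nrm (subquotient A J (J \<inter> K)) ((J \<inter> K) +> j) \<le> 2 * nrm A (j \<oplus> k)"
proof (rule field_le_epsilon)
  fix \<delta> :: real assume d: "\<delta> > 0"
  note JD = closed_idealD[OF J] and KD = closed_idealD[OF K]
  note JK = closed_ideals_Int[OF J K]
  let ?Q = "subquotient A J (J \<inter> K)" and ?q = "\<lambda>x. (J \<inter> K) +> x"
  interpret Q: star_image "subalgebra_on A J" ?Q ?q by (rule ideal_quotient(1)[OF J JK]) simp
  have c: "j \<in> carrier A" "k \<in> carrier A" using j k JD(2) KD(2) by auto
  obtain e where e: "e \<in> approx_unit J" "nrm A (j \<ominus> e \<otimes> j) \<le> \<delta>"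
    using approx_unit_ideal(2)[OF J j d] by blast
  have ec: "e \<in> J" "e \<in> carrier A" using e JD(2) by (auto simp: approx_unit_def)
  have ek: "e \<otimes> k \<in> J" "e \<otimes> k \<in> K" "e \<otimes> k \<in> carrier A" using JD(7) KD(6) c ec k by (auto simp: m_closed)
  have mem: "j \<oplus> e \<otimes> k \<in> J" using JD(4) j ek by simp
  have "(j \<oplus> e \<otimes> k) \<ominus> j = e \<otimes> k"
    using c ek(3) M.a_comm[of j "e \<otimes> k"] by (simp add: a_minus_def M.a_assoc M.r_neg)
  then have "?q (j \<oplus> e \<otimes> k) = ?q j"
    using coset_eq[OF JK, of "j \<oplus> e \<otimes> k" j] c ek by simp
  then have "nrm ?Q (?q j) \<le> nrm A (j \<oplus> e \<otimes> k)"
    using Q.image_nrm_le[of j "j \<oplus> e \<otimes> k"] j mem by simp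
  also have "j \<oplus> e \<otimes> k = (j \<ominus> e \<otimes> j) \<oplus> e \<otimes> (j \<oplus> k)"
    using c ec by (intro sum_residue_identity(2)[where x = \<zero> and w = \<zero>]) auto
  also have "nrm A \<dots> \<le> \<delta> + nrm A (e \<otimes> (j \<oplus> k))"
    using nrm_triangle[of "j \<ominus> e \<otimes> j" "e \<otimes> (j \<oplus> k)"] e(2) c ec by (simp add: m_closed)
  also have "nrm A (e \<otimes> (j \<oplus> k)) \<le> 2 * nrm A (j \<oplus> k)"
  proof -
    define z where "z = j \<oplus> k"
    have z: "z \<in> carrier A" using c by (simp add: z_def)
    have "e \<otimes> z = z \<ominus> (z \<ominus> e \<otimes> z)"
      using z ec by (simp add: a_minus_def M.minus_add M.r_neg m_closed flip: M.a_assoc)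
    then have "nrm A (e \<otimes> z) \<le> nrm A z + nrm A (z \<ominus> e \<otimes> z)"
      using nrm_triangle_minus[of z "z \<ominus> e \<otimes> z"] z ec by (simp add: m_closed)
    then show ?thesis using e(1) z unfolding approx_unit_def z_def by auto
  qed
  finally show "nrm ?Q (?q j) \<le> 2 * nrm A (j \<oplus> k) + \<delta>" by simp
qed

text \<open>
  If \<open>j\<^sub>n + k\<^sub>n\<close> converges to \<open>x\<close> then, by the last estimate, the classes of \<open>j\<^sub>n\<close> modulo \<open>J \<inter> K\<close> converge to
  that of some \<open>i \<in> J\<close>, and \<open>x - i\<close> is a limit of elements of \<open>K\<close>.
\<close>

lemma sum_closed_ideal:
  assumes J: "J \<in> closed_ideals A" and K: "K \<in> closed_ideals A"
  shows "J <+>\<^bsub>A\<^esub> K \<in> closed_ideals A"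
proof -
  note JD = closed_idealD[OF J] and KD = closed_idealD[OF K]
  note JK = closed_ideals_Int[OF J K]
  have Jc: "\<And>x. x \<in> J \<Longrightarrow> x \<in> carrier A" and Kc: "\<And>x. x \<in> K \<Longrightarrow> x \<in> carrier A" using JD(2) KD(2) by auto
  have sum: "x \<in> J <+>\<^bsub>A\<^esub> K \<longleftrightarrow> (\<exists>j\<in>J. \<exists>k\<in>K. x = j \<oplus> k)" for x by (auto simp: set_add_def')
  let ?Q = "subquotient A J (J \<inter> K)" and ?q = "\<lambda>x. (J \<inter> K) +> x"
  interpret J: cstar_algebra "subalgebra_on A J" by (rule cstar_algebra_ideal[OF J])
  interpret Q: star_image "subalgebra_on A J" ?Q ?q by (rule ideal_quotient(1)[OF J JK]) simp
  have Jminus: "x \<ominus>\<^bsub>subalgebra_on A J\<^esub> y = x \<ominus> y" if "x \<in> J" "y \<in> J" for x y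
    using that J.minus_eq_diff[of x y] minus_eq_diff[of x y] Jc by simp
  have qdiff: "diff ?Q (?q x) (?q y) = ?q (x \<ominus> y)" if "x \<in> J" "y \<in> J" for x y
    using Q.image_diff[of x y] that Jminus by simp
  have "norm_closed (J <+>\<^bsub>A\<^esub> K)"
    unfolding norm_closed_def
  proof (intro conjI ballI impI)
    show "J <+>\<^bsub>A\<^esub> K \<subseteq> carrier A" using Jc Kc by (auto simp: sum)
    fix x assume x: "x \<in> carrier A" and lim: "\<forall>e>0. \<exists>y\<in>J <+>\<^bsub>A\<^esub> K. nrm A (x \<ominus> y) < e"
    have "\<exists>j. \<exists>k\<in>K. j \<in> J \<and> nrm A (x \<ominus> (j \<oplus> k)) < (1/2)^n" for n :: nat
    proof -
      obtain y where y: "y \<in> J <+>\<^bsub>A\<^esub> K" "nrm A (x \<ominus> y) < (1/2)^n"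
        using lim[rule_format, of "(1/2)^n"] by auto
      then show ?thesis using sum[of y] by blast
    qed
    then obtain j k where jk: "\<And>n. j n \<in> J" "\<And>n. k n \<in> K"
        "\<And>n. nrm A (x \<ominus> (j n \<oplus> k n)) < (1/2 :: real)^n" by metis
    have small: "\<exists>N. 4 * (1/2)^N < \<epsilon>" if "\<epsilon> > 0" for \<epsilon> :: real
      using real_arch_pow_inv[of "\<epsilon>/4" "1/2"] that by (auto simp: field_simps)
    have pow: "(1/2 :: real)^n \<le> (1/2)^N" if "N \<le> n" for n N :: nat
      using that by (simp add: power_decreasing)
    have "\<exists>b\<in>carrier ?Q. \<forall>\<epsilon>>0. \<exists>N. \<forall>n\<ge>N. nrm ?Q (diff ?Q (?q (j n)) b) < \<epsilon>"
    proof (rule Q.image_Cauchy_limit)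
      show "?q (j n) \<in> carrier ?Q" for n using Q.f(2) jk(1) by simp
      fix \<epsilon> :: real assume "\<epsilon> > 0"
      then obtain N where N: "4 * (1/2)^N < \<epsilon>" using small by blast
      have "nrm ?Q (diff ?Q (?q (j m)) (?q (j n))) < \<epsilon>" if mn: "m \<ge> N" "n \<ge> N" for m n
      proof -
        have c: "j m \<in> carrier A" "j n \<in> carrier A" "k m \<in> carrier A" "k n \<in> carrier A"
          using jk Jc Kc by auto
        have "(j m \<oplus> k m) \<ominus> (j n \<oplus> k n) = (j m \<ominus> j n) \<oplus> (k m \<ominus> k n)"
          using c by (intro sum_residue_identity(3)[where x = \<zero>]) auto
        then have "nrm ?Q (?q (j m \<ominus> j n)) \<le> 2 * nrm A ((j m \<oplus> k m) \<ominus> (j n \<oplus> k n))"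
          using nrm_coset_le[OF J K, of "j m \<ominus> j n" "k m \<ominus> k n"] jk JD(9) KD(9) by simp
        also have "\<dots> \<le> 2 * (nrm A (x \<ominus> (j m \<oplus> k m)) + nrm A (x \<ominus> (j n \<oplus> k n)))"
          using nrm_minus_triangle[of "j m \<oplus> k m" x "j n \<oplus> k n"] nrm_minus_commute[of "j m \<oplus> k m" x] c x
          by simp
        also have "\<dots> < \<epsilon>"
          using less_le_trans[OF jk(3) pow[OF mn(1)]] less_le_trans[OF jk(3) pow[OF mn(2)]] N by simp
        finally show ?thesis using qdiff jk by simp
      qed
      then show "\<exists>N. \<forall>m\<ge>N. \<forall>n\<ge>N. nrm ?Q (diff ?Q (?q (j m)) (?q (j n))) < \<epsilon>" by blast
    qed
    then obtain b where b: "b \<in> carrier ?Q"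
        "\<And>\<epsilon>. \<epsilon> > 0 \<Longrightarrow> \<exists>N. \<forall>n\<ge>N. nrm ?Q (diff ?Q (?q (j n)) b) < \<epsilon>" by blast
    obtain i where i: "i \<in> J" "b = ?q i" using b(1) Q.f(1) by auto
    have lim_i: "\<exists>N. \<forall>n\<ge>N. nrm ?Q (?q (j n \<ominus> i)) < \<epsilon>" if "\<epsilon> > 0" for \<epsilon>
      using b(2)[OF that] qdiff[OF jk(1) i(1)] i(2) by simp
    have ic: "i \<in> carrier A" using i Jc by auto
    have "x \<ominus> i \<in> K"
    proof (rule norm_closedD[OF KD(1)])
      fix e :: real assume e: "e > 0"
      obtain N where N: "4 * (1/2)^N < e/2" using small[of "e/2"] e by auto
      obtain N' where N': "\<And>n. n \<ge> N' \<Longrightarrow> nrm ?Q (?q (j n \<ominus> i)) < e/2" using lim_i[of "e/2"] e by auto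
      define n where "n = max N N'"
      have mem: "j n \<ominus> i \<in> J" using JD(9) jk i by simp
      obtain w where w: "w \<in> J" "?q w = ?q (j n \<ominus> i)" "nrm A w < e/2"
        using Q.image_nrm_lift[of "j n \<ominus> i" "e/2 - nrm ?Q (?q (j n \<ominus> i))"] N'[of n] mem
        by (auto simp: n_def)
      have c: "w \<in> carrier A" "j n \<in> carrier A" "k n \<in> carrier A" using w jk Jc Kc by auto
      have "(j n \<ominus> i) \<ominus> w \<in> J \<inter> K"
        using coset_eq[OF JK, of "j n \<ominus> i" w] w c ic by simp
      then have "k n \<oplus> ((j n \<ominus> i) \<ominus> w) \<in> K" using KD(4) jk by simp
      moreover have "(x \<ominus> i) \<ominus> (k n \<oplus> ((j n \<ominus> i) \<ominus> w)) = (x \<ominus> (j n \<oplus> k n)) \<oplus> w"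
        by (rule sum_residue_identity(1)[OF x ic c(3,2,1)])
      moreover have "nrm A ((x \<ominus> (j n \<oplus> k n)) \<oplus> w) < e"
      proof -
        have "N \<le> n" by (simp add: n_def)
        then have "nrm A (x \<ominus> (j n \<oplus> k n)) < (1/2)^N" using less_le_trans[OF jk(3) pow] by blast
        moreover have "(0::real) \<le> (1/2)^N" by simp
        ultimately have "nrm A (x \<ominus> (j n \<oplus> k n)) < e/2" using N by linarith
        then show ?thesis
          using nrm_triangle[of "x \<ominus> (j n \<oplus> k n)" w] w(3) c x by simp
      qed
      ultimately show "\<exists>y\<in>K. nrm A ((x \<ominus> i) \<ominus> y) < e" by metis
    qed (use x ic in simp)
    moreover have "x = i \<oplus> (x \<ominus> i)"
      using x ic M.a_comm[of i "x \<ominus> i"] by (simp add: a_minus_def M.a_assoc M.l_neg)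
    ultimately show "x \<in> J <+>\<^bsub>A\<^esub> K" using i(1) sum by blast
  qed
  moreover have "\<zero> \<in> J <+>\<^bsub>A\<^esub> K" using JD(3) KD(3) sum by (metis M.l_zero M.zero_closed)
  moreover have "u \<oplus> v \<in> J <+>\<^bsub>A\<^esub> K \<and> c \<odot> u \<in> J <+>\<^bsub>A\<^esub> K \<and> (a \<in> carrier A \<longrightarrow> a \<otimes> u \<in> J <+>\<^bsub>A\<^esub> K \<and> u \<otimes> a \<in> J <+>\<^bsub>A\<^esub> K)"
    if uv: "u \<in> J <+>\<^bsub>A\<^esub> K" "v \<in> J <+>\<^bsub>A\<^esub> K" for u v c a
  proof -
    obtain j k j' k' where e: "j \<in> J" "k \<in> K" "u = j \<oplus> k" "j' \<in> J" "k' \<in> K" "v = j' \<oplus> k'"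
      using uv sum by blast
    have c: "j \<in> carrier A" "k \<in> carrier A" "j' \<in> carrier A" "k' \<in> carrier A" using e Jc Kc by auto
    have "u \<oplus> v = (j \<oplus> j') \<oplus> (k \<oplus> k')" using e c by (simp add: M.a_ac)
    then have "u \<oplus> v \<in> J <+>\<^bsub>A\<^esub> K" using JD(4) KD(4) e sum by blast
    moreover have "c \<odot> u = c \<odot> j \<oplus> c \<odot> k" using e c by (simp add: scale_add_right)
    then have "c \<odot> u \<in> J <+>\<^bsub>A\<^esub> K" using JD(5) KD(5) e sum by blast
    moreover have "a \<otimes> u \<in> J <+>\<^bsub>A\<^esub> K \<and> u \<otimes> a \<in> J <+>\<^bsub>A\<^esub> K" if a: "a \<in> carrier A"
    proof -
      have "a \<otimes> u = a \<otimes> j \<oplus> a \<otimes> k" "u \<otimes> a = j \<otimes> a \<oplus> k \<otimes> a"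
        using e c a by (simp_all add: l_distr r_distr)
      then show ?thesis using JD(6,7)[OF a] KD(6,7)[OF a] e sum by blast
    qed
    ultimately show ?thesis by blast
  qed
  ultimately show ?thesis unfolding closed_ideals_iff by blast
qed

lemma sum_ideal_upper:
  assumes J: "J \<in> closed_ideals A" and K: "K \<in> closed_ideals A"
  shows "J \<subseteq> J <+>\<^bsub>A\<^esub> K" "K \<subseteq> J <+>\<^bsub>A\<^esub> K"
proof -
  note JD = closed_idealD[OF J] and KD = closed_idealD[OF K]
  have sum: "j \<oplus> k \<in> J <+>\<^bsub>A\<^esub> K" if "j \<in> J" "k \<in> K" for j k
    using that by (auto simp: set_add_def')
  show "J \<subseteq> J <+>\<^bsub>A\<^esub> K"
  proof
    fix x assume "x \<in> J"
    then show "x \<in> J <+>\<^bsub>A\<^esub> K" using sum[of x \<zero>] JD(2) KD(3) by auto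
  qed
  show "K \<subseteq> J <+>\<^bsub>A\<^esub> K"
  proof
    fix x assume "x \<in> K"
    then show "x \<in> J <+>\<^bsub>A\<^esub> K" using sum[of \<zero> x] KD(2) JD(3) by auto
  qed
qed

lemma second_isomorphism:
  assumes J: "J \<in> closed_ideals A" and K: "K \<in> closed_ideals A"
  shows "star_epi (subalgebra_on A J) (subquotient A (J <+>\<^bsub>A\<^esub> K) K) (\<lambda>x. K +> x)"
    and "star_kernel (subalgebra_on A J) (subquotient A (J <+>\<^bsub>A\<^esub> K) K) (\<lambda>x. K +> x) = J \<inter> K"
proof -
  let ?Q = "subquotient A (J <+>\<^bsub>A\<^esub> K) K"
  note S = sum_closed_ideal[OF J K] and up = sum_ideal_upper[OF J K]
  note Q = ideal_quotient[OF S K up(2)]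
  note q = star_epiD[OF Q(3), simplified]
  have "(\<lambda>x. K +> x) ` J = (\<lambda>x. K +> x) ` (J <+>\<^bsub>A\<^esub> K)"
  proof
    show "(\<lambda>x. K +> x) ` (J <+>\<^bsub>A\<^esub> K) \<subseteq> (\<lambda>x. K +> x) ` J"
    proof
      fix u assume "u \<in> (\<lambda>x. K +> x) ` (J <+>\<^bsub>A\<^esub> K)"
      then obtain j k where jk: "j \<in> J" "k \<in> K" "u = K +> (j \<oplus> k)" by (auto simp: set_add_def')
      have c: "j \<in> carrier A" "k \<in> carrier A"
        using jk closed_idealD(2)[OF J] closed_idealD(2)[OF K] by auto
      have "(j \<oplus> k) \<ominus> j = k" using c M.a_comm[of j k] by (simp add: a_minus_def M.a_assoc M.r_neg)
      then have "u = K +> j" using coset_eq[OF K, of "j \<oplus> k" j] jk c by simp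
      then show "u \<in> (\<lambda>x. K +> x) ` J" using jk(1) by blast
    qed
  qed (use up in blast)
  then have "(\<lambda>x. K +> x) ` J = carrier ?Q" using q(1) by simp
  then show "star_epi (subalgebra_on A J) ?Q (\<lambda>x. K +> x)"
    using up(1) q(3-6) by (auto simp: star_epi_def subset_iff)
  have "star_kernel (subalgebra_on A J) ?Q (\<lambda>x. K +> x) = {x \<in> J. x \<in> star_kernel (subalgebra_on A (J <+>\<^bsub>A\<^esub> K)) ?Q (\<lambda>x. K +> x)}"
    using up(1) by (auto simp: star_kernel_def)
  then show "star_kernel (subalgebra_on A J) ?Q (\<lambda>x. K +> x) = J \<inter> K" unfolding Q(4) by auto
qed

end

section \<open>Classes of C*-algebras\<close>

lemma in_class_isomorphic:
  assumes "in_class P B" "star_isomorphism B C f" "cstar_algebra C"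
  shows "in_class P C"
proof -
  obtain B' g where B': "P B'" "star_isomorphism B' B g"
    using assms(1) by (auto simp: in_class_def star_isomorphic_def)
  have "star_isomorphism B' C (f \<circ> g)"
    using B'(2) assms(2) star_epi_comp star_epiD(1)
    unfolding star_isomorphism_iff by (metis comp_inj_on)
  then show ?thesis using B'(1) assms(3) by (auto simp: in_class_def star_isomorphic_def)
qed

lemma in_class_same_kernel:
  assumes "cstar_algebra A" "cstar_algebra B" "cstar_algebra C"
    and "star_epi A B f" "star_epi A C g" "star_kernel A B f = star_kernel A C g"
  shows "in_class P B \<longleftrightarrow> in_class P C"
proof -
  obtain h where h: "star_isomorphism B C h" using star_epi_same_kernel[OF assms] by blast
  have h': "star_isomorphism C B (inv_into (carrier B) h)"
    by (rule star_isomorphism_inverse[OF assms(2) h])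
  show ?thesis
    using in_class_isomorphic[OF _ h assms(3)] in_class_isomorphic[OF _ h' assms(2)] by blast
qed

lemma in_class_epi:
  fixes P :: "'u cstar \<Rightarrow> bool"
  assumes P: "cstar_property P" "upper_stable P" and B: "in_class P B"
    and C: "cstar_algebra C" and f: "star_epi B C f"
  shows "in_class P C"
proof -
  obtain B' :: "'u cstar" and g where B': "P B'" and g: "star_isomorphism B' B g"
    using B by (auto simp: in_class_def star_isomorphic_def)
  have cB': "cstar_algebra B'" using P(1) B' unfolding cstar_property_def by blast
  have fg: "star_epi B' C (f \<circ> g)" using g f star_epi_comp by (auto simp: star_isomorphism_iff)
  interpret cstar_epi B' C "f \<circ> g" by (rule cstar_epiI[OF cB' C fg])
  note I = kernel_closed_ideal
  have "in_class P (cstar_quotient B' (star_kernel B' C (f \<circ> g)))"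
    using P(2) B' I unfolding upper_stable_def by blast
  then show ?thesis
    using in_class_same_kernel[where P = P, OF cB' A.cstar_algebra_quotient[OF I] C A.star_epi_quotient[OF I] fg]
      A.star_image_quotient(2)[OF I] by simp
qed

text \<open>
  Choosing a representative of each coset moves the quotient back to the type of \<open>A\<close>, where
  classes are given.
\<close>

lemma (in cstar_algebra) exists_copy_of_quotient:
  assumes I: "I \<in> closed_ideals A"
  shows "\<exists>B :: 'a cstar. \<exists>g. cstar_algebra B \<and> star_isomorphism (cstar_quotient A I) B g"
proof -
  let ?Q = "cstar_quotient A I"
  have "inj_on (\<lambda>S. SOME x. x \<in> S) (carrier ?Q)"
  proof (rule inj_onI)
    have rep: "S = I +> (SOME x. x \<in> S)" if S: "S \<in> carrier ?Q" for S
    proof -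
      obtain x where x: "x \<in> carrier A" "S = I +> x"
        using S star_epiD(1)[OF star_epi_quotient[OF I]] by blast
      have "x \<in> S" using x closed_idealD(2,3)[OF I] coset_mem[of I x x] by (simp add: a_minus_def M.r_neg)
      then have "(SOME x. x \<in> S) \<in> S" by (rule someI)
      then show ?thesis using coset_eq[OF I] coset_mem[of I x] closed_idealD(2)[OF I] x by metis
    qed
    fix S T assume "S \<in> carrier ?Q" "T \<in> carrier ?Q" "(SOME x. x \<in> S) = (SOME x. x \<in> T)"
    then show "S = T" using rep[of S] rep[of T] by simp
  qed
  then show ?thesis using exists_isomorphic_copy[OF cstar_algebra_quotient[OF I]] by blast
qed

text \<open>
  Membership of a quotient in a class is decided on its isomorphic copies \<open>B\<close>, which are treated as
  images of \<open>A\<close> with kernel \<open>I\<close>; so properties of \<open>B\<close> can be expressed by ideals of \<open>A\<close>.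
\<close>

lemma (in cstar_algebra) in_class_quotient_iff:
  fixes R :: "'a cstar \<Rightarrow> bool"
  assumes I: "I \<in> closed_ideals A" and cstar: "\<And>B. R B \<Longrightarrow> cstar_algebra B"
    and R: "\<And>B h. \<lbrakk>cstar_algebra B; star_epi A B h; star_kernel A B h = I\<rbrakk> \<Longrightarrow> R B \<longleftrightarrow> \<Phi>"
  shows "in_class R (cstar_quotient A I) \<longleftrightarrow> \<Phi>"
proof -
  let ?Q = "cstar_quotient A I" and ?q = "\<lambda>x. I +> x"
  note Q = cstar_algebra_quotient[OF I] star_epi_quotient[OF I] star_image_quotient(2)[OF I]
  have R': "R B \<longleftrightarrow> \<Phi>" if B: "cstar_algebra B" and g: "star_isomorphism ?Q B g" for B g
  proof -
    have e: "star_epi ?Q B g" and inj: "inj_on g (carrier ?Q)" using g by (auto simp: star_isomorphism_iff)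
    interpret G: cstar_epi ?Q B g by (rule cstar_epiI[OF Q(1) B e])
    note q = star_epiD[OF Q(2)]
    have "g (?q x) = \<zero>\<^bsub>B\<^esub> \<longleftrightarrow> ?q x = \<zero>\<^bsub>?Q\<^esub>" if "x \<in> carrier A" for x
      using inj q(2)[OF that] G.f_zero inj_on_eq_iff[OF inj, of "?q x" "\<zero>\<^bsub>?Q\<^esub>"] by simp
    then have "star_kernel A B (g \<circ> ?q) = I" using Q(3) by (auto simp: star_kernel_def)
    then show ?thesis using R[OF B star_epi_comp[OF Q(2) e]] by simp
  qed
  show ?thesis
  proof
    assume "in_class R ?Q"
    then obtain B g where B: "R B" "star_isomorphism B ?Q g" by (auto simp: in_class_def star_isomorphic_def)
    then show \<Phi> using R'[OF cstar star_isomorphism_inverse[OF cstar]] by blast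
  next
    assume \<Phi>
    obtain B :: "'a cstar" and g where B: "cstar_algebra B" "star_isomorphism ?Q B g"
      using exists_copy_of_quotient[OF I] by blast
    then have "R B" using R' \<open>\<Phi>\<close> by blast
    moreover have "star_isomorphism B ?Q (inv_into (carrier ?Q) g)"
      by (rule star_isomorphism_inverse[OF Q(1) B(2)])
    ultimately show "in_class R ?Q" using Q(1) by (auto simp: in_class_def star_isomorphic_def)
  qed
qed

text \<open>
  The ideals of the image are the images \<open>f ` L\<close> of ideals \<open>L\<close> containing the kernel \<open>I\<close>, and \<open>f ` L\<close> is
  isomorphic to \<open>L/I\<close> since both are images of \<open>L\<close> with kernel \<open>I\<close>.
\<close>

lemma (in cstar_epi) has_nonzero_ideal_in_image_iff:
  "has_nonzero_ideal_in P B \<longleftrightarrow> (\<exists>L\<in>closed_ideals A. star_kernel A B f \<subset> L \<and>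
     in_class P (subquotient A L (star_kernel A B f)))" (is "_ \<longleftrightarrow> (\<exists>L\<in>_. ?I \<subset> L \<and> _)")
proof -
  note I = kernel_closed_ideal
  have iff: "in_class P (subalgebra_on B (f ` L)) \<longleftrightarrow> in_class P (subquotient A L ?I)"
    if L: "L \<in> closed_ideals A" "?I \<subseteq> L" for L
  proof (rule in_class_same_kernel[of "subalgebra_on A L"])
    note Q = A.ideal_quotient[OF L(1) I L(2)]
    show "star_epi (subalgebra_on A L) (subquotient A L ?I) (\<lambda>x. ?I +> x)"
      "cstar_algebra (subquotient A L ?I)" by (fact Q)+
    show "star_kernel (subalgebra_on A L) (subalgebra_on B (f ` L)) f =
        star_kernel (subalgebra_on A L) (subquotient A L ?I) (\<lambda>x. ?I +> x)"
      using Q(4) restrict(2)[OF L(1)] L(2) by auto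
  qed (use L restrict A.cstar_algebra_ideal B.cstar_algebra_ideal image_closed_ideal in auto)
  show ?thesis
  proof
    assume "has_nonzero_ideal_in P B"
    then obtain M where M: "M \<in> closed_ideals B" "M \<noteq> {\<zero>\<^bsub>B\<^esub>}" "in_class P (subalgebra_on B M)"
      by (auto simp: has_nonzero_ideal_in_def)
    define L where "L = {x \<in> carrier A. f x \<in> M}"
    have L: "L \<in> closed_ideals A" "?I \<subseteq> L"
      using preimage_closed_ideal[OF M(1)] B.closed_idealD(3)[OF M(1)] by (auto simp: L_def star_kernel_def)
    have fL: "f ` L = M" using f(1) B.closed_idealD(2)[OF M(1)] by (auto simp: L_def)
    have "L \<noteq> ?I"
    proof
      assume "L = ?I"
      then have "M \<subseteq> {\<zero>\<^bsub>B\<^esub>}" using fL by (auto simp: star_kernel_def)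
      then show False using M(2) B.closed_idealD(3)[OF M(1)] by auto
    qed
    then show "\<exists>L\<in>closed_ideals A. ?I \<subset> L \<and> in_class P (subquotient A L ?I)"
      using L iff[OF L] fL M(3) by (intro bexI[of _ L]) auto
  next
    assume "\<exists>L\<in>closed_ideals A. ?I \<subset> L \<and> in_class P (subquotient A L ?I)"
    then obtain L where L: "L \<in> closed_ideals A" "?I \<subset> L" "in_class P (subquotient A L ?I)"
      by blast
    obtain x where "x \<in> L" "x \<notin> ?I" using L(2) by blast
    then have "f x \<noteq> \<zero>\<^bsub>B\<^esub>" "f x \<in> f ` L"
      using A.closed_idealD(2)[OF L(1)] by (auto simp: star_kernel_def)
    then show "has_nonzero_ideal_in P B"
      using iff[of L] L image_closed_ideal[of L] unfolding has_nonzero_ideal_in_def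
      by (intro bexI[of _ "f ` L"]) auto
  qed
qed

lemma (in cstar_epi) quotients_have_nonzero_ideal_in_iff:
  "(\<forall>M\<in>closed_ideals B. M \<noteq> carrier B \<longrightarrow> has_nonzero_ideal_in P (cstar_quotient B M)) \<longleftrightarrow>
   (\<forall>K\<in>closed_ideals A. star_kernel A B f \<subseteq> K \<and> K \<noteq> carrier A \<longrightarrow>
     (\<exists>L\<in>closed_ideals A. K \<subset> L \<and> in_class P (subquotient A L K)))"
    (is "?L \<longleftrightarrow> ?R")
proof -
  have iff: "has_nonzero_ideal_in P (cstar_quotient B M) \<longleftrightarrow>
      (\<exists>L\<in>closed_ideals A. K \<subset> L \<and> in_class P (subquotient A L K))"
    if M: "M \<in> closed_ideals B" and K: "K = {x \<in> carrier A. f x \<in> M}" for M K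
  proof -
    let ?Q = "cstar_quotient B M" and ?g = "(\<lambda>b. M +>\<^bsub>B\<^esub> b) \<circ> f"
    interpret Q: cstar_epi A ?Q ?g
      by (rule cstar_epiI[OF A.cstar_algebra_axioms B.cstar_algebra_quotient[OF M]
            star_epi_comp[OF epi B.star_epi_quotient[OF M]]])
    have "b \<in> M \<longleftrightarrow> M +>\<^bsub>B\<^esub> b = \<zero>\<^bsub>?Q\<^esub>" if "b \<in> carrier B" for b
      using that B.star_image_quotient(2)[OF M] by (auto simp: star_kernel_def)
    then have "star_kernel A ?Q ?g = K" using f(2) by (auto simp: star_kernel_def K)
    then show ?thesis using Q.has_nonzero_ideal_in_image_iff[of P] by simp
  qed
  show ?thesis
  proof
    assume L: ?L
    show ?R
    proof (intro ballI impI, elim conjE)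
      fix K assume K: "K \<in> closed_ideals A" "star_kernel A B f \<subseteq> K" "K \<noteq> carrier A"
      note KD = A.closed_idealD[OF K(1)]
      have eq: "K = {x \<in> carrier A. f x \<in> f ` K}"
      proof (intro equalityI subsetI)
        fix x assume "x \<in> {x \<in> carrier A. f x \<in> f ` K}"
        then obtain k where x: "x \<in> carrier A" "k \<in> K" "f x = f k" by auto
        have "k \<in> carrier A" using x KD(2) by auto
        then have "x \<ominus> k \<in> K" using f_eq_iff[of x k] x K(2) by auto
        then have "(x \<ominus> k) \<oplus> k \<in> K" using KD(4) x by simp
        then show "x \<in> K"
          using x \<open>k \<in> carrier A\<close> by (simp add: a_minus_def A.M.a_assoc A.M.l_neg)
      qed (use KD(2) in auto)
      have fK: "f ` K \<in> closed_ideals B" using image_closed_ideal K by simp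
      have "f ` K \<noteq> carrier B"
      proof
        assume "f ` K = carrier B"
        then have "carrier A \<subseteq> K" using eq f(2) by blast
        then show False using K(3) KD(2) by blast
      qed
      then have "has_nonzero_ideal_in P (cstar_quotient B (f ` K))" using L fK by blast
      then show "\<exists>L\<in>closed_ideals A. K \<subset> L \<and> in_class P (subquotient A L K)"
        using iff[OF fK eq] by blast
    qed
  next
    assume R: ?R
    show ?L
    proof (intro ballI impI)
      fix M assume M: "M \<in> closed_ideals B" "M \<noteq> carrier B"
      define K where "K = {x \<in> carrier A. f x \<in> M}"
      have "K \<in> closed_ideals A" "star_kernel A B f \<subseteq> K"
        using preimage_closed_ideal[OF M(1)] B.closed_idealD(3)[OF M(1)] by (auto simp: K_def star_kernel_def)
      moreover have "K \<noteq> carrier A"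
      proof
        assume "K = carrier A"
        then have "f x \<in> M" if "x \<in> carrier A" for x using that by (auto simp: K_def)
        then have "f ` carrier A \<subseteq> M" by auto
        then have "carrier B \<subseteq> M" by (simp only: f(1))
        then show False using M B.closed_idealD(2)[OF M(1)] by blast
      qed
      ultimately show "has_nonzero_ideal_in P (cstar_quotient B M)"
        using R iff[OF M(1) K_def] by blast
    qed
  qed
qed

text \<open>The zero algebra has no closed ideal other than itself, so it needs no separate case.\<close>

lemma G_property_iff:
  "G_property P B \<longleftrightarrow> cstar_algebra B \<and>
     (\<forall>M\<in>closed_ideals B. M \<noteq> carrier B \<longrightarrow> has_nonzero_ideal_in P (cstar_quotient B M))"
proof -
  have "M = carrier B" if "cstar_algebra B" "carrier B = {\<zero>\<^bsub>B\<^esub>}" "M \<in> closed_ideals B" for M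
    using cstar_algebra.closed_idealD(2,3)[OF that(1,3)] that(2) by auto
  then show ?thesis unfolding G_property_def by blast
qed

context cstar_algebra
begin

text \<open>
  With \<open>s K\<close> for \<open>K \<subseteq> J\<close>: quantifying over the closed ideals of \<open>J\<close> is quantifying over those of the
  whole algebra that are contained in \<open>J\<close>.
\<close>

lemma restrict_quantifiers:
  "(\<forall>K\<in>{K \<in> C. s K}. a K \<and> b K \<longrightarrow> (\<exists>L\<in>{L \<in> C. s L}. r K L)) \<longleftrightarrow>
   (\<forall>K\<in>C. a K \<and> s K \<and> b K \<longrightarrow> (\<exists>L\<in>C. s L \<and> r K L))"
  "\<not> (\<exists>L\<in>{L \<in> C. s L}. q L) \<longleftrightarrow> \<not> (\<exists>L\<in>C. s L \<and> q L)"
  by blast+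

lemma in_class_G_property_iff:
  fixes P :: "'a cstar \<Rightarrow> bool"
  assumes J: "J \<in> closed_ideals A" and I: "I \<in> closed_ideals A" "I \<subseteq> J"
  shows "in_class (G_property P) (subquotient A J I) \<longleftrightarrow>
    (\<forall>K\<in>closed_ideals A. I \<subseteq> K \<and> K \<subseteq> J \<and> K \<noteq> J \<longrightarrow>
      (\<exists>L\<in>closed_ideals A. L \<subseteq> J \<and> K \<subset> L \<and> in_class P (subquotient A L K)))"
proof -
  interpret J: cstar_algebra "subalgebra_on A J" by (rule cstar_algebra_ideal[OF J])
  note cl = closed_ideals_ideal[OF J]
  show ?thesis
  proof (rule J.in_class_quotient_iff)
    fix B :: "'a cstar" and h assume "cstar_algebra B" "star_epi (subalgebra_on A J) B h"
      and ker: "star_kernel (subalgebra_on A J) B h = I"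
    then interpret H: cstar_epi "subalgebra_on A J" B h
      using J.cstar_algebra_axioms by (intro cstar_epiI)
    show "G_property P B \<longleftrightarrow> (\<forall>K\<in>closed_ideals A. I \<subseteq> K \<and> K \<subseteq> J \<and> K \<noteq> J \<longrightarrow>
      (\<exists>L\<in>closed_ideals A. L \<subseteq> J \<and> K \<subset> L \<and> in_class P (subquotient A L K)))"
      unfolding G_property_iff H.quotients_have_nonzero_ideal_in_iff ker cl
      unfolding subalgebra_simps restrict_quantifiers using H.B.cstar_algebra_axioms by blast
  next
    show "I \<in> closed_ideals (subalgebra_on A J)" using I cl by simp
  qed (simp add: G_property_iff)
qed

lemma in_class_NG_property_iff:
  fixes P :: "'a cstar \<Rightarrow> bool"
  assumes J: "J \<in> closed_ideals A" and I: "I \<in> closed_ideals A" "I \<subseteq> J"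
  shows "in_class (NG_property P) (subquotient A J I) \<longleftrightarrow>
    \<not> (\<exists>L\<in>closed_ideals A. L \<subseteq> J \<and> I \<subset> L \<and> in_class P (subquotient A L I))"
proof -
  interpret J: cstar_algebra "subalgebra_on A J" by (rule cstar_algebra_ideal[OF J])
  note cl = closed_ideals_ideal[OF J]
  show ?thesis
  proof (rule J.in_class_quotient_iff)
    fix B :: "'a cstar" and h assume "cstar_algebra B" "star_epi (subalgebra_on A J) B h"
      and ker: "star_kernel (subalgebra_on A J) B h = I"
    then interpret H: cstar_epi "subalgebra_on A J" B h
      using J.cstar_algebra_axioms by (intro cstar_epiI)
    show "NG_property P B \<longleftrightarrow>
      \<not> (\<exists>L\<in>closed_ideals A. L \<subseteq> J \<and> I \<subset> L \<and> in_class P (subquotient A L I))"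
      unfolding NG_property_def H.has_nonzero_ideal_in_image_iff ker cl
      unfolding subalgebra_simps restrict_quantifiers using H.B.cstar_algebra_axioms by blast
  next
    show "I \<in> closed_ideals (subalgebra_on A J)" using I cl by simp
  qed (simp add: NG_property_def)
qed

lemma Id_lattice_simps [simp]:
  "carrier (Id_lattice A) = closed_ideals A" "I \<sqsubseteq>\<^bsub>Id_lattice A\<^esub> J \<longleftrightarrow> I \<subseteq> J"
  by (simp_all add: Id_lattice_def)

lemma join_Id_lattice:
  assumes J: "J \<in> closed_ideals A" and K: "K \<in> closed_ideals A"
  shows "J \<squnion>\<^bsub>Id_lattice A\<^esub> K = J <+>\<^bsub>A\<^esub> K"
proof -
  interpret L: complete_lattice "Id_lattice A" by (rule complete_lattice_Id_lattice[OF cstar_algebra_axioms])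
  note S = sum_closed_ideal[OF J K] and up = sum_ideal_upper[OF J K]
  let ?V = "J \<squnion>\<^bsub>Id_lattice A\<^esub> K"
  have V: "?V \<in> closed_ideals A" using L.join_closed[of J K] J K by simp
  have "?V \<subseteq> J <+>\<^bsub>A\<^esub> K" using L.join_le[of J "J <+>\<^bsub>A\<^esub> K" K] S up J K by simp
  moreover have "J <+>\<^bsub>A\<^esub> K \<subseteq> ?V"
    using L.join_left[of J K] L.join_right[of J K] J K closed_idealD(4)[OF V]
    by (auto simp: set_add_def')
  ultimately show ?thesis by blast
qed

text \<open>
  Reflexivity holds as the zero algebra is in every class. For the join, \<open>J \<rightarrow> (J + K)/K\<close> has
  kernel \<open>J \<inter> K \<supseteq> I\<close>, so it factors through \<open>J/I \<in> P\<close>, and \<open>P\<close> passes to images by upper stability.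
\<close>

lemma H_relation_ideal_rel:
  assumes P: "cstar_property P" "upper_stable P"
  shows "H_relation (Id_lattice A) (ideal_rel P A)"
proof -
  have "ideal_rel P A I I" if I: "I \<in> closed_ideals A" for I
  proof -
    interpret I: cstar_algebra "subalgebra_on A I" by (rule cstar_algebra_ideal[OF I])
    have II: "I \<in> closed_ideals (subalgebra_on A I)" using closed_ideals_ideal[OF I] I by simp
    let ?Q = "subquotient A I I"
    note Q = I.cstar_algebra_quotient[OF II] I.star_epi_quotient[OF II] I.star_image_quotient(2)[OF II]
    have cQ: "carrier ?Q = {\<zero>\<^bsub>?Q\<^esub>}"
      using star_epiD(1)[OF Q(2)] Q(3) closed_idealD(3)[OF I] unfolding star_kernel_def by auto
    obtain B :: "'a cstar" and g where B: "cstar_algebra B" "star_isomorphism ?Q B g"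
      using I.exists_copy_of_quotient[OF II] by blast
    interpret G: cstar_epi ?Q B g
      using Q(1) B by (intro cstar_epiI) (auto simp: star_isomorphism_iff)
    have "carrier B = {\<zero>\<^bsub>B\<^esub>}" using G.f(1) cQ G.f_zero by auto
    then have "P B" using P(1) B(1) unfolding cstar_property_def by blast
    then have "in_class P ?Q"
      using star_isomorphism_inverse[OF Q(1) B(2)] Q(1) by (auto simp: in_class_def star_isomorphic_def)
    then show ?thesis using I by (simp add: ideal_rel_def)
  qed
  moreover have "ideal_rel P A K (J \<squnion>\<^bsub>Id_lattice A\<^esub> K)"
    if IJ: "ideal_rel P A I J" and K: "K \<in> closed_ideals A" "I \<subseteq> K" for I J K
  proof -
    have I: "I \<in> closed_ideals A" and J: "J \<in> closed_ideals A" and sub: "I \<subseteq> J"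
      and inP: "in_class P (subquotient A J I)"
      using IJ by (auto simp: ideal_rel_def)
    note S = sum_closed_ideal[OF J K(1)] and up = sum_ideal_upper[OF J K(1)]
    note Q = ideal_quotient[OF J I sub] and Q' = ideal_quotient[OF S K(1) up(2)]
      and iso = second_isomorphism[OF J K(1)]
    interpret F: cstar_epi "subalgebra_on A J" "subquotient A J I" "\<lambda>x. I +> x"
      by (rule cstar_epiI[OF cstar_algebra_ideal[OF J] Q(2,3)])
    have "I \<subseteq> J \<inter> K" using sub K(2) by blast
    then obtain h where "star_epi (subquotient A J I)
        (subquotient A (J <+>\<^bsub>A\<^esub> K) K) h"
      using F.factor[OF Q'(2) iso(1)] unfolding Q(4) iso(2) by blast
    then have "in_class P (subquotient A (J <+>\<^bsub>A\<^esub> K) K)"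
      by (rule in_class_epi[OF P inP Q'(2)])
    then show ?thesis using S K(1) up by (simp add: join_Id_lattice[OF J K(1)] ideal_rel_def)
  qed
  moreover have "I \<in> closed_ideals A \<and> J \<in> closed_ideals A \<and> I \<subseteq> J" if "ideal_rel P A I J" for I J
    using that by (simp add: ideal_rel_def)
  ultimately show ?thesis
    unfolding H_relation_def relation_in_def Id_lattice_simps by blast
qed

lemma proper_step_iff:
  "\<lbrakk>K \<in> closed_ideals A; L \<in> closed_ideals A\<rbrakk> \<Longrightarrow>
    K \<subset> L \<and> in_class P (subquotient A L K) \<longleftrightarrow> L \<noteq> K \<and> ideal_rel P A K L"
  by (auto simp: ideal_rel_def)

lemma ideal_rel_G_property:
  "ideal_rel (G_property P) A = stepwise_below (Id_lattice A) (ideal_rel P A)"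
proof (intro ext)
  fix I J
  show "ideal_rel (G_property P) A I J = stepwise_below (Id_lattice A) (ideal_rel P A) I J"
  proof (cases "I \<in> closed_ideals A \<and> J \<in> closed_ideals A \<and> I \<subseteq> J")
    case True
    then have "ideal_rel (G_property P) A I J \<longleftrightarrow>
        in_class (G_property P) (subquotient A J I)"
      by (simp add: ideal_rel_def)
    also have "\<dots> \<longleftrightarrow> stepwise_below (Id_lattice A) (ideal_rel P A) I J"
      using True
      by (simp add: in_class_G_property_iff stepwise_below_def proper_step_iff cong: ball_cong bex_cong)
    finally show ?thesis .
  qed (auto simp: ideal_rel_def stepwise_below_def)
qed

lemma ideal_rel_NG_property:
  assumes P: "cstar_property P" "upper_stable P"
  shows "ideal_rel (NG_property P) A = left_arrow (Id_lattice A) (ideal_rel P A)"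
proof (intro ext)
  interpret L: complete_lattice "Id_lattice A" by (rule complete_lattice_Id_lattice[OF cstar_algebra_axioms])
  note left = L.left_arrow_iff[OF H_relation_ideal_rel[OF P]]
  fix I J
  show "ideal_rel (NG_property P) A I J = left_arrow (Id_lattice A) (ideal_rel P A) I J"
  proof (cases "I \<in> closed_ideals A \<and> J \<in> closed_ideals A \<and> I \<subseteq> J")
    case True
    then have "ideal_rel (NG_property P) A I J \<longleftrightarrow>
        in_class (NG_property P) (subquotient A J I)"
      by (simp add: ideal_rel_def)
    also have "\<dots> \<longleftrightarrow> \<not> (\<exists>L\<in>closed_ideals A. L \<subseteq> J \<and> L \<noteq> I \<and> ideal_rel P A I L)"
      using True by (simp add: in_class_NG_property_iff proper_step_iff cong: bex_cong)
    also have "\<dots> \<longleftrightarrow> (\<forall>L. ideal_rel P A I L \<and> L \<subseteq> J \<longrightarrow> L = I)"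
    proof -
      have "L \<in> closed_ideals A" if "ideal_rel P A I L" for L using that by (simp add: ideal_rel_def)
      then show ?thesis by blast
    qed
    also have "\<dots> \<longleftrightarrow> left_arrow (Id_lattice A) (ideal_rel P A) I J"
      unfolding left using True by simp
    finally show ?thesis .
  next
    case False
    then show ?thesis unfolding left by (auto simp: ideal_rel_def)
  qed
qed

end

theorem theorem4p5:
  fixes P :: "'u cstar \<Rightarrow> bool" and A :: "'u cstar"
  assumes "cstar_property P" and "upper_stable P" and "cstar_algebra A"
  shows "(ideal_rel (G_property P) A = transfinite_closure (Id_lattice A) (ideal_rel P A) \<and>
          R_order (Id_lattice A) (ideal_rel (G_property P) A)) \<and>
         (ideal_rel (NG_property P) A = left_arrow (Id_lattice A) (ideal_rel P A) \<and>
          dual_R_order (Id_lattice A) (ideal_rel (NG_property P) A)) \<and>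
         radical (Id_lattice A) (transfinite_closure (Id_lattice A) (ideal_rel P A)) =
           radical (Id_lattice A) (ideal_rel (G_property P) A) \<and>
         radical (Id_lattice A) (ideal_rel (G_property P) A) =
           dual_radical (Id_lattice A) (ideal_rel (NG_property P) A)"
proof -
  interpret A: cstar_algebra A by fact
  interpret L: complete_lattice "Id_lattice A" by (rule complete_lattice_Id_lattice) fact
  note H = A.H_relation_ideal_rel[OF assms(1,2)]
  show ?thesis
    unfolding A.ideal_rel_G_property A.ideal_rel_NG_property[OF assms(1,2)]
    using L.transfinite_closure_eq_stepwise_below[OF H] L.R_order_stepwise_below[OF H]
      L.dual_R_order_left_arrow[OF H] L.radical_stepwise_below_eq_dual_radical_left_arrow[OF H]
    by simp
qed

end
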